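(* Let $G$ be a finite simple graph on $[n]$ with edge ideal $I(G)\subset S=K[x_1,\dots,x_n]$. Then $I(G)$ satisfies the $0$th and the first homological strong persistence properties. In particular, $I(G)$ satisfies the $0$th and the first homological persistence properties.
   Context: $K$ is a field and $S=K[x_1,\dots,x_n]$ is the standard graded polynomial ring. For a finite simple graph $G$ with vertex set $[n]=\{1,\dots,n\}$ and edge set $E(G)$, the edge ideal $I(G)\subset S$ is the ideal generated by the monomials $x_ix_j$ with $\{i,j\}\in E(G)$. For ${\bf a}=(a_1,\dots,a_n)\in\mathbb{Z}_{\ge0}^n$ put ${\bf x}^{\bf a}=x_1^{a_1}\cdots x_n^{a_n}$. The $i$th homological shift ideal of a monomial ideal $I\subset S$ is $\mathrm{HS}_i(I)=({\bf x}^{\bf a} : \mathrm{Tor}_i^S(K,I)_{\bf a}\ne0)$. For ideals $J,L$, $J:L$ denotes the colon ideal. $\mathrm{Ass}\,J$ denotes the set of associated primes of the ideal $J$ (that is, of $S/J$). $V(I)$ denotes the set of prime ideals of $S$ containing $I$. A monomial prime ideal is a prime ideal generated by a subset of the variables. For a monomial prime ideal $P\subset S$, $S(P)$ is the polynomial ring over $K$ in the variables which generate $P$, and for a monomial ideal $J\subset S$ the monomial localization $J(P)\subset S(P)$ is the monomial ideal obtained from $J$ by applying the substitutions $x_i\mapsto1$ for all $x_i\notin P$. A monomial ideal $I\subset S$ satisfies the $i$th homological persistence property if $\mathrm{Ass}\,\mathrm{HS}_i(I)\subseteq\mathrm{Ass}\,\mathrm{HS}_i(I^2)\subseteq\mathrm{Ass}\,\mathrm{HS}_i(I^3)\subseteq\cdots$.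 A monomial ideal $I\subset S$ satisfies the $i$th homological strong persistence property if for all monomial prime ideals $P\in V(I)$, all integers $k>0$, and any monomial $f\in(\mathrm{HS}_i(I^k):P)(P)\setminus\mathrm{HS}_i(I^k)(P)$, there exists a monomial $g\in I(P)$ such that $g\,\mathrm{HS}_i(I^k)(P)\subseteq\mathrm{HS}_i(I^{k+1})(P)$ and $fg\notin\mathrm{HS}_i(I^{k+1})(P)$.
   Formalization: In the strong persistence property the zero prime P is excluded; this matters only for a graph without edges, where I(G)=0, P=0 and f=1 would require a monomial g in the zero ideal, so the literal claim fails. *)

theory Defs
  imports "HOL-Library.Poly_Mapping" "HOL-Algebra.Ideal_Product"
begin

section \<open>Polynomial rings and monomials\<close>

text \<open>
  A polynomial over \<open>'k\<close> in variables indexed by natural numbers maps an exponent vector to its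
  coefficient. For a finite set \<open>V\<close> of variables, \<open>polyring V\<close> is the subring \<open>K[x_i : i \<in> V]\<close>; so
  \<open>S = polyring {1..n}\<close>, and the smaller rings \<open>S(P)\<close> are instances of the same construction.
\<close>

type_synonym 'k mpoly = "(nat \<Rightarrow>\<^sub>0 nat) \<Rightarrow>\<^sub>0 'k"

definition polyring :: "nat set \<Rightarrow> 'k::field mpoly ring" where
  "polyring V = \<lparr>carrier = {p. \<forall>a \<in> Poly_Mapping.keys p. Poly_Mapping.keys a \<subseteq> V},
     mult = (*), one = 1, zero = 0, add = (+)\<rparr>"

lemma polyring_cring: "cring (polyring V :: 'k::field mpoly ring)"
proof (rule cringI)
  let ?R = "polyring V :: 'k mpoly ring"
  have ops: "p \<oplus>\<^bsub>?R\<^esub> q = p + q" "p \<otimes>\<^bsub>?R\<^esub> q = p * q" "\<zero>\<^bsub>?R\<^esub> = 0" "\<one>\<^bsub>?R\<^esub> = 1"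
    "0 \<in> carrier ?R" "1 \<in> carrier ?R" for p q
    by (simp_all add: polyring_def)
  have add: "p + q \<in> carrier ?R" if "p \<in> carrier ?R" "q \<in> carrier ?R" for p q
    using that Poly_Mapping.keys_add[of p q] by (fastforce simp: polyring_def)
  have mult: "p * q \<in> carrier ?R" if "p \<in> carrier ?R" "q \<in> carrier ?R" for p q
  proof -
    have "Poly_Mapping.keys a \<subseteq> V" if a: "a \<in> Poly_Mapping.keys (p * q)" for a
    proof -
      obtain b c where "a = b + c" "b \<in> Poly_Mapping.keys p" "c \<in> Poly_Mapping.keys q"
        using a keys_mult[of p q] by blast
      then show ?thesis
        using Poly_Mapping.keys_add[of b c] \<open>p \<in> carrier ?R\<close> \<open>q \<in> carrier ?R\<close>
        unfolding polyring_def by fastforce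
    qed
    then show ?thesis
      by (simp add: polyring_def)
  qed
  show "abelian_group ?R"
  proof (rule abelian_groupI)
    fix p
    assume "p \<in> carrier ?R"
    then have "- p \<in> carrier ?R"
      by (simp add: polyring_def)
    moreover have "- p \<oplus>\<^bsub>?R\<^esub> p = \<zero>\<^bsub>?R\<^esub>"
      by (simp add: polyring_def)
    ultimately show "\<exists>q \<in> carrier ?R. q \<oplus>\<^bsub>?R\<^esub> p = \<zero>\<^bsub>?R\<^esub>"
      by blast
  qed (simp_all add: ops add ac_simps)
  show "comm_monoid ?R"
    by (rule comm_monoidI) (simp_all add: ops mult ac_simps)
qed (simp add: polyring_def distrib_right)

definition monom :: "(nat \<Rightarrow>\<^sub>0 nat) \<Rightarrow> 'k::field mpoly" where
  "monom a = Poly_Mapping.single a 1"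

definition Var :: "nat \<Rightarrow> 'k::field mpoly" where
  "Var i = monom (Poly_Mapping.single i 1)"

definition colon_ideal :: "('a, 'b) ring_scheme \<Rightarrow> 'a set \<Rightarrow> 'a set \<Rightarrow> 'a set" where
  "colon_ideal R J L = {r \<in> carrier R. \<forall>p \<in> L. r \<otimes>\<^bsub>R\<^esub> p \<in> J}"

text \<open>A prime \<open>P\<close> is associated to \<open>R/J\<close> if it is the annihilator of a residue class \<open>f + J\<close>.\<close>

definition Ass :: "('a, 'b) ring_scheme \<Rightarrow> 'a set \<Rightarrow> 'a set set" where
  "Ass R J = {P. primeideal P R \<and> (\<exists>f \<in> carrier R. P = {r \<in> carrier R. r \<otimes>\<^bsub>R\<^esub> f \<in> J})}"

definition V_of :: "('a, 'b) ring_scheme \<Rightarrow> 'a set \<Rightarrow> 'a set set" where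
  "V_of R I = {P. primeideal P R \<and> I \<subseteq> P}"

abbreviation ideal_power :: "('a, 'b) ring_scheme \<Rightarrow> 'a set \<Rightarrow> nat \<Rightarrow> 'a set" where
  "ideal_power R I k \<equiv> I [^]\<^bsub>ideals_set R\<^esub> k"


section \<open>Edge ideals\<close>

definition simple_graph :: "nat \<Rightarrow> nat set set \<Rightarrow> bool" where
  "simple_graph n E \<longleftrightarrow> (\<forall>e \<in> E. e \<subseteq> {1..n} \<and> card e = 2)"

definition edge_ideal :: "nat \<Rightarrow> nat set set \<Rightarrow> 'k::field mpoly set" where
  "edge_ideal n E = Idl\<^bsub>polyring {1..n}\<^esub> {Var i * Var j | i j. {i, j} \<in> E}"


section \<open>Multigraded Tor and homological shift ideals\<close>

text \<open>
  \<open>Tor_i(K, J)\<close> is the \<open>i\<close>-th homology of \<open>F \<otimes> J\<close> for a multigraded free resolution \<open>F\<close> of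
  \<open>K = S/(x_i : i \<in> V)\<close>; for \<open>F\<close> we take the Koszul complex on the variables. Its \<open>i\<close>-th module is
  free on the symbols \<open>e_T\<close> with \<open>T \<subseteq> V\<close>, \<open>|T| = i\<close>, where \<open>e_T\<close> has multidegree \<open>sqfree T\<close>, and
  \<open>d e_T\<close> is the sum over \<open>j \<in> T\<close> of \<open>ksign j (T - {j}) x_j e_{T - {j}}\<close>.
  An element of \<open>F_i \<otimes> J\<close> is represented by its coefficient function \<open>c\<close>, extended by \<open>0\<close> to all sets.
  That this complex is a resolution of \<open>K\<close> is shown in \<open>koszul_diff_diff\<close> and \<open>koszul_resolution\<close>.
\<close>

definition sqfree :: "nat set \<Rightarrow> (nat \<Rightarrow>\<^sub>0 nat)" where
  "sqfree T = (\<Sum>j\<in>T. Poly_Mapping.single j 1)"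

definition ksign :: "nat \<Rightarrow> nat set \<Rightarrow> 'k::field mpoly" where
  "ksign j T = (- 1) ^ card {k \<in> T. k < j}"

text \<open>The component of multidegree \<open>a\<close> of \<open>F_i \<otimes> J\<close>.\<close>

definition koszul_chains ::
    "nat set \<Rightarrow> 'k::field mpoly set \<Rightarrow> nat \<Rightarrow> (nat \<Rightarrow>\<^sub>0 nat) \<Rightarrow> (nat set \<Rightarrow> 'k mpoly) set" where
  "koszul_chains V J i a = {c. \<forall>T.
     if T \<subseteq> V \<and> card T = i
     then c T \<in> J \<and> (\<forall>b \<in> Poly_Mapping.keys (c T). b + sqfree T = a)
     else c T = 0}"

definition koszul_diff :: "nat set \<Rightarrow> (nat set \<Rightarrow> 'k::field mpoly) \<Rightarrow> (nat set \<Rightarrow> 'k mpoly)" where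
  "koszul_diff V c = (\<lambda>T. \<Sum>j\<in>V - T. ksign j T * Var j * c (insert j T))"

definition tor_cycles ::
    "nat set \<Rightarrow> 'k::field mpoly set \<Rightarrow> nat \<Rightarrow> (nat \<Rightarrow>\<^sub>0 nat) \<Rightarrow> (nat set \<Rightarrow> 'k mpoly) set" where
  "tor_cycles V J i a = {c \<in> koszul_chains V J i a. koszul_diff V c = (\<lambda>_. 0)}"

definition tor_boundaries ::
    "nat set \<Rightarrow> 'k::field mpoly set \<Rightarrow> nat \<Rightarrow> (nat \<Rightarrow>\<^sub>0 nat) \<Rightarrow> (nat set \<Rightarrow> 'k mpoly) set" where
  "tor_boundaries V J i a = koszul_diff V ` koszul_chains V J (Suc i) a"

definition Tor_nonzero :: "nat set \<Rightarrow> nat \<Rightarrow> 'k::field mpoly set \<Rightarrow> (nat \<Rightarrow>\<^sub>0 nat) \<Rightarrow> bool" where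
  "Tor_nonzero V i J a \<longleftrightarrow> \<not> tor_cycles V J i a \<subseteq> tor_boundaries V J i a"

definition HS :: "nat set \<Rightarrow> nat \<Rightarrow> 'k::field mpoly set \<Rightarrow> 'k mpoly set" where
  "HS V i I = Idl\<^bsub>polyring V\<^esub> {monom a | a. Poly_Mapping.keys a \<subseteq> V \<and> Tor_nonzero V i I a}"


section \<open>Monomial localization and the persistence properties\<close>

definition monomial_prime :: "nat set \<Rightarrow> 'k::field mpoly set \<Rightarrow> bool" where
  "monomial_prime V P \<longleftrightarrow>
     primeideal P (polyring V) \<and> (\<exists>W \<subseteq> V. P = Idl\<^bsub>polyring V\<^esub> (Var ` W))"

definition vars_in :: "nat set \<Rightarrow> 'k::field mpoly set \<Rightarrow> nat set" where
  "vars_in V P = {i \<in> V. Var i \<in> P}"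

definition restrict_exp :: "nat set \<Rightarrow> (nat \<Rightarrow>\<^sub>0 nat) \<Rightarrow> (nat \<Rightarrow>\<^sub>0 nat)" where
  "restrict_exp W a = (\<Sum>i \<in> Poly_Mapping.keys a \<inter> W. Poly_Mapping.single i (Poly_Mapping.lookup a i))"

text \<open>The substitution \<open>x_i \<mapsto> 1\<close> for all \<open>i \<notin> W\<close>.\<close>

definition subst_one :: "nat set \<Rightarrow> 'k::field mpoly \<Rightarrow> 'k mpoly" where
  "subst_one W p =
     (\<Sum>a \<in> Poly_Mapping.keys p. Poly_Mapping.single (restrict_exp W a) (Poly_Mapping.lookup p a))"

text \<open>
  \<open>J(P)\<close>: the substitution is a surjective ring homomorphism from \<open>S\<close> onto
  \<open>S(P) = polyring (vars_in V P)\<close>, so the image of an ideal of \<open>S\<close> is an ideal of \<open>S(P)\<close>.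
\<close>

definition localize :: "nat set \<Rightarrow> 'k::field mpoly set \<Rightarrow> 'k mpoly set \<Rightarrow> 'k mpoly set" where
  "localize V P J = subst_one (vars_in V P) ` J"

definition homological_persistence :: "nat set \<Rightarrow> nat \<Rightarrow> 'k::field mpoly set \<Rightarrow> bool" where
  "homological_persistence V i I \<longleftrightarrow>
     (\<forall>k\<ge>1. Ass (polyring V) (HS V i (ideal_power (polyring V) I k))
          \<subseteq> Ass (polyring V) (HS V i (ideal_power (polyring V) I (k + 1))))"

text \<open>
  The zero prime is excluded. It lies in \<open>V(I)\<close> only for \<open>I = 0\<close>, and there the condition would
  ask for a monomial in the zero ideal (take \<open>f = 1\<close>), so it could never hold.
\<close>

definition homological_strong_persistence :: "nat set \<Rightarrow> nat \<Rightarrow> 'k::field mpoly set \<Rightarrow> bool" where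
  "homological_strong_persistence V i I \<longleftrightarrow>
     (\<forall>P k a.
        monomial_prime V P \<and> P \<noteq> {0} \<and> P \<in> V_of (polyring V) I \<and> k > 0 \<and>
        monom a \<in> localize V P (colon_ideal (polyring V) (HS V i (ideal_power (polyring V) I k)) P)
                   - localize V P (HS V i (ideal_power (polyring V) I k)) \<longrightarrow>
        (\<exists>b. monom b \<in> localize V P I \<and>
             (\<forall>h \<in> localize V P (HS V i (ideal_power (polyring V) I k)).
                monom b * h \<in> localize V P (HS V i (ideal_power (polyring V) I (k + 1)))) \<and>
             monom a * monom b \<notin> localize V P (HS V i (ideal_power (polyring V) I (k + 1)))))"


section \<open>The Koszul complex is a multigraded free resolution of \<open>K\<close>\<close>

lemma lookup_sqfree:
  assumes "finite T"
  shows "Poly_Mapping.lookup (sqfree T) i = (if i \<in> T then 1 else 0)"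
proof -
  have "Poly_Mapping.lookup (sqfree T) i = (\<Sum>j\<in>T. if j = i then 1 else 0)"
    unfolding sqfree_def lookup_sum by (intro sum.cong) (simp_all add: lookup_single when_def)
  then show ?thesis
    using assms by (simp add: sum.delta')
qed

lemma sqfree_insert: "finite T \<Longrightarrow> j \<notin> T \<Longrightarrow> sqfree (insert j T) = Poly_Mapping.single j 1 + sqfree T"
  by (simp add: sqfree_def)

lemma ksign_insert:
  assumes "finite T" "k \<notin> T"
  shows "ksign j (insert k T) = (if k < j then - ksign j T else ksign j T)"
proof (cases "k < j")
  case True
  then have "{l \<in> insert k T. l < j} = insert k {l \<in> T. l < j}"
    by auto
  with True assms show ?thesis
    by (simp add: ksign_def)
next
  case False
  then have "{l \<in> insert k T. l < j} = {l \<in> T. l < j}"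
    by auto
  with False show ?thesis
    by (simp add: ksign_def)
qed

lemma ksign_square: "ksign j T * ksign j T = 1"
  by (simp add: ksign_def flip: power_add mult_2)

lemma ksign_anticomm:
  assumes "finite T" "j \<notin> T" "k \<notin> T" "j \<noteq> k"
  shows "ksign k (insert j T) * ksign j T = - (ksign j (insert k T) * ksign k T :: 'k::field mpoly)"
  using assms by (auto simp: ksign_insert mult.commute)

lemma koszul_diff_diff:
  assumes "finite V" "c \<in> koszul_chains V J i a"
  shows "koszul_diff V (koszul_diff V c) = (\<lambda>_. 0)"
proof
  fix T
  show "koszul_diff V (koszul_diff V c) T = 0"
  proof (cases "T \<subseteq> V")
    case False
    then have "c (insert k (insert j T)) = 0" for j k
      using assms(2) by (auto simp: koszul_chains_def)
    then show ?thesis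
      by (simp add: koszul_diff_def)
  next
    case True
    with assms(1) have fin: "finite T"
      by (rule finite_subset[rotated])
    define D where "D = {p \<in> (V - T) \<times> (V - T). fst p \<noteq> snd p}"
    define D1 where "D1 = {p \<in> D. fst p < snd p}"
    define D2 where "D2 = {p \<in> D. snd p < fst p}"
    define F where "F p = (case p of (j, k) \<Rightarrow>
      ksign j T * Var j * (ksign k (insert j T) * Var k * c (insert k (insert j T))))" for p
    have finD: "finite D1" "finite D2"
      using assms(1) by (auto simp: D_def D1_def D2_def)
    have "koszul_diff V (koszul_diff V c) T = (\<Sum>j\<in>V - T. \<Sum>k\<in>V - insert j T. F (j, k))"
      by (simp add: koszul_diff_def F_def sum_distrib_left)
    also have "\<dots> = sum F (Sigma (V - T) (\<lambda>j. V - insert j T))"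
      using assms(1) by (subst sum.Sigma) auto
    also have "Sigma (V - T) (\<lambda>j. V - insert j T) = D1 \<union> D2"
      by (auto simp: D_def D1_def D2_def)
    also have "sum F (D1 \<union> D2) = sum F D1 + sum F D2"
      using finD by (intro sum.union_disjoint) (auto simp: D1_def D2_def)
    also have "sum F D2 = (\<Sum>p\<in>D1. F (snd p, fst p))"
      by (rule sum.reindex_bij_witness[where i = prod.swap and j = prod.swap])
        (auto simp: D_def D1_def D2_def)
    also have "\<dots> = (\<Sum>p\<in>D1. - F p)"
    proof (rule sum.cong[OF refl])
      fix p
      assume "p \<in> D1"
      then obtain j k where p: "p = (j, k)" "j \<notin> T" "k \<notin> T" "j \<noteq> k"
        by (cases p) (auto simp: D1_def D_def)
      have *: "F (j, k) = (ksign k (insert j T) * ksign j T) * (Var j * Var k * c (insert k (insert j T)))"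
        "F (k, j) = (ksign j (insert k T) * ksign k T) * (Var j * Var k * c (insert k (insert j T)))"
        by (simp_all add: F_def insert_commute ac_simps)
      show "F (snd p, fst p) = - F p"
        using ksign_anticomm[OF fin p(2-4), where ?'k = 'a] by (simp add: p(1) *)
    qed
    finally show ?thesis
      by (simp add: sum_negf)
  qed
qed

lemma lookup_single_mult:
  fixes p :: "'k::field mpoly"
  shows "Poly_Mapping.lookup (Poly_Mapping.single u 1 * p) (u + b) = Poly_Mapping.lookup p b"
  by (simp add: lookup_mult lookup_single when_mult)

lemma Var_mult_cancel:
  fixes p q :: "'k::field mpoly"
  assumes "Var j * p = Var j * q"
  shows "p = q"
proof (rule poly_mapping_eqI)
  fix b
  show "Poly_Mapping.lookup p b = Poly_Mapping.lookup q b"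
    using arg_cong[OF assms, where f = "\<lambda>r. Poly_Mapping.lookup r (Poly_Mapping.single j 1 + b)"]
    by (simp add: Var_def monom_def lookup_single_mult)
qed

lemma ksign_cases: "(ksign j T :: 'k::field mpoly) = 1 \<or> (ksign j T :: 'k::field mpoly) = - 1"
  unfolding ksign_def by (metis neg_one_even_power neg_one_odd_power)

lemma keys_ksign_mult:
  fixes p :: "'k::field mpoly"
  shows "Poly_Mapping.keys (ksign j T * p) = Poly_Mapping.keys p"
  using ksign_cases[of j T, where ?'k = 'k] by (elim disjE) simp_all

lemma koszul_exact:
  fixes c :: "nat set \<Rightarrow> 'k::field mpoly"
  assumes V: "finite V" and "a \<noteq> 0" and c: "c \<in> tor_cycles V (carrier (polyring V)) i a"
  shows "c \<in> tor_boundaries V (carrier (polyring V)) i a"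
proof -
  from \<open>a \<noteq> 0\<close> obtain j where j: "Poly_Mapping.lookup a j > 0"
    by (metis gr0I poly_mapping_eqI lookup_zero)
  have cch: "c \<in> koszul_chains V (carrier (polyring V)) i a" and dc: "koszul_diff V c = (\<lambda>_. 0)"
    using c by (auto simp: tor_cycles_def)
  have c0: "c T = 0" if "\<not> (T \<subseteq> V \<and> card T = i)" for T
    using cch that by (auto simp: koszul_chains_def)
  have ckeys: "T \<subseteq> V" "card T = i" "finite T" "m + sqfree T = a" "Poly_Mapping.keys m \<subseteq> V"
    if "m \<in> Poly_Mapping.keys (c T)" for m T
  proof -
    have "T \<subseteq> V \<and> card T = i"
      using that c0[of T] by (metis empty_iff keys_zero)
    then show T: "T \<subseteq> V" "card T = i"
      by auto
    then show "finite T"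
      using V by (auto intro: finite_subset)
    from T show "m + sqfree T = a" "Poly_Mapping.keys m \<subseteq> V"
      using cch that T by (auto simp: koszul_chains_def polyring_def dest!: spec[of _ T]) blast
  qed
  define l where "l T = Poly_Mapping.lookup (c T) (a - sqfree T)" for T
  have cl: "c T = Poly_Mapping.single (a - sqfree T) (l T)" for T
  proof (rule poly_mapping_eqI)
    fix m
    show "Poly_Mapping.lookup (c T) m =
        Poly_Mapping.lookup (Poly_Mapping.single (a - sqfree T) (l T)) m"
    proof (cases "m = a - sqfree T")
      case False
      then have "m \<notin> Poly_Mapping.keys (c T)"
        using ckeys(4)[of m T] by auto
      with False show ?thesis
        by (simp add: in_keys_iff lookup_single when_def)
    qed (simp add: l_def)
  qed
  define b where "b T = (if T \<subseteq> V \<and> card T = Suc i \<and> j \<in> T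
    then ksign j (T - {j}) * Poly_Mapping.single (a - sqfree T) (l (T - {j})) else 0)" for T
  have deg: "a - sqfree T + sqfree T = a"
      "Poly_Mapping.single j 1 + (a - sqfree T) = a - sqfree (T - {j})"
      "Poly_Mapping.keys (a - sqfree T) \<subseteq> V" "j \<in> V"
    if "l (T - {j}) \<noteq> 0" "j \<in> T" for T
  proof -
    let ?R = "T - {j}" and ?m = "a - sqfree (T - {j})"
    have m: "?m \<in> Poly_Mapping.keys (c ?R)"
      using that(1) by (simp add: l_def in_keys_iff)
    note R = ckeys[OF m]
    have T: "T = insert j ?R"
      using that by auto
    have e: "sqfree T = Poly_Mapping.single j 1 + sqfree ?R"
      by (subst T, rule sqfree_insert) (use R in auto)
    have mj: "Poly_Mapping.lookup ?m j > 0"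
      using arg_cong[OF R(4), where f = "\<lambda>p. Poly_Mapping.lookup p j"] j R(3)
      by (simp add: lookup_add lookup_sqfree)
    then show "j \<in> V"
      using R(5) by (auto simp: in_keys_iff)
    have am: "a - sqfree T = ?m - Poly_Mapping.single j 1"
      unfolding e by (rule poly_mapping_eqI) (simp add: lookup_minus lookup_add)
    show s: "Poly_Mapping.single j 1 + (a - sqfree T) = ?m"
      unfolding am using mj
      by (intro poly_mapping_eqI) (auto simp: lookup_minus lookup_add lookup_single when_def)
    show "a - sqfree T + sqfree T = a"
      using s R(4) e by (metis add.assoc add.commute)
    show "Poly_Mapping.keys (a - sqfree T) \<subseteq> V"
      using R(5) s by (metis am in_keys_iff lookup_minus diff_0_eq_0 subset_iff)
  qed
  have bX: "Var j * b T = ksign j (T - {j}) * c (T - {j})"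
    if "T \<subseteq> V" "card T = Suc i" "j \<in> T" for T
  proof (cases "l (T - {j}) = 0")
    case True
    then show ?thesis
      using that by (simp add: b_def cl[of "T - {j}"])
  next
    case False
    have "Var j * Poly_Mapping.single (a - sqfree T) (l (T - {j})) = c (T - {j})"
      using deg(2)[OF False that(3)] by (simp add: cl[of "T - {j}"] Var_def monom_def mult_single)
    then show ?thesis
      using that by (simp add: b_def mult.left_commute)
  qed
  have "b \<in> koszul_chains V (carrier (polyring V)) (Suc i) a"
    unfolding koszul_chains_def
  proof (intro CollectI allI)
    fix T
    have "b T \<in> carrier (polyring V) \<and> (\<forall>m\<in>Poly_Mapping.keys (b T). m + sqfree T = a)"
      using deg[of T] by (auto simp: b_def polyring_def keys_ksign_mult split: if_splits)
    then show "if T \<subseteq> V \<and> card T = Suc i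
        then b T \<in> carrier (polyring V) \<and> (\<forall>m\<in>Poly_Mapping.keys (b T). m + sqfree T = a)
        else b T = 0"
      by (auto simp: b_def)
  qed
  moreover have "koszul_diff V b = c"
  proof
    fix T
    consider "\<not> (T \<subseteq> V \<and> card T = i)" | "T \<subseteq> V" "card T = i" "j \<notin> V"
      | "T \<subseteq> V" "card T = i" "j \<in> V" "j \<notin> T" | "T \<subseteq> V" "card T = i" "j \<in> V" "j \<in> T"
      by blast
    then show "koszul_diff V b T = c T"
    proof cases
      case 1
      have "b (insert k T) = 0" if "k \<in> V - T" for k
      proof (cases "T \<subseteq> V")
        case True
        with V have "finite T"
          by (rule finite_subset[rotated])
        with 1 True that show ?thesis
          by (auto simp: b_def)
      qed (auto simp: b_def)
      with c0[OF 1] show ?thesis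
        by (simp add: koszul_diff_def)
    next
      case 2
      have "c T = 0"
      proof (rule ccontr)
        assume "c T \<noteq> 0"
        then obtain m where "m \<in> Poly_Mapping.keys (c T)"
          by (metis all_not_in_conv keys_eq_empty)
        note m = ckeys[OF this]
        have "Poly_Mapping.lookup m j > 0"
          using arg_cong[OF m(4), where f = "\<lambda>p. Poly_Mapping.lookup p j"] j m(1,3) 2(3)
          by (auto simp: lookup_add lookup_sqfree split: if_splits)
        then have "j \<in> Poly_Mapping.keys m"
          by (simp add: in_keys_iff)
        with m(5) 2(3) show False
          by blast
      qed
      moreover have "b (insert k T) = 0" for k
        using 2(3) by (auto simp: b_def)
      ultimately show ?thesis
        by (simp add: koszul_diff_def)
    next
      case 3
      have fin: "finite T"
        using 3(1) V by (rule finite_subset)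
      have "koszul_diff V b T = (\<Sum>k\<in>{j}. ksign k T * Var k * b (insert k T))"
        unfolding koszul_diff_def
        by (rule sum.mono_neutral_right) (use V 3 in \<open>auto simp: b_def\<close>)
      also have "\<dots> = ksign j T * (Var j * b (insert j T))"
        by (simp add: mult.assoc)
      also have "Var j * b (insert j T) = ksign j T * c T"
        using bX[of "insert j T"] 3 fin by simp
      finally show ?thesis
        using ksign_square[of j T, where ?'a = 'k] by (simp flip: mult.assoc)
    next
      case 4
      define R where "R = T - {j}"
      have T: "T = insert j R" "j \<notin> R"
        using 4 by (auto simp: R_def)
      have fin: "finite T"
        using 4(1) V by (rule finite_subset)
      then have finR: "finite R"
        by (simp add: R_def)
      have VR: "V - R = insert j (V - T)"
        using 4 by (auto simp: R_def)
      define s where "s = (\<Sum>k\<in>V - T. ksign k R * Var k * c (insert k R))"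
      have "0 = koszul_diff V c R"
        by (simp add: dc)
      also have "\<dots> = ksign j R * Var j * c T + s"
        using V by (simp add: koszul_diff_def VR s_def T(1)[symmetric] \<open>j \<in> T\<close>)
      finally have "ksign j R * (ksign j R * Var j * c T + s) = 0"
        by simp
      then have *: "Var j * c T = - (ksign j R * s)"
        using ksign_square[of j R, where ?'a = 'k]
        by (simp add: distrib_left eq_neg_iff_add_eq_0 flip: mult.assoc)
      have "Var j * koszul_diff V b T
          = (\<Sum>k\<in>V - T. ksign k T * Var k * (Var j * b (insert k T)))"
        by (simp add: koszul_diff_def sum_distrib_left mult.left_commute)
      also have "\<dots> = (\<Sum>k\<in>V - T. - (ksign j R * (ksign k R * Var k * c (insert k R))))"
      proof (rule sum.cong[OF refl])
        fix k
        assume k: "k \<in> V - T"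
        then have kj: "k \<noteq> j" "k \<notin> R"
          using 4 by (auto simp: R_def)
        have "insert k T - {j} = insert k R"
          using kj by (auto simp: R_def)
        then have "Var j * b (insert k T) = ksign j (insert k R) * c (insert k R)"
          using bX[of "insert k T"] k 4 fin by simp
        then have "ksign k T * Var k * (Var j * b (insert k T))
            = (ksign k (insert j R) * ksign j (insert k R)) * (Var k * c (insert k R))"
          by (simp add: T(1)[symmetric] ac_simps)
        also have "ksign k (insert j R) * ksign j (insert k R) = - (ksign j R * ksign k R :: 'k mpoly)"
          using kj T(2) finR by (auto simp: ksign_insert)
        finally show "ksign k T * Var k * (Var j * b (insert k T))
            = - (ksign j R * (ksign k R * Var k * c (insert k R)))"
          by (simp add: mult.assoc)
      qed
      also have "\<dots> = - (ksign j R * s)"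
        by (simp add: s_def sum_negf sum_distrib_left)
      also have "\<dots> = Var j * c T"
        by (simp add: *)
      finally show ?thesis
        by (rule Var_mult_cancel)
    qed
  qed
  ultimately show ?thesis
    by (auto simp: tor_boundaries_def)
qed

lemma koszul_diff_chains:
  assumes V: "finite V" and c: "c \<in> koszul_chains V (carrier (polyring V)) (Suc i) a"
  shows "koszul_diff V c \<in> koszul_chains V (carrier (polyring V)) i a"
  unfolding koszul_chains_def
proof (intro CollectI allI)
  fix T
  have c0: "c U = 0" if "\<not> (U \<subseteq> V \<and> card U = Suc i)" for U
    using c that by (auto simp: koszul_chains_def)
  have ckeys: "U \<subseteq> V" "card U = Suc i" "m + sqfree U = a" "Poly_Mapping.keys m \<subseteq> V"
    if "m \<in> Poly_Mapping.keys (c U)" for m U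
  proof -
    have "U \<subseteq> V \<and> card U = Suc i"
      using that c0[of U] by (metis empty_iff keys_zero)
    then show U: "U \<subseteq> V" "card U = Suc i"
      by auto
    from U show "m + sqfree U = a" "Poly_Mapping.keys m \<subseteq> V"
      using c that U by (auto simp: koszul_chains_def polyring_def dest!: spec[of _ U]) blast
  qed
  have *: "m + sqfree T = a \<and> Poly_Mapping.keys m \<subseteq> V \<and> T \<subseteq> V \<and> card T = i"
    if "m \<in> Poly_Mapping.keys (koszul_diff V c T)" for m
  proof -
    from that obtain j where j: "j \<in> V - T"
      "m \<in> Poly_Mapping.keys (ksign j T * (Var j * c (insert j T)))"
      unfolding koszul_diff_def using keys_sum[of "\<lambda>j. ksign j T * Var j * c (insert j T)" "V - T"]
      by (auto simp: mult.assoc)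
    then have "m \<in> Poly_Mapping.keys (Var j * c (insert j T))"
      by (simp add: keys_ksign_mult)
    then obtain u where u: "m = Poly_Mapping.single j 1 + u" "u \<in> Poly_Mapping.keys (c (insert j T))"
      using keys_mult[of "Var j" "c (insert j T)"] by (auto simp: Var_def monom_def)
    note k = ckeys[OF u(2)]
    have fin: "finite T"
      using k(1) V by (meson finite_insert finite_subset)
    have "m + sqfree T = a"
      using k(3) j(1) fin by (simp add: u(1) sqfree_insert ac_simps)
    moreover have "Poly_Mapping.keys m \<subseteq> V"
      using keys_add[of "Poly_Mapping.single j 1" u] k(4) j(1) by (auto simp: u(1))
    ultimately show ?thesis
      using k(1,2) j(1) fin by auto
  qed
  show "if T \<subseteq> V \<and> card T = i
      then koszul_diff V c T \<in> carrier (polyring V) \<and>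
        (\<forall>m\<in>Poly_Mapping.keys (koszul_diff V c T). m + sqfree T = a)
      else koszul_diff V c T = 0"
  proof (cases "T \<subseteq> V \<and> card T = i")
    case True
    with * show ?thesis
      by (simp add: polyring_def)
  next
    case False
    with * have "Poly_Mapping.keys (koszul_diff V c T) = {}"
      by blast
    with False show ?thesis
      by (simp only: if_False keys_eq_empty)
  qed
qed

text \<open>
  Exactness in each multidegree: for coefficients in \<open>S\<close> the only homology sits in homological
  degree \<open>0\<close> and multidegree \<open>0\<close>, where it is \<open>K\<close>.
\<close>

lemma koszul_resolution:
  assumes V: "finite V"
  shows "i \<noteq> 0 \<or> a \<noteq> 0 \<Longrightarrow>
      tor_cycles V (carrier (polyring V)) i a
      = tor_boundaries V (carrier (polyring V) :: 'k::field mpoly set) i a"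
    and "tor_cycles V (carrier (polyring V)) 0 0
      = range (\<lambda>u T. if T = {} then Poly_Mapping.single 0 (u::'k) else 0)"
    and "tor_boundaries V (carrier (polyring V)) 0 0 = {\<lambda>_. 0 :: 'k mpoly}"
proof -
  have sub: "tor_boundaries V (carrier (polyring V)) i a \<subseteq> tor_cycles V (carrier (polyring V) :: 'k mpoly set) i a"
    for i a
    using koszul_diff_chains[OF V] koszul_diff_diff[OF V]
    by (auto simp: tor_boundaries_def tor_cycles_def)
  have zero: "c = (\<lambda>_. 0)" if "c \<in> koszul_chains V (carrier (polyring V)) i 0" "i \<noteq> 0"
    for c :: "nat set \<Rightarrow> 'k mpoly" and i
  proof
    fix T
    show "c T = 0"
    proof (rule ccontr)
      assume "c T \<noteq> 0"
      moreover then obtain m where "m \<in> Poly_Mapping.keys (c T)"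
        by (metis all_not_in_conv keys_eq_empty)
      ultimately have T: "T \<subseteq> V" "card T = i" "m + sqfree T = 0"
        using that(1) by (auto simp: koszul_chains_def split: if_splits dest!: spec[of _ T])
      then obtain j where "j \<in> T"
        using \<open>i \<noteq> 0\<close> by fastforce
      moreover have "finite T"
        using T(1) V by (rule finite_subset)
      ultimately show False
        using arg_cong[OF T(3), where f = "\<lambda>p. Poly_Mapping.lookup p j"]
        by (simp add: lookup_add lookup_sqfree)
    qed
  qed
  have diff0: "koszul_diff V (\<lambda>_. 0) = (\<lambda>_. 0 :: 'k mpoly)"
    by (simp add: koszul_diff_def)
  have chain0: "(\<lambda>_. 0) \<in> koszul_chains V (carrier (polyring V) :: 'k mpoly set) i a" for i a
    by (simp add: koszul_chains_def polyring_def)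
  have bd0: "(\<lambda>_. 0) \<in> tor_boundaries V (carrier (polyring V) :: 'k mpoly set) i a" for i a
    unfolding tor_boundaries_def using diff0 chain0 by (metis imageI)
  show "tor_cycles V (carrier (polyring V) :: 'k mpoly set) i a
      = tor_boundaries V (carrier (polyring V)) i a"
    if "i \<noteq> 0 \<or> a \<noteq> 0"
  proof (cases "a = 0")
    case True
    then show ?thesis
      using that sub[of i a] zero[of _ i] bd0[of i a] by (auto simp: tor_cycles_def)
  next
    case False
    then show ?thesis
      using koszul_exact[OF V False] sub by blast
  qed
  show "tor_boundaries V (carrier (polyring V)) 0 0 = {\<lambda>_. 0 :: 'k mpoly}"
    using zero[of _ "Suc 0"] bd0[of 0 0] diff0 by (auto simp: tor_boundaries_def)
  show "tor_cycles V (carrier (polyring V)) 0 0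
      = range (\<lambda>u T. if T = {} then Poly_Mapping.single 0 (u::'k) else 0)" (is "?L = ?R")
  proof
    show "?L \<subseteq> ?R"
    proof
      fix c
      assume "c \<in> ?L"
      then have c: "c \<in> koszul_chains V (carrier (polyring V)) 0 0"
        by (simp add: tor_cycles_def)
      have fin: "finite T" if "T \<subseteq> V" for T
        using that V by (rule finite_subset)
      have "c T = (if T = {} then Poly_Mapping.single 0 (Poly_Mapping.lookup (c {}) 0) else 0)" for T
      proof (cases "T = {}")
        case True
        have "\<forall>m\<in>Poly_Mapping.keys (c {}). m = 0"
          using c by (auto simp: koszul_chains_def sqfree_def dest!: spec[of _ "{}"])
        then have "c {} = Poly_Mapping.single 0 (Poly_Mapping.lookup (c {}) 0)"
          by (intro poly_mapping_eqI) (auto simp: lookup_single when_def in_keys_iff)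
        with True show ?thesis
          by simp
      next
        case False
        then show ?thesis
          using c fin[of T] by (auto simp: koszul_chains_def split: if_splits dest!: spec[of _ T])
      qed
      then show "c \<in> ?R"
        by blast
    qed
    show "?R \<subseteq> ?L"
    proof
      fix c
      assume "c \<in> ?R"
      then obtain u where c: "c = (\<lambda>T. if T = {} then Poly_Mapping.single 0 (u::'k) else 0)"
        by blast
      have fin: "finite T" if "T \<subseteq> V" for T
        using that V by (rule finite_subset)
      have "c \<in> koszul_chains V (carrier (polyring V)) 0 0"
        using fin by (auto simp: c koszul_chains_def polyring_def sqfree_def)
      then show "c \<in> ?L"
        by (simp add: tor_cycles_def koszul_diff_def c)
    qed
  qed
qed

end

theory Submission
  imports Defs "HOL-Library.Multiset"
begin

text \<open>
  Membership in the ideals of the statement is a matter of packing edges. A monomial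
  \<open>x\<^sup>f\<close> lies in \<open>I(G)\<^sup>k\<close> iff some multiset of \<open>k\<close> edges has all its vertex
  degrees bounded by \<open>f\<close>. For every monomial ideal \<open>J\<close> one has \<open>HS_0(J) = J\<close>, and if the minimal
  generators of \<open>J\<close> are known, \<open>HS_1(J)\<close> is generated by the least common multiples of two distinct
  ones (\<open>HS_0_mono_span\<close>, \<open>HS_1_mono_span\<close>). The products of \<open>k\<close> edges all have degree \<open>2k\<close>, so
  they are the minimal generators of \<open>I(G)\<^sup>k\<close>. Hence, for \<open>i \<in> {0, 1}\<close>, a monomial lies in
  \<open>L_k = HS_i(I(G)\<^sup>k)\<close> iff the packings of \<open>k\<close> edges into it realise at least \<open>i + 1\<close> degree
  vectors (\<open>HS_power_edge_ideal\<close>). Localizing at a prime \<open>P\<close> with set of variables \<open>W\<close> drops the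
  bounds at the vertices outside \<open>W\<close> (\<open>fitting_exps_localize\<close>).

  Multiplication by an edge maps \<open>L_k\<close> into \<open>L_(k+1)\<close>. What has to be found, for a monomial
  \<open>f \<notin> L_k(P)\<close> with \<open>x_v f \<in> L_k(P)\<close> for all \<open>v \<in> W\<close>, is an edge \<open>e\<close> with \<open>f e \<notin> L_(k+1)(P)\<close>
  (\<open>edge_keeping_unpackable_degrees\<close>). The tool is an exchange property of degree vectors, proved by
  following an alternating trail in two edge multisets (\<open>degree_exchange\<close>).

  For \<open>i = 0\<close> an edge with an endpoint outside \<open>W\<close> works at once. If there is none, one argues as in
  Gallai's lemma on maximum matchings. Every vertex of \<open>W\<close> has a neighbour that some maximum packing leaves
  unsaturated, so there is an edge \<open>e\<close> whose endpoints are both of this kind. If \<open>k + 1\<close> edges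
  could be packed into \<open>f e\<close>, exchanges would lead to a maximum packing into \<open>f\<close> that leaves two
  adjacent vertices unsaturated simultaneously, and such a packing can be enlarged.

  For \<open>i = 1\<close> only the case of a unique degree vector of \<open>k\<close>-packings into \<open>f\<close> is new. If some edge
  \<open>e\<close> avoids \<open>W\<close>, then the packings into \<open>f\<close> consist of copies of \<open>e\<close> only, and this persists for
  \<open>f e\<close>. Otherwise the exchange property shows that a packing \<open>M\<close> into \<open>f\<close> fills \<open>f\<close> on all of \<open>W\<close>
  (\<open>unique_packing_saturates\<close>), and for any edge \<open>e\<close> of \<open>M\<close> a count with weights shows that
  the degree vector of a \<open>(k+1)\<close>-packing into \<open>f e\<close> is still unique
  (\<open>saturated_packing_add_edge\<close>).

  This gives strong persistence. For persistence, an associated prime \<open>P\<close> of a monomial ideal is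
  generated by variables and is the annihilator of a monomial \<open>c\<close> (\<open>Ass_mono_span\<close>). With the edge
  \<open>e\<close> obtained for \<open>f = c\<close>, the monomial \<open>c e\<close> has annihilator \<open>P\<close> modulo \<open>L_(k+1)\<close>. An associated prime of
  \<open>L_k\<close> may fail to contain \<open>I(G)\<close>, which is why the combinatorial statements concern
  arbitrary sets \<open>W\<close> of vertices rather than vertex covers.
\<close>

section \<open>Degrees of edge multisets\<close>

definition vdeg :: "nat set multiset \<Rightarrow> nat \<Rightarrow> nat" where
  "vdeg M v = size {#e \<in># M. v \<in> e#}"

lemma vdeg_simps [simp]:
  "vdeg {#} v = 0"
  "vdeg (add_mset e M) v = of_bool (v \<in> e) + vdeg M v"
  "vdeg (M + N) v = vdeg M v + vdeg N v"
  by (auto simp: vdeg_def)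

lemma vdeg_le_size: "vdeg M v \<le> size M"
  by (simp add: vdeg_def size_filter_mset_lesseq)

lemma vdeg_pos_edge:
  assumes "vdeg M v > 0" "\<forall>e \<in># M. card e = 2"
  obtains w M' where "M = add_mset {v, w} M'" "w \<noteq> v"
proof -
  have "{#e \<in># M. v \<in> e#} \<noteq> {#}"
    using assms(1) unfolding vdeg_def by (metis less_irrefl size_empty)
  then obtain e where "e \<in># {#e \<in># M. v \<in> e#}"
    by (rule multiset_nonemptyE)
  then have e: "e \<in># M" "v \<in> e"
    by simp_all
  then obtain x y where "e = {x, y}" "x \<noteq> y"
    using assms(2) by (meson card_2_iff)
  then obtain w where "e = {v, w}" "w \<noteq> v"
    using e(2) by (cases "v = x") (auto simp: insert_commute)
  with e(1) show thesis
    using that by (metis insert_DiffM)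
qed

text \<open>
  Follow a trail from \<open>i\<close> that alternates between edges of \<open>S\<close> and edges of \<open>R\<close>, moving the former into
  \<open>R\<close> and the latter out of it. The trail can stop after an \<open>S\<close>-edge at a vertex where \<open>S\<close> has the
  larger degree, and after an \<open>R\<close>-edge at a vertex where \<open>R\<close> has the larger degree. Otherwise the
  degrees provide the next edge. The two disjuncts are these two ways of stopping, at \<open>j\<close>; in the
  first, \<open>j = i\<close> needs a degree difference of two. The induction removes the first two edges of the
  trail from \<open>S\<close> and \<open>R\<close>.
\<close>

lemma degree_exchange:
  assumes "\<forall>e \<in># R + S. card e = 2" "vdeg R i < vdeg S i"
  shows "\<exists>R' S' j. R' + S' = R + S \<and>
    (size R' = Suc (size R) \<and> vdeg R j + of_bool (j = i) < vdeg S j \<and>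
       (\<forall>v. vdeg R' v = vdeg R v + of_bool (v = i) + of_bool (v = j))
     \<or> size R' = size R \<and> vdeg S j < vdeg R j \<and>
       (\<forall>v. vdeg R' v + of_bool (v = j) = vdeg R v + of_bool (v = i)))"
  using assms
proof (induction "size S" arbitrary: R S i rule: less_induct)
  case less
  obtain a S1 where S: "S = add_mset {i, a} S1" "a \<noteq> i"
    using vdeg_pos_edge[of S i] less.prems by auto
  show ?case
  proof (cases "vdeg R a < vdeg S a")
    case True
    then show ?thesis
      using S by (intro exI[of _ "add_mset {i, a} R"] exI[of _ S1] exI[of _ a]) auto
  next
    case False
    then have "vdeg R a > 0"
      using S by auto
    then obtain c R1 where R: "R = add_mset {a, c} R1" "c \<noteq> a"
      using vdeg_pos_edge[of R a] less.prems by auto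
    show ?thesis
    proof (cases "vdeg S c < vdeg R c")
      case True
      then show ?thesis
        using S R by (intro exI[of _ "add_mset {i, a} R1"] exI[of _ "add_mset {a, c} S1"] exI[of _ c]) auto
    next
      case False
      have "vdeg R1 c < vdeg S1 c"
        using False S R less.prems(2) by (cases "c = i") auto
      then obtain R' S' j where IH: "R' + S' = R1 + S1"
        "size R' = Suc (size R1) \<and> vdeg R1 j + of_bool (j = c) < vdeg S1 j \<and>
           (\<forall>v. vdeg R' v = vdeg R1 v + of_bool (v = c) + of_bool (v = j))
         \<or> size R' = size R1 \<and> vdeg S1 j < vdeg R1 j \<and>
           (\<forall>v. vdeg R' v + of_bool (v = j) = vdeg R1 v + of_bool (v = c))"
        using less.hyps[of S1 R1 c] less.prems(1) S R by auto
      have sum: "add_mset {i, a} R' + add_mset {a, c} S' = R + S"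
        using IH(1) S R by simp
      from IH(2) show ?thesis
      proof
        assume A: "size R' = Suc (size R1) \<and> vdeg R1 j + of_bool (j = c) < vdeg S1 j \<and>
           (\<forall>v. vdeg R' v = vdeg R1 v + of_bool (v = c) + of_bool (v = j))"
        have "vdeg R j + of_bool (j = i) < vdeg S j"
          using A S R by (auto split: if_splits)
        moreover have "vdeg (add_mset {i, a} R') v = vdeg R v + of_bool (v = i) + of_bool (v = j)" for v
          using A S R by auto
        ultimately show ?thesis
          using sum A R by (intro exI[of _ "add_mset {i, a} R'"] exI[of _ "add_mset {a, c} S'"] exI[of _ j]) auto
      next
        assume A: "size R' = size R1 \<and> vdeg S1 j < vdeg R1 j \<and>
           (\<forall>v. vdeg R' v + of_bool (v = j) = vdeg R1 v + of_bool (v = c))"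
        \<comment> \<open>At \<open>i\<close> the multiset \<open>R\<close> has the smaller degree, even after the removal of one edge of \<open>S\<close>.\<close>
        have ji: "j \<noteq> i"
        proof
          assume "j = i"
          then have "vdeg S1 i < vdeg R1 i" using A by auto
          then show False using S R less.prems(2) by (auto split: if_splits)
        qed
        then have "vdeg S j < vdeg R j"
          using A S R by auto
        moreover have "vdeg (add_mset {i, a} R') v + of_bool (v = j) = vdeg R v + of_bool (v = i)" for v
          using A[THEN conjunct2, THEN conjunct2, rule_format, of v] S R by (auto split: if_splits)
        ultimately show ?thesis
          using sum A R by (intro exI[of _ "add_mset {i, a} R'"] exI[of _ "add_mset {a, c} S'"] exI[of _ j]) auto
      qed
    qed
  qed
qed

section \<open>Packings that cannot be enlarged\<close>

text \<open>
  The set \<open>W\<close> carries the variables that survive a localization; at the other vertices, whose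
  variables become \<open>1\<close>, the multiset may have any degree.
\<close>

definition packs :: "nat set set \<Rightarrow> nat \<Rightarrow> nat set \<Rightarrow> (nat \<Rightarrow> nat) \<Rightarrow> nat set multiset \<Rightarrow> bool" where
  "packs E k W f M \<longleftrightarrow> set_mset M \<subseteq> E \<and> size M = k \<and> (\<forall>v \<in> W. vdeg M v \<le> f v)"

lemma packs_edges: "packs E k W f M \<Longrightarrow> \<forall>e\<in>E. card e = 2 \<Longrightarrow> \<forall>e \<in># M. card e = 2"
  by (auto simp: packs_def)

lemma packs_remove:
  assumes "packs E (Suc k) W f (add_mset d N)"
    and "\<And>x. x \<in> W \<Longrightarrow> of_bool (x \<in> d) + vdeg N x \<le> f x \<Longrightarrow> vdeg N x \<le> g x"
  shows "packs E k W g N"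
  using assms by (auto simp: packs_def)

lemma packs_tighten:
  assumes "packs E k W (\<lambda>x. f x + of_bool (x = v)) N" "vdeg N v \<le> f v"
  shows "packs E k W f N"
  unfolding packs_def
proof (intro conjI ballI)
  show "set_mset N \<subseteq> E" "size N = k"
    using assms(1) by (auto simp: packs_def)
  fix x assume "x \<in> W"
  then have "vdeg N x \<le> f x + of_bool (x = v)"
    using assms(1) by (simp add: packs_def)
  with assms(2) show "vdeg N x \<le> f x"
    by (cases "x = v") auto
qed

text \<open>
  The transitivity step of Gallai's lemma for maximum packings: one of them has room at \<open>a\<close> and \<open>b\<close>
  simultaneously, another one at \<open>w\<close>. If \<open>M0\<close> is full at \<open>w\<close>, an exchange frees \<open>w\<close> in it and can use up the
  room at one of \<open>a\<close> and \<open>b\<close> only. For \<open>a = b\<close> the hypothesis asks for room for two edge ends.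
\<close>

lemma slack_exchange:
  assumes E: "\<forall>e\<in>E. card e = 2"
    and nomore: "\<And>M. \<not> packs E (Suc k) W f M"
    and M0: "packs E k W f M0" "\<forall>v\<in>W. vdeg M0 v + of_bool (v = a) + of_bool (v = b) \<le> f v"
    and M1: "packs E k W f M1" "vdeg M1 w < f w"
    and W: "a \<in> W" "b \<in> W" "w \<in> W" and ne: "w \<noteq> a" "w \<noteq> b"
  shows "\<exists>M c. c \<in> {a, b} \<and> packs E k W f M \<and> (\<forall>v\<in>W. vdeg M v + of_bool (v = w) + of_bool (v = c) \<le> f v)"
proof (cases "vdeg M0 w < f w")
  case True
  then have "\<forall>v\<in>W. vdeg M0 v + of_bool (v = w) + of_bool (v = a) \<le> f v"
    using M0(2) ne by (force split: if_splits)
  then show ?thesis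
    using M0(1) by (intro exI[of _ M0] exI[of _ a]) simp
next
  case False
  then have "vdeg M1 w < vdeg M0 w"
    using M1 by simp
  moreover have "\<forall>e \<in># M1 + M0. card e = 2"
    using packs_edges[OF M0(1) E] packs_edges[OF M1(1) E] by auto
  ultimately obtain R' S' j where x: "R' + S' = M1 + M0"
    "size R' = Suc (size M1) \<and> vdeg M1 j + of_bool (j = w) < vdeg M0 j \<and>
       (\<forall>v. vdeg R' v = vdeg M1 v + of_bool (v = w) + of_bool (v = j))
     \<or> size R' = size M1 \<and> vdeg M0 j < vdeg M1 j \<and>
       (\<forall>v. vdeg R' v + of_bool (v = j) = vdeg M1 v + of_bool (v = w))"
    using degree_exchange[of M1 M0 w] by blast
  have sub: "set_mset R' \<subseteq> E" "set_mset S' \<subseteq> E"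
    using arg_cong[OF x(1), of set_mset] M0(1) M1(1) by (auto simp: packs_def)
  have ds: "vdeg R' v + vdeg S' v = vdeg M1 v + vdeg M0 v" for v
    using arg_cong[OF x(1), of "\<lambda>M. vdeg M v"] by simp
  from x(2) show ?thesis
  proof
    assume A: "size R' = Suc (size M1) \<and> vdeg M1 j + of_bool (j = w) < vdeg M0 j \<and>
       (\<forall>v. vdeg R' v = vdeg M1 v + of_bool (v = w) + of_bool (v = j))"
    have "packs E (Suc k) W f R'"
      unfolding packs_def
    proof (intro conjI ballI sub)
      show "size R' = Suc k" using A M1(1) by (simp add: packs_def)
      fix v assume v: "v \<in> W"
      have "vdeg M0 v \<le> f v" "vdeg M1 v \<le> f v"
        using v M0 M1(1) by (auto simp: packs_def)
      then show "vdeg R' v \<le> f v"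
        using A M1(2) v by (auto split: if_splits)
    qed
    with nomore show ?thesis by blast
  next
    assume A: "size R' = size M1 \<and> vdeg M0 j < vdeg M1 j \<and>
       (\<forall>v. vdeg R' v + of_bool (v = j) = vdeg M1 v + of_bool (v = w))"
    have S: "vdeg S' v + of_bool (v = w) = vdeg M0 v + of_bool (v = j)" for v
      using ds[of v] A[THEN conjunct2, THEN conjunct2, rule_format, of v] by linarith
    have sz: "size S' = k"
      using arg_cong[OF x(1), of size] A M0(1) by (simp add: packs_def)
    define c where "c = (if j = a then b else a)"
    have slack: "vdeg S' v + of_bool (v = w) + of_bool (v = c) \<le> f v" if v: "v \<in> W" for v
    proof -
      have "vdeg M0 v + of_bool (v = j) \<le> f v"
        using v A M1(1) M0(1) by (cases "v = j") (force simp: packs_def)+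
      then show ?thesis
        using M0(2)[rule_format, OF v] S[of v] by (auto simp: c_def split: if_splits)
    qed
    moreover have "packs E k W f S'"
      unfolding packs_def
    proof (intro conjI ballI sub sz)
      fix v assume "v \<in> W"
      then show "vdeg S' v \<le> f v" using slack[of v] by linarith
    qed
    ultimately show ?thesis
      by (intro exI[of _ S'] exI[of _ c]) (auto simp: c_def)
  qed
qed

text \<open>
  In algebraic terms: a monomial in the socle of a localized power of the edge ideal can be multiplied by a
  suitable edge without entering the next power. The proof is by contradiction, so that every edge
  \<open>e\<close> admits a packing of \<open>k + 1\<close> edges into \<open>f\<close> enlarged by \<open>e\<close>.
\<close>

lemma edge_keeping_unpackable:
  assumes E: "\<forall>e\<in>E. card e = 2" and ne: "E \<noteq> {}" and k: "k > 0"
    and none: "\<And>M. \<not> packs E k W f M"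
    and soc: "\<And>v. v \<in> W \<Longrightarrow> \<exists>M. packs E k W (\<lambda>x. f x + of_bool (x = v)) M"
  shows "\<exists>e\<in>E. \<forall>M. \<not> packs E (Suc k) W (\<lambda>x. f x + of_bool (x \<in> e)) M"
proof (rule ccontr)
  assume "\<not> ?thesis"
  then have all: "\<exists>M. packs E (Suc k) W (\<lambda>x. f x + of_bool (x \<in> e)) M" if "e \<in> E" for e
    using that by blast
  \<comment> \<open>If \<open>e\<close> has at most one endpoint \<open>h\<close> in \<open>W\<close>, deleting one edge, at \<open>h\<close> if possible, from the packing of
    \<open>k + 1\<close> edges leaves a packing of \<open>k\<close> edges into \<open>f\<close>.\<close>
  have inW: "e \<subseteq> W" if e: "e \<in> E" for e
  proof (rule ccontr)
    assume "\<not> e \<subseteq> W"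
    then obtain h where h: "e \<inter> W \<subseteq> {h}"
      using E e by (metis card_2_iff Int_insert_left Int_empty_left subset_insertI insert_subset empty_subsetI
          order_refl)
    obtain M where M: "packs E (Suc k) W (\<lambda>x. f x + of_bool (x \<in> e)) M"
      using all[OF e] by blast
    have "\<exists>d. d \<in># M \<and> (vdeg M h > 0 \<longrightarrow> h \<in> d)"
    proof (cases "vdeg M h > 0")
      case True
      then obtain w M' where "M = add_mset {h, w} M'"
        using vdeg_pos_edge[OF True packs_edges[OF M E]] by blast
      then show ?thesis by auto
    next
      case False
      then show ?thesis using M by (metis packs_def multiset_nonemptyE size_empty nat.distinct(1))
    qed
    then obtain d M' where d: "M = add_mset d M'" "vdeg M h > 0 \<longrightarrow> h \<in> d"
      by (metis insert_DiffM)
    have "vdeg M' v \<le> f v" if v: "v \<in> W" for v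
    proof -
      have *: "vdeg M v \<le> f v + of_bool (v \<in> e)"
        using M v by (simp add: packs_def)
      show ?thesis
      proof (cases "v = h")
        case True
        then show ?thesis using * d by (cases "h \<in> e"; cases "vdeg M h > 0") auto
      next
        case False
        then have "v \<notin> e" using h v by auto
        then show ?thesis using * d by simp
      qed
    qed
    then have "packs E k W f M'"
      using M d(1) by (auto simp: packs_def)
    with none show False by blast
  qed
  define slack where "slack M a b \<longleftrightarrow> (\<forall>v\<in>W. vdeg M v + of_bool (v = a) + of_bool (v = b) \<le> f v)"
    for M a b
  obtain k' where k': "k = Suc k'"
    using k by (cases k) auto
  \<comment> \<open>A maximum packing with room at both ends of an edge could be enlarged by that edge.\<close>
  have noadj: False if "packs E k' W f M" "slack M a b" "{a, b} \<in> E" for M a b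
  proof -
    have "a \<noteq> b" using E that(3) by force
    then have "packs E k W f (add_mset {a, b} M)"
      using that inW[OF that(3)] unfolding packs_def slack_def k' by (fastforce split: if_splits)
    with none show False by blast
  qed
  have sat: "f x < vdeg N x" if "packs E k W (\<lambda>z. f z + of_bool (z = x)) N" for x N
    using packs_tighten[OF that] none by (meson not_le)
  \<comment> \<open>The packing into \<open>f\<close> enlarged at \<open>v\<close> uses the new copy of \<open>v\<close>; deleting the edge there frees its
    other end \<open>w\<close>.\<close>
  have nbr: "\<exists>w M. {v, w} \<in> E \<and> packs E k' W f M \<and> vdeg M w < f w" if v: "v \<in> W" for v
  proof -
    obtain N where N: "packs E k W (\<lambda>x. f x + of_bool (x = v)) N"
      using soc[OF v] by blast
    have "vdeg N v > f v"
      using sat[OF N] .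
    then obtain w M where M: "N = add_mset {v, w} M" "w \<noteq> v"
      using vdeg_pos_edge[OF _ packs_edges[OF N E], of v] by (metis gr0I not_less0)
    have "{v, w} \<in> E" using M N by (auto simp: packs_def)
    moreover have "packs E k' W f M"
      unfolding packs_def
    proof (intro conjI ballI)
      show "set_mset M \<subseteq> E" "size M = k'" using N M k' by (auto simp: packs_def)
      fix x assume "x \<in> W"
      then have "vdeg N x \<le> f x + of_bool (x = v)" using N by (simp add: packs_def)
      then show "vdeg M x \<le> f x" using M by (auto split: if_splits)
    qed
    moreover have "vdeg N w \<le> f w"
      using inW[OF \<open>{v, w} \<in> E\<close>] N M(2) by (auto simp: packs_def)
    then have "vdeg M w < f w" using M by simp
    ultimately show ?thesis by blast
  qed
  \<comment> \<open>Two steps of \<open>nbr\<close> give an edge \<open>{w, w'}\<close> both of whose ends are left free by maximum packings.\<close>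
  obtain v where v: "v \<in> W"
    using ne inW E by fastforce
  obtain w M1 where M1: "{v, w} \<in> E" "packs E k' W f M1" "vdeg M1 w < f w"
    using nbr[OF v] by blast
  have w: "w \<in> W" using M1(1) inW by blast
  obtain w' M2 where M2: "{w, w'} \<in> E" "packs E k' W f M2" "vdeg M2 w' < f w'"
    using nbr[OF w] by blast
  have w': "w' \<in> W" using M2(1) inW by blast
  have ww': "w \<noteq> w'" using M2(1) E by force
  obtain N where N: "packs E (Suc k) W (\<lambda>x. f x + of_bool (x \<in> {w, w'})) N"
    using all[OF M2(1)] by blast
  have cards: "\<forall>e\<in>#N. card e = 2" using packs_edges[OF N E] .
  \<comment> \<open>Deleting the edges \<open>{w, a}\<close> and \<open>{w', b}\<close> from \<open>N\<close> yields a maximum packing \<open>M0\<close> into \<open>f\<close> with room at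
    \<open>a\<close> and \<open>b\<close>. The following steps establish that these two edges exist and are different.\<close>
  have "vdeg N w > 0"
  proof (rule ccontr)
    assume 0: "\<not> ?thesis"
    obtain d N' where d: "N = add_mset d N'" using N by (metis packs_def size_eq_Suc_imp_eq_union)
    have "packs E k W (\<lambda>z. f z + of_bool (z = w')) N'"
      by (rule packs_remove[OF N[unfolded d]])
        (use 0 d in \<open>auto simp: of_bool_def split: if_splits\<close>)
    then have "vdeg N w' > 0"
      using sat d by fastforce
    then obtain c N'' where d': "N = add_mset {w', c} N''"
      using vdeg_pos_edge[OF _ cards, of w'] by metis
    have "packs E k W f N''"
      by (rule packs_remove[OF N[unfolded d']])
        (use 0 d' in \<open>auto simp: of_bool_def split: if_splits\<close>)
    with none show False by blast
  qed
  then obtain a N1 where a: "N = add_mset {w, a} N1" "a \<noteq> w"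
    using vdeg_pos_edge[OF _ cards] by metis
  have aE: "{w, a} \<in> E" using N a by (auto simp: packs_def)
  have aw': "a \<noteq> w'"
  proof
    assume aw: "a = w'"
    have "packs E k W f N1"
      by (rule packs_remove[OF N[unfolded a(1)]])
        (use aw in \<open>auto simp: of_bool_def split: if_splits\<close>)
    with none show False by blast
  qed
  have N1: "packs E k W (\<lambda>z. f z + of_bool (z = w')) N1"
    by (rule packs_remove[OF N[unfolded a(1)]])
      (use a(2) ww' in \<open>auto simp: of_bool_def split: if_splits\<close>)
  have "vdeg N1 w' > 0" using sat[OF N1] by simp
  then obtain b M0 where b: "N1 = add_mset {w', b} M0" "b \<noteq> w'"
    using vdeg_pos_edge[OF _ packs_edges[OF N1 E]] by metis
  have bE: "{w', b} \<in> E" using N1 b by (auto simp: packs_def)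
  have degN: "vdeg N x \<le> f x + of_bool (x \<in> {w, w'})" if "x \<in> W" for x
    using N that by (simp add: packs_def)
  have bw: "b \<noteq> w"
  proof
    assume bw: "b = w"
    have "N = add_mset {w, w'} (add_mset {w, a} M0)"
      using a b bw by (simp add: insert_commute add_mset_commute)
    note N' = N[unfolded this]
    have "packs E k W f (add_mset {w, a} M0)"
      by (rule packs_remove[OF N'])
        (auto simp: of_bool_def split: if_splits)
    with none show False by blast
  qed
  have aW: "a \<in> W" "b \<in> W" using aE bE inW by blast+
  have s0: "slack M0 a b"
    unfolding slack_def
  proof
    fix x assume "x \<in> W"
    with degN[OF this] show "vdeg M0 x + of_bool (x = a) + of_bool (x = b) \<le> f x"
      using a b aw' bw ww' by (auto simp: of_bool_def split: if_splits)
  qed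
  have p0: "packs E k' W f M0"
    unfolding packs_def
  proof (intro conjI ballI)
    show "set_mset M0 \<subseteq> E" "size M0 = k'" using N a b k' by (auto simp: packs_def)
    fix x assume "x \<in> W"
    then show "vdeg M0 x \<le> f x" using s0 unfolding slack_def by (meson add_leD1)
  qed
  have nomore: "\<not> packs E (Suc k') W f M" for M
    using none k' by simp
  \<comment> \<open>Freeing \<open>w\<close> must use up \<open>a\<close>, because \<open>w\<close> and \<open>a\<close> are adjacent. Freeing \<open>w'\<close> next leaves room at
    \<open>w\<close> or at \<open>b\<close>, and both are adjacent to \<open>w'\<close>.\<close>
  obtain M c where M: "c \<in> {a, b}" "packs E k' W f M" "slack M w c"
    using slack_exchange[OF E nomore p0 s0[unfolded slack_def] M1(2,3) aW w] a(2) bw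
    unfolding slack_def by blast
  have cb: "c = b"
    using M noadj[of M w a] aE by auto
  obtain M' c' where M': "c' \<in> {w, b}" "packs E k' W f M'" "slack M' w' c'"
    using slack_exchange[OF E nomore M(2) M(3)[unfolded slack_def cb] M2(2,3) w aW(2) w'] b(2) ww'
    unfolding slack_def by blast
  then show False
    using noadj[of M' w' c'] bE M2(1) by (auto simp: insert_commute)
qed

section \<open>Packings with a unique degree vector\<close>

lemma vdeg_replicate [simp]: "vdeg (replicate_mset n e) v = n * of_bool (v \<in> e)"
  by (induction n) auto

lemma vdeg_eq_0_iff: "vdeg M v = 0 \<longleftrightarrow> (\<forall>d\<in>#M. v \<notin> d)"
  by (induction M) auto

lemma vdeg_less_size:
  assumes "vdeg M v < size M"
  obtains d M' where "M = add_mset d M'" "v \<notin> d"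
proof -
  have "\<exists>d\<in>#M. v \<notin> d"
    using assms by (induction M) (auto simp: of_bool_def split: if_splits)
  then show thesis
    using that by (metis insert_DiffM)
qed

text \<open>
  Double counting of the pairs of an edge of \<open>N\<close> and one of its ends.
\<close>

lemma sum_mset_edges:
  fixes g :: "nat \<Rightarrow> nat"
  assumes "finite F" "\<forall>d\<in>#N. d \<subseteq> F"
  shows "(\<Sum>d\<in>#N. \<Sum>x\<in>d. g x) = (\<Sum>x\<in>F. g x * vdeg N x)"
  using assms(2)
proof (induction N)
  case (add d N)
  have "(\<Sum>x\<in>d. g x) = (\<Sum>x\<in>F. g x * of_bool (x \<in> d))"
    using assms(1) add.prems by (intro sum.mono_neutral_cong_left) auto
  then show ?case
    using add by (simp add: distrib_left sum.distrib)
qed simp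

lemma vdeg_sum_mset: "vdeg N v = (\<Sum>d\<in>#N. of_bool (v \<in> d))"
  by (induction N) auto

lemma of_bool_mem_inj:
  assumes "\<And>x. (of_bool (x \<in> A) :: nat) = of_bool (x \<in> B)"
  shows "A = B"
proof (rule Set.set_eqI)
  fix x
  show "x \<in> A \<longleftrightarrow> x \<in> B"
    using assms[of x] by (simp only: of_bool_eq_iff)
qed

text \<open>
  Suppose there is room at \<open>w\<close>. By uniqueness \<open>N\<close> exceeds \<open>f\<close> at \<open>w\<close>, hence exceeds the degree of
  \<open>M\<close> there by at least two. An exchange moves \<open>M\<close> towards \<open>N\<close> at \<open>w\<close>; after the deletion of an edge, if
  the exchange has added one, the result is a packing of \<open>k\<close> edges into \<open>f\<close> whose degree at \<open>w\<close> is
  larger by one, contrary to uniqueness.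
\<close>

lemma unique_packing_saturates:
  assumes E: "\<forall>e\<in>E. card e = 2" and M: "packs E k W f M"
    and uniq: "\<And>N. packs E k W f N \<Longrightarrow> vdeg M = vdeg N"
    and w: "w \<in> W" and N: "packs E k W (\<lambda>x. f x + of_bool (x = w)) N" "vdeg N \<noteq> vdeg M"
  shows "vdeg M w = f w"
proof (rule ccontr)
  assume "vdeg M w \<noteq> f w"
  then have less: "vdeg M w < f w" using M w by (auto simp: packs_def le_less)
  have Nw: "vdeg N w > f w"
    using packs_tighten[OF N(1)] uniq N(2) by (metis not_le)
  have "\<forall>e \<in># M + N. card e = 2"
    using packs_edges[OF M E] packs_edges[OF N(1) E] by auto
  then obtain R S j where x: "R + S = M + N"
    "size R = Suc (size M) \<and> vdeg M j + of_bool (j = w) < vdeg N j \<and>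
       (\<forall>v. vdeg R v = vdeg M v + of_bool (v = w) + of_bool (v = j))
     \<or> size R = size M \<and> vdeg N j < vdeg M j \<and>
       (\<forall>v. vdeg R v + of_bool (v = j) = vdeg M v + of_bool (v = w))"
    using degree_exchange[of M N w] less Nw by (meson less_trans)
  have sub: "set_mset R \<subseteq> E"
    using arg_cong[OF x(1), of set_mset] M N(1) by (auto simp: packs_def)
  have noR: False if "packs E k W f Q" "vdeg Q w = Suc (vdeg M w)" for Q
    using uniq[OF that(1)] that(2) by simp
  have leM: "vdeg M v \<le> f v" if "v \<in> W" for v
    using M that by (simp add: packs_def)
  have leN: "vdeg N v \<le> f v + of_bool (v = w)" if "v \<in> W" for v
    using N(1) that by (simp add: packs_def)
  have szM: "size M = k" "size N = k" using M N(1) by (auto simp: packs_def)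
  from x(2) show False
  proof
    assume A: "size R = Suc (size M) \<and> vdeg M j + of_bool (j = w) < vdeg N j \<and>
       (\<forall>v. vdeg R v = vdeg M v + of_bool (v = w) + of_bool (v = j))"
    show False
    proof (cases "j = w")
      case True
      then have "vdeg R w > 0" using A by simp
      then obtain c Q where Q: "R = add_mset {w, c} Q" "c \<noteq> w"
        using vdeg_pos_edge[of R w] sub E by blast
      have dQ: "vdeg Q v + of_bool (v = c) = vdeg M v + of_bool (v = w)" for v
        using A[THEN conjunct2, THEN conjunct2, rule_format, of v] True Q
        by (auto simp: of_bool_def split: if_splits)
      have "packs E k W f Q"
        unfolding packs_def
      proof (intro conjI ballI)
        show "set_mset Q \<subseteq> E" "size Q = k" using Q sub A szM by auto
        fix v assume "v \<in> W"
        with dQ[of v] leM[of v] less show "vdeg Q v \<le> f v"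
          by (auto simp: of_bool_def split: if_splits)
      qed
      then show False using noR dQ[of w] Q(2) by simp
    next
      case False
      \<comment> \<open>A vertex has degree at most \<open>k\<close> in \<open>N\<close>, so some edge of \<open>R\<close> avoids \<open>w\<close> and can be deleted.\<close>
      have "vdeg M w + 2 \<le> vdeg N w" using less Nw by simp
      also have "\<dots> \<le> k" using vdeg_le_size[of N w] szM by simp
      finally have "vdeg R w < size R" using A False szM by simp
      then obtain d Q where Q: "R = add_mset d Q" "w \<notin> d"
        using vdeg_less_size by blast
      have "packs E k W f Q"
        unfolding packs_def
      proof (intro conjI ballI)
        show "set_mset Q \<subseteq> E" "size Q = k" using Q sub A szM by auto
        fix v assume v: "v \<in> W"
        have "vdeg Q v \<le> vdeg M v + of_bool (v = w) + of_bool (v = j)"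
          using A[THEN conjunct2, THEN conjunct2, rule_format, of v] Q by simp
        then show "vdeg Q v \<le> f v"
          using leM[OF v] leN[OF v] less A False by (auto simp: of_bool_def split: if_splits)
      qed
      moreover have "vdeg Q w = Suc (vdeg M w)"
        using A[THEN conjunct2, THEN conjunct2, rule_format, of w] Q False by simp
      ultimately show False using noR by blast
    qed
  next
    assume A: "size R = size M \<and> vdeg N j < vdeg M j \<and>
       (\<forall>v. vdeg R v + of_bool (v = j) = vdeg M v + of_bool (v = w))"
    note dR = A[THEN conjunct2, THEN conjunct2, rule_format]
    have jw: "j \<noteq> w" using A less Nw by auto
    have "packs E k W f R"
      unfolding packs_def
    proof (intro conjI ballI sub)
      show "size R = k" using A szM by simp
      fix v assume v: "v \<in> W"
      with dR[of v] leM[of v] less show "vdeg R v \<le> f v"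
        by (auto simp: of_bool_def split: if_splits)
    qed
    then show False using noR dR[of w] jw by simp
  qed
qed

text \<open>
  Call a vertex of \<open>W\<close> a boundary vertex if it has a neighbour outside \<open>W\<close>. By uniqueness, an edge of
  \<open>M\<close> at a boundary vertex \<open>h\<close> leads to the only outer neighbour of \<open>h\<close>. Give weight \<open>2\<close> to the
  boundary vertices, \<open>1\<close> to the others in \<open>W\<close>, and \<open>0\<close> outside. Every edge of the graph has
  weight at least \<open>2\<close>, and those of \<open>M\<close> have weight exactly \<open>2\<close>. As \<open>M\<close> fills \<open>f\<close>, the total weight
  available to \<open>N\<close> is \<open>2(k + 1)\<close>, so every edge of \<open>N\<close> has weight \<open>2\<close> and \<open>N\<close> fills \<open>W\<close> as \<open>M\<close> with
  \<open>e\<close> does. The degrees outside \<open>W\<close> are then determined by those at the boundary vertices.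
\<close>

lemma saturated_packing_add_edge:
  assumes E: "\<forall>e\<in>E. card e = 2" and meet: "\<And>e. e \<in> E \<Longrightarrow> e \<inter> W \<noteq> {}"
    and M: "packs E k W f M" and uniq: "\<And>N. packs E k W f N \<Longrightarrow> vdeg M = vdeg N"
    and full: "\<And>w. w \<in> W \<Longrightarrow> vdeg M w = f w" and e: "e \<in># M"
    and N: "packs E (Suc k) W (\<lambda>x. f x + of_bool (x \<in> e)) N"
  shows "vdeg N = vdeg (add_mset e M)"
proof -
  define M1 where "M1 = add_mset e M"
  have subM: "set_mset M \<subseteq> E" using M by (simp add: packs_def)
  have subM1: "set_mset M1 \<subseteq> E" using M e by (auto simp: packs_def M1_def)
  have memM1: "d \<in># M" if "d \<in># M1" for d using that e by (auto simp: M1_def)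
  \<comment> \<open>Replacing \<open>d\<close> by \<open>{h, y}\<close> gives another packing into \<open>f\<close>, since \<open>y \<notin> W\<close> is not bounded.\<close>
  have forced: "d = {h, y}" if d: "d \<in># M" "h \<in> d" "h \<in> W" "{h, y} \<in> E" "y \<notin> W" for d h y
  proof -
    obtain Q where Q: "M = add_mset d Q" using d(1) by (metis insert_DiffM)
    have "packs E k W f (add_mset {h, y} Q)"
      unfolding packs_def
    proof (intro conjI ballI)
      show "set_mset (add_mset {h, y} Q) \<subseteq> E" "size (add_mset {h, y} Q) = k"
        using M Q d by (auto simp: packs_def)
      fix v assume v: "v \<in> W"
      have "vdeg M v \<le> f v" using v M by (simp add: packs_def)
      then show "vdeg (add_mset {h, y} Q) v \<le> f v"
        using Q v d(2,5) by (auto simp: of_bool_def split: if_splits)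
    qed
    then have eq: "vdeg M = vdeg (add_mset {h, y} Q)" by (rule uniq)
    show ?thesis by (rule of_bool_mem_inj) (use fun_cong[OF eq] Q in simp)
  qed
  define H where "H = {h \<in> W. \<exists>y. y \<notin> W \<and> {h, y} \<in> E}"
  define wt where "wt x = (if x \<in> H then 2 else if x \<in> W then 1 else (0::nat))" for x
  have wtM: "(\<Sum>x\<in>d. wt x) = 2" if d: "d \<in># M" for d
  proof -
    obtain x y where xy: "d = {x, y}" "x \<noteq> y"
      using d subM E by (meson card_2_iff subsetD)
    show ?thesis
    proof (cases "d \<inter> H = {}")
      case True
      have "x \<in> W \<and> y \<in> W"
        using True meet[of d] d subM xy unfolding H_def by (fastforce simp: insert_commute)
      then show ?thesis using True xy by (simp add: wt_def)
    next
      case False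
      then obtain h z where h: "h \<in> d" "h \<in> W" "z \<notin> W" "{h, z} \<in> E"
        unfolding H_def by blast
      then have "d = {h, z}" using forced d by blast
      moreover have "h \<in> H" "z \<notin> H" using h by (auto simp: H_def)
      moreover have "h \<noteq> z" using h by blast
      ultimately show ?thesis using h by (simp add: wt_def)
    qed
  qed
  have wtE: "(\<Sum>x\<in>d. wt x) \<ge> 2" if d: "d \<in> E" for d
  proof -
    obtain x y where xy: "d = {x, y}" "x \<noteq> y" "x \<in> W"
      using meet[OF d] d E by (metis card_2_iff disjoint_iff doubleton_eq_iff insertE singletonD)
    show ?thesis
    proof (cases "y \<in> W")
      case True
      then show ?thesis using xy by (simp add: wt_def)
    next
      case False
      then have "x \<in> H" using xy d by (auto simp: H_def)
      then show ?thesis using xy by (simp add: wt_def)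
    qed
  qed
  define F where "F = \<Union> (set_mset N \<union> set_mset M1)"
  have subN: "set_mset N \<subseteq> E" and szN: "size N = Suc k" using N by (auto simp: packs_def)
  have finF: "finite F"
  proof -
    have "finite d" if "d \<in> E" for d
      using E that by (metis card.infinite zero_neq_numeral)
    then show ?thesis
      unfolding F_def using subN subM1 by blast
  qed
  have F: "\<forall>d\<in>#N. d \<subseteq> F" "\<forall>d\<in>#M1. d \<subseteq> F" by (auto simp: F_def)
  have le: "vdeg N x \<le> vdeg M1 x" if "x \<in> W" for x
    using N that full[OF that] by (simp add: packs_def M1_def add.commute)
  have wle: "wt x * vdeg N x \<le> wt x * vdeg M1 x" for x
    using le[of x] by (auto simp: wt_def H_def)
  have s1: "(\<Sum>d\<in>#M1. \<Sum>x\<in>d. wt x) = 2 * Suc k"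
  proof -
    have "(\<Sum>d\<in>#M1. \<Sum>x\<in>d. wt x) = (\<Sum>d\<in>#M1. 2)"
      by (rule arg_cong[of _ _ sum_mset], rule image_mset_cong) (use wtM memM1 in blast)
    also have "\<dots> = 2 * Suc k" using M by (simp add: M1_def packs_def)
    finally show ?thesis .
  qed
  have lower: "2 * size Q \<le> (\<Sum>d\<in>#Q. \<Sum>x\<in>d. wt x)" if "set_mset Q \<subseteq> E" for Q
    using that
  proof (induction Q)
    case (add d Q)
    then show ?case using wtE[of d] by simp
  qed simp
  have eqs: "(\<Sum>x\<in>F. wt x * vdeg N x) = (\<Sum>x\<in>F. wt x * vdeg M1 x)"
  proof (rule antisym)
    show "(\<Sum>x\<in>F. wt x * vdeg N x) \<le> (\<Sum>x\<in>F. wt x * vdeg M1 x)"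
      by (intro sum_mono wle)
    show "(\<Sum>x\<in>F. wt x * vdeg M1 x) \<le> (\<Sum>x\<in>F. wt x * vdeg N x)"
      using lower[OF subN] s1 szN sum_mset_edges[OF finF F(1), of wt] sum_mset_edges[OF finF F(2), of wt]
      by simp
  qed
  have eqW: "vdeg N x = vdeg M1 x" if x: "x \<in> W" for x
  proof (cases "x \<in> F")
    case True
    have "wt x * vdeg N x = wt x * vdeg M1 x"
      by (rule sum_mono_inv[OF eqs wle True finF])
    then show ?thesis using x by (auto simp: wt_def split: if_splits)
  next
    case False
    then have "\<forall>d\<in>#N. x \<notin> d" "\<forall>d\<in>#M1. x \<notin> d" using F by blast+
    then have "vdeg N x = 0" "vdeg M1 x = 0" by (simp_all only: vdeg_eq_0_iff)
    then show ?thesis by simp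
  qed
  have wtN: "(\<Sum>x\<in>d. wt x) = 2" if d: "d \<in># N" for d
  proof -
    obtain Q where Q: "N = add_mset d Q" using d by (metis insert_DiffM)
    have "2 * size Q \<le> (\<Sum>d\<in>#Q. \<Sum>x\<in>d. wt x)" using lower[of Q] subN Q by auto
    moreover have "(\<Sum>d\<in>#N. \<Sum>x\<in>d. wt x) = 2 * Suc k"
      using eqs s1 sum_mset_edges[OF finF F(1), of wt] sum_mset_edges[OF finF F(2), of wt] by simp
    ultimately have "(\<Sum>x\<in>d. wt x) \<le> 2" using Q szN by simp
    then show ?thesis using wtE[of d] d subN by fastforce
  qed
  have eqO: "vdeg N z = vdeg M1 z" if z: "z \<notin> W" for z
  proof -
    \<comment> \<open>\<open>\<phi>\<close> marks the vertices of \<open>W\<close> next to \<open>z\<close>. Each edge of \<open>M\<close> and of \<open>N\<close> contains \<open>z\<close> as often as it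
      contains marked vertices, so the degree of \<open>z\<close> is a sum of degrees inside \<open>W\<close>.\<close>
    define \<phi> where "\<phi> x = (of_bool (x \<in> W \<and> {x, z} \<in> E) :: nat)" for x
    have char: "of_bool (z \<in> d) = (\<Sum>x\<in>d. \<phi> x)"
      if d: "d \<in> E" and *: "\<And>x. x \<in> d \<Longrightarrow> x \<in> W \<Longrightarrow> {x, z} \<in> E \<Longrightarrow> z \<in> d" for d
    proof (cases "z \<in> d")
      case True
      obtain x where x: "d = {x, z}" "x \<noteq> z"
        using True d E by (metis card_2_iff doubleton_eq_iff insertE singletonD)
      then have "x \<in> W" using meet[OF d] z by auto
      then show ?thesis using x d z by (simp add: \<phi>_def)
    next
      case False
      then have "\<phi> x = 0" if "x \<in> d" for x using * that by (auto simp: \<phi>_def)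
      then show ?thesis using False by simp
    qed
    have cM: "of_bool (z \<in> d) = (\<Sum>x\<in>d. \<phi> x)" if d: "d \<in># M1" for d
    proof (rule char)
      show "d \<in> E" using d subM1 by auto
      show "z \<in> d" if "x \<in> d" "x \<in> W" "{x, z} \<in> E" for x
        using forced[OF memM1[OF d] that z] by simp
    qed
    have cN: "of_bool (z \<in> d) = (\<Sum>x\<in>d. \<phi> x)" if d: "d \<in># N" for d
    proof (rule char)
      show dE: "d \<in> E" using d subN by auto
      show "z \<in> d" if x: "x \<in> d" "x \<in> W" "{x, z} \<in> E" for x
      proof -
        obtain y where y: "d = {x, y}" "x \<noteq> y"
          using x(1) dE E by (metis card_2_iff doubleton_eq_iff insertE singletonD)
        have "x \<in> H" using x z by (auto simp: H_def)
        then have "wt y = 0" using wtN[OF d] y by (simp add: wt_def split: if_splits)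
        then have yW: "y \<notin> W" by (auto simp: wt_def split: if_splits)
        have "vdeg N x > 0" using d x(1) vdeg_eq_0_iff[of N x] by auto
        then have "vdeg M1 x > 0" using eqW[OF x(2)] by simp
        then obtain w Q where "M1 = add_mset {x, w} Q"
          using vdeg_pos_edge[of M1 x] subM1 E by blast
        then have "{x, w} \<in># M" using memM1 by auto
        then have "{x, w} = {x, z}" "{x, w} = {x, y}"
          using forced[of "{x, w}" x] x y yW z dE by auto
        then show ?thesis using y by auto
      qed
    qed
    have "vdeg N z = (\<Sum>d\<in>#N. \<Sum>x\<in>d. \<phi> x)"
      unfolding vdeg_sum_mset by (rule arg_cong[of _ _ sum_mset], rule image_mset_cong) (rule cN)
    also have "\<dots> = (\<Sum>x\<in>F. \<phi> x * vdeg N x)" by (rule sum_mset_edges[OF finF F(1)])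
    also have "\<dots> = (\<Sum>x\<in>F. \<phi> x * vdeg M1 x)"
      by (rule sum.cong) (auto simp: \<phi>_def eqW)
    also have "\<dots> = (\<Sum>d\<in>#M1. \<Sum>x\<in>d. \<phi> x)" by (rule sum_mset_edges[OF finF F(2), symmetric])
    also have "\<dots> = vdeg M1 z"
      unfolding vdeg_sum_mset by (rule arg_cong[of _ _ sum_mset], rule image_mset_cong) (rule cM[symmetric])
    finally show ?thesis .
  qed
  show ?thesis using eqW eqO unfolding M1_def by blast
qed

text \<open>
  Without any packing into \<open>f\<close> this is \<open>edge_keeping_unpackable\<close>. If an edge \<open>e\<close> avoids \<open>W\<close>, it can be
  packed arbitrarily often, and uniqueness forces all packings to consist of copies of \<open>e\<close>. In the
  remaining case \<open>W\<close> is a vertex cover and any edge of the packing does.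
\<close>

lemma edge_keeping_unique_packing:
  assumes E: "\<forall>e\<in>E. card e = 2" and ne: "E \<noteq> {}" and k: "k > 0"
    and uniq: "\<And>M N. packs E k W f M \<Longrightarrow> packs E k W f N \<Longrightarrow> vdeg M = vdeg N"
    and soc: "\<And>v. v \<in> W \<Longrightarrow> \<exists>M N. packs E k W (\<lambda>x. f x + of_bool (x = v)) M
       \<and> packs E k W (\<lambda>x. f x + of_bool (x = v)) N \<and> vdeg M \<noteq> vdeg N"
  shows "\<exists>e\<in>E. \<forall>M N. packs E (Suc k) W (\<lambda>x. f x + of_bool (x \<in> e)) M
       \<longrightarrow> packs E (Suc k) W (\<lambda>x. f x + of_bool (x \<in> e)) N \<longrightarrow> vdeg M = vdeg N"
proof (cases "\<exists>M. packs E k W f M")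
  case False
  have "\<exists>e\<in>E. \<forall>M. \<not> packs E (Suc k) W (\<lambda>x. f x + of_bool (x \<in> e)) M"
  proof (rule edge_keeping_unpackable[OF E ne k])
    show "\<not> packs E k W f M" for M using False by blast
    show "\<exists>M. packs E k W (\<lambda>x. f x + of_bool (x = v)) M" if "v \<in> W" for v
      using soc[OF that] by blast
  qed
  then show ?thesis by blast
next
  case True
  then obtain M where M: "packs E k W f M" by blast
  show ?thesis
  proof (cases "\<exists>e\<in>E. e \<inter> W = {}")
    case True
    then obtain e where e: "e \<in> E" "e \<inter> W = {}" by blast
    have "N = replicate_mset (Suc k) e" if N: "packs E (Suc k) W (\<lambda>x. f x + of_bool (x \<in> e)) N" for N
    proof -
      have "d = e" if d: "d \<in># N" for d
      proof -
        \<comment> \<open>Exchanging one copy of \<open>e\<close> for \<open>d\<close> preserves the bounds on \<open>W\<close>, so uniqueness gives \<open>d = e\<close>.\<close>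
        have "packs E k W f (replicate_mset k e)"
          using e by (auto simp: packs_def)
        moreover have "packs E k W f (add_mset d (replicate_mset (k - 1) e))"
        proof -
          have bound: "of_bool (x \<in> d) \<le> f x" if x: "x \<in> W" for x
          proof -
            have "of_bool (x \<in> d) \<le> vdeg N x"
              using d by (metis insert_DiffM vdeg_simps(2) le_add1)
            also have "\<dots> \<le> f x"
            proof -
              have "x \<notin> e" using x e(2) by blast
              moreover have "vdeg N x \<le> f x + of_bool (x \<in> e)"
                using N x by (simp add: packs_def)
              ultimately show ?thesis by simp
            qed
            finally show ?thesis .
          qed
          show ?thesis
            unfolding packs_def
          proof (intro conjI ballI)
            show "set_mset (add_mset d (replicate_mset (k - 1) e)) \<subseteq> E"
              using e(1) d N by (auto simp: packs_def split: if_splits)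
            show "size (add_mset d (replicate_mset (k - 1) e)) = k"
              using k by simp
            fix x assume x: "x \<in> W"
            then have "x \<notin> e" using e(2) by blast
            then show "vdeg (add_mset d (replicate_mset (k - 1) e)) x \<le> f x"
              using bound[OF x] by simp
          qed
        qed
        ultimately have eq: "vdeg (replicate_mset k e) = vdeg (add_mset d (replicate_mset (k - 1) e))"
          by (rule uniq)
        obtain k' where k': "k = Suc k'" using k by (cases k) auto
        show ?thesis
          by (rule of_bool_mem_inj) (use fun_cong[OF eq] k' in simp)
      qed
      then show ?thesis
        using N set_mset_subset_singletonD[of N e] by (auto simp: packs_def)
    qed
    then show ?thesis using e(1) by metis
  next
    case False
    then have meet: "e \<inter> W \<noteq> {}" if "e \<in> E" for e using that by blast
    have full: "vdeg M w = f w" if w: "w \<in> W" for w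
    proof -
      obtain N where N: "packs E k W (\<lambda>x. f x + of_bool (x = w)) N" "vdeg N \<noteq> vdeg M"
        using soc[OF w] by metis
      show ?thesis
        by (rule unique_packing_saturates[OF E M uniq[OF M] w N])
    qed
    obtain e where e: "e \<in># M"
      using M k by (metis packs_def size_empty less_irrefl multiset_nonemptyE)
    then have "e \<in> E"
      using M by (auto simp: packs_def)
    moreover have "vdeg N = vdeg (add_mset e M)"
      if "packs E (Suc k) W (\<lambda>x. f x + of_bool (x \<in> e)) N" for N
      by (rule saturated_packing_add_edge[OF E meet M uniq[OF M] full e that])
    ultimately show ?thesis by metis
  qed
qed

section \<open>Counting the degree vectors of packings\<close>

text \<open>
  Realising at least \<open>i + 1\<close> degree vectors treats both cases uniformly: for \<open>i = 0\<close> a generator of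
  the power divides the monomial, for \<open>i = 1\<close> two distinct generators do. The condition
  on \<open>card D\<close> makes \<open>D\<close> finite, as infinite sets have cardinality \<open>0\<close>.
\<close>

definition packable :: "nat set set \<Rightarrow> nat \<Rightarrow> nat \<Rightarrow> nat set \<Rightarrow> (nat \<Rightarrow> nat) \<Rightarrow> bool" where
  "packable E i k W f \<longleftrightarrow> (\<exists>D \<subseteq> vdeg ` {M. packs E k W f M}. card D = Suc i)"

lemma packable_0: "packable E 0 k W f \<longleftrightarrow> (\<exists>M. packs E k W f M)"
proof
  assume "packable E 0 k W f"
  then obtain D where "D \<subseteq> vdeg ` {M. packs E k W f M}" "card D = Suc 0"
    unfolding packable_def by blast
  then show "\<exists>M. packs E k W f M"
    by (auto simp: card_Suc_eq)
next
  assume "\<exists>M. packs E k W f M"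
  then obtain M where "packs E k W f M" ..
  then show "packable E 0 k W f"
    unfolding packable_def by (intro exI[of _ "{vdeg M}"]) auto
qed

lemma packable_1:
  "packable E 1 k W f \<longleftrightarrow> (\<exists>M N. packs E k W f M \<and> packs E k W f N \<and> vdeg M \<noteq> vdeg N)"
proof
  assume "packable E 1 k W f"
  then obtain D where "D \<subseteq> vdeg ` {M. packs E k W f M}" "card D = 2"
    unfolding packable_def by (auto simp: numeral_2_eq_2)
  moreover from this obtain d d' where "D = {d, d'}" "d \<noteq> d'"
    by (meson card_2_iff)
  ultimately have "d \<in> vdeg ` {M. packs E k W f M}" "d' \<in> vdeg ` {M. packs E k W f M}"
    by auto
  with \<open>d \<noteq> d'\<close> show "\<exists>M N. packs E k W f M \<and> packs E k W f N \<and> vdeg M \<noteq> vdeg N"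
    by blast
next
  assume "\<exists>M N. packs E k W f M \<and> packs E k W f N \<and> vdeg M \<noteq> vdeg N"
  then obtain M N where "packs E k W f M" "packs E k W f N" "vdeg M \<noteq> vdeg N" by blast
  then show "packable E 1 k W f"
    unfolding packable_def by (intro exI[of _ "{vdeg M, vdeg N}"]) auto
qed

lemma packable_mono:
  assumes "packable E i k V f" "W \<subseteq> V" "\<And>v. v \<in> W \<Longrightarrow> f v \<le> g v"
  shows "packable E i k W g"
proof -
  have "packs E k W g M" if "packs E k V f M" for M
    using that assms(2,3) unfolding packs_def by (meson order_trans subsetD)
  then have "vdeg ` {M. packs E k V f M} \<subseteq> vdeg ` {M. packs E k W g M}" by blast
  with assms(1) show ?thesis unfolding packable_def by (meson subset_trans)
qed

lemma packable_add_edge: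
  assumes "packable E i k W f" "e \<in> E"
  shows "packable E i (Suc k) W (\<lambda>x. f x + of_bool (x \<in> e))"
proof -
  obtain D where D: "D \<subseteq> vdeg ` {M. packs E k W f M}" "card D = Suc i"
    using assms(1) unfolding packable_def by blast
  define s where "s d = (\<lambda>x. of_bool (x \<in> e) + d x)" for d :: "nat \<Rightarrow> nat"
  have "inj_on s D"
    by (auto simp: inj_on_def s_def fun_eq_iff)
  then have "card (s ` D) = Suc i"
    using D(2) by (simp add: card_image)
  moreover have "s ` D \<subseteq> vdeg ` {M. packs E (Suc k) W (\<lambda>x. f x + of_bool (x \<in> e)) M}"
  proof
    fix d assume "d \<in> s ` D"
    then obtain M where M: "packs E k W f M" "d = s (vdeg M)"
      using D(1) by blast
    have "packs E (Suc k) W (\<lambda>x. f x + of_bool (x \<in> e)) (add_mset e M)"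
      using M(1) assms(2) by (auto simp: packs_def)
    moreover have "vdeg (add_mset e M) = d"
      by (auto simp: M(2) s_def)
    ultimately show "d \<in> vdeg ` {M. packs E (Suc k) W (\<lambda>x. f x + of_bool (x \<in> e)) M}"
      by blast
  qed
  ultimately show ?thesis unfolding packable_def by blast
qed

text \<open>
  Bounds on \<open>W\<close> extend to larger vertex sets: a vertex has degree at most \<open>k\<close> in a multiset of \<open>k\<close>
  edges, so the bound \<open>k\<close> is no restriction.
\<close>

lemma packable_extend:
  assumes "packable E i k W f"
  shows "packable E i k V (\<lambda>v. if v \<in> W then f v else k)"
proof -
  have "packs E k V (\<lambda>v. if v \<in> W then f v else k) M" if "packs E k W f M" for M
    using that vdeg_le_size[of M] by (auto simp: packs_def)
  then have "vdeg ` {M. packs E k W f M} \<subseteq> vdeg ` {M. packs E k V (\<lambda>v. if v \<in> W then f v else k) M}"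
    by blast
  with assms show ?thesis unfolding packable_def by (meson subset_trans)
qed

lemma packable_no_edges: "k > 0 \<Longrightarrow> \<not> packable {} i k W f"
proof -
  assume "k > 0"
  then have "{M. packs {} k W f M} = {}" by (auto simp: packs_def)
  then show ?thesis by (simp add: packable_def)
qed

lemma edge_keeping_unpackable_degrees:
  assumes E: "\<forall>e\<in>E. card e = 2" "E \<noteq> {}" and k: "k > 0" and i: "i = 0 \<or> i = 1"
    and none: "\<not> packable E i k W f"
    and soc: "\<And>v. v \<in> W \<Longrightarrow> packable E i k W (\<lambda>x. f x + of_bool (x = v))"
  shows "\<exists>e\<in>E. \<not> packable E i (Suc k) W (\<lambda>x. f x + of_bool (x \<in> e))"
  using i
proof
  assume i: "i = 0"
  have "\<exists>e\<in>E. \<forall>M. \<not> packs E (Suc k) W (\<lambda>x. f x + of_bool (x \<in> e)) M"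
    by (rule edge_keeping_unpackable[OF E k]) (use none soc in \<open>auto simp: i packable_0\<close>)
  then show ?thesis by (simp add: i packable_0)
next
  assume i: "i = 1"
  have "\<exists>e\<in>E. \<forall>M N. packs E (Suc k) W (\<lambda>x. f x + of_bool (x \<in> e)) M
       \<longrightarrow> packs E (Suc k) W (\<lambda>x. f x + of_bool (x \<in> e)) N \<longrightarrow> vdeg M = vdeg N"
    by (rule edge_keeping_unique_packing[OF E k]) (use none soc in \<open>unfold i packable_1, blast+\<close>)
  then show ?thesis unfolding i packable_1 by blast
qed

section \<open>Ideals spanned by monomials\<close>

lemma polyring_simps [simp]:
  "p \<oplus>\<^bsub>polyring V\<^esub> q = p + q" "p \<otimes>\<^bsub>polyring V\<^esub> q = p * q"
  "\<zero>\<^bsub>polyring V\<^esub> = 0" "\<one>\<^bsub>polyring V\<^esub> = 1"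
  "p \<in> carrier (polyring V) \<longleftrightarrow> (\<forall>a \<in> Poly_Mapping.keys p. Poly_Mapping.keys a \<subseteq> V)"
  by (simp_all add: polyring_def)

lemma keys_add_nat: "Poly_Mapping.keys (a + b) = Poly_Mapping.keys a \<union> Poly_Mapping.keys (b :: nat \<Rightarrow>\<^sub>0 nat)"
  by (auto simp: in_keys_iff lookup_add)

lemma monom_mult: "monom a * monom b = monom (a + b)"
  by (simp add: monom_def mult_single)

lemma keys_monom [simp]: "Poly_Mapping.keys (monom a :: 'k::field mpoly) = {a}"
  by (simp add: monom_def)

lemma keys_monom_mult: "Poly_Mapping.keys (monom u * q :: 'k::field mpoly) = (+) u ` Poly_Mapping.keys q"
proof
  show "Poly_Mapping.keys (monom u * q) \<subseteq> (+) u ` Poly_Mapping.keys q"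
    using keys_mult[of "monom u" q] by auto
  show "(+) u ` Poly_Mapping.keys q \<subseteq> Poly_Mapping.keys (monom u * q)"
    by (auto simp: in_keys_iff monom_def lookup_single_mult)
qed

text \<open>
  Every monomial ideal of \<open>polyring V\<close> has this form with an upward closed set \<open>X\<close> of exponent
  vectors; conversely the set is an ideal for upward closed \<open>X\<close>.
\<close>

definition mono_span :: "nat set \<Rightarrow> (nat \<Rightarrow>\<^sub>0 nat) set \<Rightarrow> 'k::field mpoly set" where
  "mono_span V X = {p. \<forall>a \<in> Poly_Mapping.keys p. Poly_Mapping.keys a \<subseteq> V \<and> a \<in> X}"

definition upset :: "(nat \<Rightarrow>\<^sub>0 nat) set \<Rightarrow> bool" where
  "upset X \<longleftrightarrow> (\<forall>a b. a \<in> X \<longrightarrow> a + b \<in> X)"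

lemma monom_in_mono_span [simp]:
  "(monom a :: 'k::field mpoly) \<in> mono_span V X \<longleftrightarrow> Poly_Mapping.keys a \<subseteq> V \<and> a \<in> X"
  by (simp add: mono_span_def)

lemma mono_span_cong: "(\<And>a. Poly_Mapping.keys a \<subseteq> V \<Longrightarrow> a \<in> X \<longleftrightarrow> a \<in> Y) \<Longrightarrow> mono_span V X = mono_span V Y"
  by (auto simp: mono_span_def)

lemma ring_polyring: "ring (polyring V :: 'k::field mpoly ring)"
  using polyring_cring cring.axioms(1) by blast

lemma polyring_uminus:
  fixes p :: "'k::field mpoly"
  assumes "p \<in> carrier (polyring V)"
  shows "\<ominus>\<^bsub>polyring V\<^esub> p = - p"
proof -
  interpret cring "polyring V :: 'k mpoly ring" by (rule polyring_cring)
  show ?thesis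
    by (rule minus_equality) (use assms in auto)
qed

lemma mono_span_ideal:
  assumes "upset X"
  shows "ideal (mono_span V X :: 'k::field mpoly set) (polyring V)"
proof (rule idealI)
  let ?R = "polyring V :: 'k mpoly ring" and ?J = "mono_span V X :: 'k mpoly set"
  interpret cring ?R by (rule polyring_cring)
  show "ring ?R" by (rule ring_polyring)
  have sub: "?J \<subseteq> carrier ?R" by (auto simp: mono_span_def)
  show "subgroup ?J (add_monoid ?R)"
  proof (rule subgroup.intro)
    show "?J \<subseteq> carrier (add_monoid ?R)" using sub by simp
    show "\<one>\<^bsub>add_monoid ?R\<^esub> \<in> ?J" by (simp add: mono_span_def)
    show "p \<otimes>\<^bsub>add_monoid ?R\<^esub> q \<in> ?J" if "p \<in> ?J" "q \<in> ?J" for p q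
      using that Poly_Mapping.keys_add[of p q] by (fastforce simp: mono_span_def)
    show "inv\<^bsub>add_monoid ?R\<^esub> p \<in> ?J" if "p \<in> ?J" for p
      using that polyring_uminus[of p V] sub by (auto simp: mono_span_def a_inv_def)
  qed
  show "r \<otimes>\<^bsub>?R\<^esub> p \<in> ?J" if p: "p \<in> ?J" and r: "r \<in> carrier ?R" for p r
  proof -
    have "Poly_Mapping.keys c \<subseteq> V \<and> c \<in> X" if "c \<in> Poly_Mapping.keys (r * p)" for c
    proof -
      obtain a b where ab: "c = a + b" "a \<in> Poly_Mapping.keys r" "b \<in> Poly_Mapping.keys p"
        using \<open>c \<in> Poly_Mapping.keys (r * p)\<close> keys_mult[of r p] by blast
      then have "b + a \<in> X" using assms p by (auto simp: upset_def mono_span_def)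
      then show ?thesis using ab p r by (auto simp: keys_add_nat mono_span_def add.commute)
    qed
    then show ?thesis by (simp add: mono_span_def)
  qed
  then show "p \<otimes>\<^bsub>?R\<^esub> r \<in> ?J" if p: "p \<in> ?J" and r: "r \<in> carrier ?R" for p r
    using that by (simp add: mult.commute)
qed

lemma poly_mapping_sum_singles:
  fixes p :: "'k::field mpoly"
  shows "p = (\<Sum>a\<in>Poly_Mapping.keys p. Poly_Mapping.single a (Poly_Mapping.lookup p a))"
proof (rule poly_mapping_eqI)
  fix b
  show "Poly_Mapping.lookup p b = Poly_Mapping.lookup (\<Sum>a\<in>Poly_Mapping.keys p. Poly_Mapping.single a (Poly_Mapping.lookup p a)) b"
    by (simp add: lookup_sum lookup_single when_def sum.delta' in_keys_iff)
qed

lemma ideal_sumI: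
  fixes J :: "'k::field mpoly set"
  assumes J: "ideal J (polyring V)" and "\<And>x. x \<in> F \<Longrightarrow> g x \<in> J"
  shows "sum g F \<in> J"
proof -
  have "0 \<in> J"
    using additive_subgroup.zero_closed[OF ideal.axioms(1)[OF J]] by simp
  then show ?thesis
    using assms(2)
  proof (induction F rule: infinite_finite_induct)
    case (insert x F)
    have "g x \<oplus>\<^bsub>polyring V\<^esub> sum g F \<in> J"
      by (rule additive_subgroup.a_closed[OF ideal.axioms(1)[OF J]]) (use insert in auto)
    then show ?case using insert by simp
  qed auto
qed

lemma ideal_keysI:
  fixes J :: "'k::field mpoly set"
  assumes J: "ideal J (polyring V)" and "\<And>a. a \<in> Poly_Mapping.keys p \<Longrightarrow> monom a \<in> J"
  shows "p \<in> J"
proof -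
  have "Poly_Mapping.single a (Poly_Mapping.lookup p a) \<in> J" if "a \<in> Poly_Mapping.keys p" for a
  proof -
    have "Poly_Mapping.single 0 (Poly_Mapping.lookup p a) \<otimes>\<^bsub>polyring V\<^esub> monom a \<in> J"
      by (rule ideal.I_l_closed[OF J assms(2)[OF that]]) simp
    then show ?thesis by (simp add: monom_def mult_single)
  qed
  then show ?thesis
    by (subst poly_mapping_sum_singles) (rule ideal_sumI[OF J])
qed

lemma upset_generated: "upset {u + b |u b. u \<in> A}"
  unfolding upset_def
proof clarify
  fix u b c :: "nat \<Rightarrow>\<^sub>0 nat"
  assume "u \<in> A"
  moreover have "u + b + c = u + (b + c)" by (rule add.assoc)
  ultimately show "\<exists>v d. u + b + c = v + d \<and> v \<in> A" by blast
qed

lemma genideal_monoms: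
  fixes A :: "(nat \<Rightarrow>\<^sub>0 nat) set"
  assumes "\<And>a. a \<in> A \<Longrightarrow> Poly_Mapping.keys a \<subseteq> V"
  shows "Idl\<^bsub>polyring V\<^esub> (monom ` A :: 'k::field mpoly set) = mono_span V {a + b |a b. a \<in> A}"
proof
  let ?R = "polyring V :: 'k mpoly ring"
  interpret cring ?R by (rule polyring_cring)
  have up: "upset {a + b |a b. a \<in> A}"
    by (rule upset_generated)
  show "Idl\<^bsub>?R\<^esub> (monom ` A) \<subseteq> mono_span V {a + b |a b. a \<in> A}"
  proof (rule genideal_minimal[OF mono_span_ideal[OF up]])
    show "monom ` A \<subseteq> (mono_span V {a + b |a b. a \<in> A} :: 'k mpoly set)"
      using assms by auto (metis add.right_neutral)
  qed
  have sub: "(monom ` A :: 'k mpoly set) \<subseteq> carrier ?R"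
    using assms by auto
  have id: "ideal (Idl\<^bsub>?R\<^esub> (monom ` A)) ?R"
    by (rule genideal_ideal[OF sub])
  show "mono_span V {a + b |a b. a \<in> A} \<subseteq> Idl\<^bsub>?R\<^esub> (monom ` A :: 'k mpoly set)"
  proof
    fix p :: "'k mpoly"
    assume p: "p \<in> mono_span V {a + b |a b. a \<in> A}"
    show "p \<in> Idl\<^bsub>?R\<^esub> (monom ` A)"
    proof (rule ideal_keysI[OF id])
      fix c assume "c \<in> Poly_Mapping.keys p"
      then obtain a b where ab: "c = a + b" "a \<in> A" "Poly_Mapping.keys c \<subseteq> V"
        using p unfolding mono_span_def by blast
      have "monom a \<in> Idl\<^bsub>?R\<^esub> (monom ` A :: 'k mpoly set)"
        using genideal_self[OF sub] ab(2) by blast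
      then have "monom b \<otimes>\<^bsub>?R\<^esub> monom a \<in> Idl\<^bsub>?R\<^esub> (monom ` A :: 'k mpoly set)"
        by (rule ideal.I_l_closed[OF id]) (use ab in \<open>auto simp: keys_add_nat\<close>)
      then show "monom c \<in> Idl\<^bsub>?R\<^esub> (monom ` A :: 'k mpoly set)"
        by (simp add: monom_mult ab(1) add.commute)
    qed
  qed
qed

lemma ideal_prod_mono_span:
  assumes "upset X" "upset Y"
  shows "ideal_prod (polyring V) (mono_span V X) (mono_span V Y :: 'k::field mpoly set)
    = mono_span V {a + b |a b. a \<in> X \<and> b \<in> Y}"
proof
  let ?R = "polyring V :: 'k mpoly ring"
  let ?Z = "{a + b |a b. a \<in> X \<and> b \<in> Y}"
  show "ideal_prod ?R (mono_span V X) (mono_span V Y) \<subseteq> mono_span V ?Z"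
  proof
    fix p assume "p \<in> ideal_prod ?R (mono_span V X) (mono_span V Y)"
    then show "p \<in> mono_span V ?Z"
    proof induction
      case (prod p q)
      have "Poly_Mapping.keys c \<subseteq> V \<and> c \<in> ?Z" if "c \<in> Poly_Mapping.keys (p * q)" for c
      proof -
        obtain a b where "c = a + b" "a \<in> Poly_Mapping.keys p" "b \<in> Poly_Mapping.keys q"
          using \<open>c \<in> Poly_Mapping.keys (p * q)\<close> keys_mult[of p q] by blast
        with prod have "a \<in> X" "b \<in> Y" "Poly_Mapping.keys c \<subseteq> V"
          by (auto simp: mono_span_def keys_add_nat)
        with \<open>c = a + b\<close> show ?thesis by blast
      qed
      then show ?case by (simp add: mono_span_def)
    next
      case (sum p q)
      then show ?case
        using Poly_Mapping.keys_add[of p q] by (fastforce simp: mono_span_def)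
    qed
  qed
  show "mono_span V ?Z \<subseteq> ideal_prod ?R (mono_span V X) (mono_span V Y)"
  proof
    fix p :: "'k mpoly"
    assume p: "p \<in> mono_span V ?Z"
    show "p \<in> ideal_prod ?R (mono_span V X) (mono_span V Y)"
    proof (rule ideal_keysI)
      show "ideal (ideal_prod ?R (mono_span V X) (mono_span V Y)) ?R"
        by (intro ring.ideal_prod_is_ideal ring_polyring mono_span_ideal assms)
      fix c assume "c \<in> Poly_Mapping.keys p"
      then obtain a b where ab: "c = a + b" "a \<in> X" "b \<in> Y" "Poly_Mapping.keys c \<subseteq> V"
        using p unfolding mono_span_def by blast
      then have "monom a \<otimes>\<^bsub>?R\<^esub> monom b \<in> ideal_prod ?R (mono_span V X) (mono_span V Y)"
        by (intro ideal_prod.prod) (auto simp: keys_add_nat)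
      then show "monom c \<in> ideal_prod ?R (mono_span V X) (mono_span V Y)"
        by (simp add: monom_mult ab(1))
    qed
  qed
qed

section \<open>Powers of the edge ideal\<close>

lemma lookup_sqfree_of_bool: "finite T \<Longrightarrow> Poly_Mapping.lookup (sqfree T) v = of_bool (v \<in> T)"
  by (simp add: lookup_sqfree)

definition fitting_exps :: "nat set set \<Rightarrow> nat \<Rightarrow> nat \<Rightarrow> nat set \<Rightarrow> (nat \<Rightarrow>\<^sub>0 nat) set" where
  "fitting_exps E i k V = {a. packable E i k V (Poly_Mapping.lookup a)}"

lemma upset_fitting_exps: "upset (fitting_exps E i k V)"
  unfolding upset_def fitting_exps_def
  by (auto intro: packable_mono simp: lookup_add)

lemma simple_graph_edge: "simple_graph n E \<Longrightarrow> e \<in> E \<Longrightarrow> finite e \<and> e \<subseteq> {1..n} \<and> card e = 2"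
  unfolding simple_graph_def by (meson finite_atLeastAtMost finite_subset)

lemma edge_ideal_eq:
  assumes "simple_graph n E"
  shows "(edge_ideal n E :: 'k::field mpoly set) = mono_span {1..n} (fitting_exps E 0 1 {1..n})"
proof -
  have "{Var i * Var j | i j. {i, j} \<in> E} = (monom ` (sqfree ` E) :: 'k mpoly set)"
  proof (intro equalityI subsetI)
    fix p :: "'k mpoly"
    assume "p \<in> {Var i * Var j | i j. {i, j} \<in> E}"
    then obtain i j where ij: "p = Var i * Var j" "{i, j} \<in> E" by blast
    then have "i \<noteq> j" using simple_graph_edge[OF assms ij(2)] by (auto simp: card_insert_if)
    then have "p = monom (sqfree {i, j})"
      by (simp add: ij(1) sqfree_def Var_def monom_mult)
    then show "p \<in> monom ` (sqfree ` E)" using ij(2) by blast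
  next
    fix p :: "'k mpoly"
    assume "p \<in> monom ` (sqfree ` E)"
    then obtain e where e: "e \<in> E" "p = monom (sqfree e)" by blast
    then obtain i j where ij: "e = {i, j}" "i \<noteq> j"
      using simple_graph_edge[OF assms e(1)] by (meson card_2_iff)
    then have "p = Var i * Var j"
      by (simp add: e(2) sqfree_def Var_def monom_mult)
    then show "p \<in> {Var i * Var j | i j. {i, j} \<in> E}" using e(1) ij(1) by blast
  qed
  then have "(edge_ideal n E :: 'k mpoly set) = Idl\<^bsub>polyring {1..n}\<^esub> (monom ` (sqfree ` E))"
    by (simp add: edge_ideal_def)
  also have "\<dots> = mono_span {1..n} {a + b |a b. a \<in> sqfree ` E}"
  proof (rule genideal_monoms)
    fix a assume "a \<in> sqfree ` E"
    then show "Poly_Mapping.keys a \<subseteq> {1..n}"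
      using simple_graph_edge[OF assms] by (fastforce simp: in_keys_iff lookup_sqfree split: if_splits)
  qed
  also have "\<dots> = mono_span {1..n} (fitting_exps E 0 1 {1..n})"
  proof (rule mono_span_cong)
    fix c :: "nat \<Rightarrow>\<^sub>0 nat"
    show "c \<in> {a + b |a b. a \<in> sqfree ` E} \<longleftrightarrow> c \<in> fitting_exps E 0 1 {1..n}"
    proof
      assume "c \<in> {a + b |a b. a \<in> sqfree ` E}"
      then obtain e b where e: "e \<in> E" "c = sqfree e + b" by blast
      then have "packs E 1 {1..n} (Poly_Mapping.lookup c) {#e#}"
        using simple_graph_edge[OF assms e(1)] by (simp add: packs_def lookup_add lookup_sqfree_of_bool)
      then show "c \<in> fitting_exps E 0 1 {1..n}"
        by (auto simp: fitting_exps_def packable_0)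
    next
      assume "c \<in> fitting_exps E 0 1 {1..n}"
      then obtain M where M: "packs E 1 {1..n} (Poly_Mapping.lookup c) M"
        by (auto simp: fitting_exps_def packable_0)
      then obtain e where e: "M = {#e#}" "e \<in> E"
        using size_1_singleton_mset[of M] by (auto simp: packs_def)
      have "c = sqfree e + (c - sqfree e)"
      proof (rule poly_mapping_eqI)
        fix v
        show "Poly_Mapping.lookup c v = Poly_Mapping.lookup (sqfree e + (c - sqfree e)) v"
          using M e simple_graph_edge[OF assms e(2)]
          by (force simp: lookup_add lookup_minus lookup_sqfree_of_bool packs_def of_bool_def)
      qed
      then show "c \<in> {a + b |a b. a \<in> sqfree ` E}" using e(2) by blast
    qed
  qed
  finally show ?thesis .
qed

lemma ideal_power_edge_ideal:
  assumes "simple_graph n E"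
  shows "ideal_power (polyring {1..n}) (edge_ideal n E :: 'k::field mpoly set) k
    = mono_span {1..n} (fitting_exps E 0 k {1..n})"
proof (induction k)
  case 0
  have "fitting_exps E 0 0 {1..n} = UNIV"
    by (auto simp: fitting_exps_def packable_0 packs_def)
  then show ?case
    by (intro Set.set_eqI) (simp only: nat_pow_def ideals_set_def mono_span_def, simp)
next
  case (Suc k)
  let ?V = "{1..n}"
  have "ideal_power (polyring ?V) (edge_ideal n E :: 'k mpoly set) (Suc k)
    = ideal_prod (polyring ?V) (ideal_power (polyring ?V) (edge_ideal n E) k) (edge_ideal n E)"
    by (simp add: nat_pow_def ideals_set_def)
  also have "\<dots> = mono_span ?V {a + b |a b. a \<in> fitting_exps E 0 k ?V \<and> b \<in> fitting_exps E 0 1 ?V}"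
    unfolding Suc unfolding edge_ideal_eq[OF assms]
    by (rule ideal_prod_mono_span[OF upset_fitting_exps upset_fitting_exps])
  also have "\<dots> = mono_span ?V (fitting_exps E 0 (Suc k) ?V)"
  proof (rule mono_span_cong)
    fix c :: "nat \<Rightarrow>\<^sub>0 nat"
    show "c \<in> {a + b |a b. a \<in> fitting_exps E 0 k ?V \<and> b \<in> fitting_exps E 0 1 ?V}
      \<longleftrightarrow> c \<in> fitting_exps E 0 (Suc k) ?V"
    proof
      assume "c \<in> {a + b |a b. a \<in> fitting_exps E 0 k ?V \<and> b \<in> fitting_exps E 0 1 ?V}"
      then obtain a b M N where "c = a + b" "packs E k ?V (Poly_Mapping.lookup a) M" "packs E 1 ?V (Poly_Mapping.lookup b) N"
        by (auto simp: fitting_exps_def packable_0)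
      then have "packs E (Suc k) ?V (Poly_Mapping.lookup c) (M + N)"
        by (auto simp: packs_def lookup_add intro: add_mono)
      then show "c \<in> fitting_exps E 0 (Suc k) ?V"
        by (auto simp: fitting_exps_def packable_0)
    next
      assume "c \<in> fitting_exps E 0 (Suc k) ?V"
      then obtain M where M: "packs E (Suc k) ?V (Poly_Mapping.lookup c) M"
        by (auto simp: fitting_exps_def packable_0)
      then obtain e N where e: "M = add_mset e N" "e \<in> E"
        by (metis packs_def size_eq_Suc_imp_eq_union union_single_eq_member subsetD)
      note fe = simple_graph_edge[OF assms e(2)]
      have le: "of_bool (v \<in> e) + vdeg N v \<le> Poly_Mapping.lookup c v" if "v \<in> ?V" for v
        using M e that by (auto simp: packs_def)
      have "c = (c - sqfree e) + sqfree e"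
      proof (rule poly_mapping_eqI)
        fix v
        show "Poly_Mapping.lookup c v = Poly_Mapping.lookup ((c - sqfree e) + sqfree e) v"
          using le[of v] fe
          by (cases "v \<in> e") (auto simp: lookup_add lookup_minus lookup_sqfree_of_bool)
      qed
      moreover have "packs E k ?V (Poly_Mapping.lookup (c - sqfree e)) N"
        unfolding packs_def
      proof (intro conjI ballI)
        show "set_mset N \<subseteq> E" "size N = k" using M e by (auto simp: packs_def)
        fix v assume "v \<in> ?V"
        with le[of v] show "vdeg N v \<le> Poly_Mapping.lookup (c - sqfree e) v"
          using fe by (simp add: lookup_minus lookup_sqfree_of_bool)
      qed
      moreover have "packs E 1 ?V (Poly_Mapping.lookup (sqfree e)) {#e#}"
        using fe e(2) by (simp add: packs_def lookup_sqfree_of_bool)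
      ultimately show "c \<in> {a + b |a b. a \<in> fitting_exps E 0 k ?V \<and> b \<in> fitting_exps E 0 1 ?V}"
        unfolding fitting_exps_def packable_0 by blast
    qed
  qed
  finally show ?case .
qed

section \<open>Computing homological shift ideals\<close>

definition exp_total :: "(nat \<Rightarrow>\<^sub>0 nat) \<Rightarrow> nat" where
  "exp_total a = (\<Sum>v\<in>Poly_Mapping.keys a. Poly_Mapping.lookup a v)"

lemma exp_total_add_single: "exp_total (a + Poly_Mapping.single v 1) = Suc (exp_total a)"
proof -
  have eq: "exp_total b = (\<Sum>w\<in>insert v (Poly_Mapping.keys a). Poly_Mapping.lookup b w)"
    if "Poly_Mapping.keys b \<subseteq> insert v (Poly_Mapping.keys a)" for b
    unfolding exp_total_def using that by (intro sum.mono_neutral_left) (auto simp: in_keys_iff)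
  have "exp_total (a + Poly_Mapping.single v 1) = (\<Sum>w\<in>insert v (Poly_Mapping.keys a). Poly_Mapping.lookup a w + (if w = v then 1 else 0))"
    by (subst eq) (auto simp: keys_add_nat lookup_add lookup_single when_def intro!: sum.cong)
  also have "\<dots> = (\<Sum>w\<in>insert v (Poly_Mapping.keys a). Poly_Mapping.lookup a w) + 1"
    by (simp add: sum.distrib sum.delta)
  also have "\<dots> = Suc (exp_total a)"
    using eq[OF subset_insertI] by simp
  finally show ?thesis .
qed

text \<open>
  Subtraction of exponent vectors is truncated, so this needs the variable \<open>x_j\<close> to occur.
\<close>

lemma exp_peel:
  assumes "Poly_Mapping.lookup (b :: nat \<Rightarrow>\<^sub>0 nat) j \<noteq> 0"
  shows "b = Poly_Mapping.single j 1 + (b - Poly_Mapping.single j 1)"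
  by (rule poly_mapping_eqI) (use assms in \<open>auto simp: lookup_add lookup_minus lookup_single when_def\<close>)

lemma exp_nonzero_peel:
  assumes "(b :: nat \<Rightarrow>\<^sub>0 nat) \<noteq> 0"
  obtains j r where "b = Poly_Mapping.single j 1 + r"
proof -
  have "Poly_Mapping.keys b \<noteq> {}" using assms by simp
  then obtain j where "j \<in> Poly_Mapping.keys b" by blast
  then have "Poly_Mapping.lookup b j \<noteq> 0" by (simp add: in_keys_iff)
  then show thesis using exp_peel that by blast
qed

lemma koszul_chains_zero: "0 \<in> J \<Longrightarrow> (\<lambda>_. 0) \<in> koszul_chains V J i a"
  by (simp add: koszul_chains_def)

lemma koszul_diff_zero: "koszul_diff V (\<lambda>_. 0) = (\<lambda>_. 0)"
  by (simp add: koszul_diff_def)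

lemma zero_boundary: "0 \<in> J \<Longrightarrow> (\<lambda>_. 0) \<in> tor_boundaries V J i a"
  unfolding tor_boundaries_def
  by (rule image_eqI[where x = "\<lambda>_. 0"]) (simp_all add: koszul_diff_zero koszul_chains_zero)

lemma koszul_chain_keysD:
  assumes "c \<in> koszul_chains V J i a" "b \<in> Poly_Mapping.keys (c T)"
  shows "T \<subseteq> V" "card T = i" "b + sqfree T = a" "c T \<in> J"
proof -
  have "T \<subseteq> V \<and> card T = i"
  proof (rule ccontr)
    assume "\<not> (T \<subseteq> V \<and> card T = i)"
    then have "c T = 0" using assms(1) by (auto simp: koszul_chains_def)
    then show False using assms(2) by simp
  qed
  then show "T \<subseteq> V" "card T = i" "b + sqfree T = a" "c T \<in> J"
    using assms by (auto simp: koszul_chains_def dest!: spec[of _ T])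
qed

lemma HS_eq_mono_span:
  "HS V i J = mono_span V {a + b |a b. Poly_Mapping.keys a \<subseteq> V \<and> Tor_nonzero V i (J :: 'k::field mpoly set) a}"
proof -
  have "HS V i J = Idl\<^bsub>polyring V\<^esub> (monom ` {a. Poly_Mapping.keys a \<subseteq> V \<and> Tor_nonzero V i J a})"
    unfolding HS_def by (rule arg_cong) blast
  also have "\<dots> = mono_span V {a + b |a b. a \<in> {a. Poly_Mapping.keys a \<subseteq> V \<and> Tor_nonzero V i J a}}"
    by (rule genideal_monoms) simp
  finally show ?thesis by simp
qed

text \<open>
  It suffices that the multidegrees of \<open>Tor\<close> lie in \<open>X\<close> and that the minimal elements of \<open>X\<close> are
  such multidegrees. This avoids describing all multidegrees: they may be harder to determine than the ideal
  they generate.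
\<close>

lemma HS_eqI:
  fixes J :: "'k::field mpoly set"
  assumes up: "upset X"
    and sound: "\<And>a. Poly_Mapping.keys a \<subseteq> V \<Longrightarrow> Tor_nonzero V i J a \<Longrightarrow> a \<in> X"
    and minimal: "\<And>a. Poly_Mapping.keys a \<subseteq> V \<Longrightarrow> a \<in> X \<Longrightarrow> (\<And>j b. a = b + Poly_Mapping.single j 1 \<Longrightarrow> b \<notin> X) \<Longrightarrow> Tor_nonzero V i J a"
  shows "HS V i J = mono_span V X"
  unfolding HS_eq_mono_span
proof (rule mono_span_cong)
  let ?Y = "{a + b |a b. Poly_Mapping.keys a \<subseteq> V \<and> Tor_nonzero V i J a}"
  fix c :: "nat \<Rightarrow>\<^sub>0 nat"
  assume c: "Poly_Mapping.keys c \<subseteq> V"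
  show "c \<in> ?Y \<longleftrightarrow> c \<in> X"
  proof
    assume "c \<in> ?Y"
    then obtain a b where "c = a + b" "Poly_Mapping.keys a \<subseteq> V" "Tor_nonzero V i J a" by blast
    then show "c \<in> X" using sound up by (auto simp: upset_def)
  next
    assume "c \<in> X"
    with c show "c \<in> ?Y"
    proof (induction "exp_total c" arbitrary: c rule: less_induct)
      case less
      show ?case
      proof (cases "\<exists>j b. c = b + Poly_Mapping.single j 1 \<and> b \<in> X")
        case True
        then obtain j b where b: "c = b + Poly_Mapping.single j 1" "b \<in> X" by blast
        have "b \<in> ?Y"
          by (rule less.hyps) (use b less.prems(1) in \<open>auto simp: exp_total_add_single keys_add_nat simp del: One_nat_def\<close>)
        then obtain a d where a: "b = a + d" "Poly_Mapping.keys a \<subseteq> V" "Tor_nonzero V i J a" by blast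
        then have "c = a + (d + Poly_Mapping.single j 1)" by (simp add: b(1) add.assoc)
        with a(2,3) show ?thesis by blast
      next
        case False
        then have "Tor_nonzero V i J c"
          using minimal[OF less.prems] by blast
        then show ?thesis using less.prems(1) by (metis (mono_tags, lifting) add.right_neutral mem_Collect_eq)
      qed
    qed
  qed
qed

lemma HS_0_mono_span:
  fixes V :: "nat set"
  assumes V: "finite V" and up: "upset X"
  shows "HS V 0 (mono_span V X :: 'k::field mpoly set) = mono_span V X"
proof (rule HS_eqI[OF up])
  let ?J = "mono_span V X :: 'k mpoly set"
  have fin: "finite T" if "T \<subseteq> V" for T using that V by (rule finite_subset)
  have zero: "0 \<in> ?J" by (simp add: mono_span_def)
  {
    fix a assume "Poly_Mapping.keys a \<subseteq> V" "Tor_nonzero V 0 ?J a"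
    then obtain c where c: "c \<in> koszul_chains V ?J 0 a" "c \<notin> tor_boundaries V ?J 0 a"
      by (auto simp: Tor_nonzero_def tor_cycles_def)
    then have "c \<noteq> (\<lambda>_. 0)" using zero_boundary[OF zero] by blast
    then obtain T b where "b \<in> Poly_Mapping.keys (c T)" by (metis all_not_in_conv keys_eq_empty ext)
    note b = this koszul_chain_keysD[OF c(1) this]
    then have "T = {}" using fin[of T] by simp
    then have "b = a" using b(4) by (simp add: sqfree_def)
    then show "a \<in> X" using b by (auto simp: mono_span_def)
  next
    fix a assume a: "Poly_Mapping.keys a \<subseteq> V" "a \<in> X" and min: "\<And>j b. a = b + Poly_Mapping.single j 1 \<Longrightarrow> b \<notin> X"
    \<comment> \<open>The cycle is \<open>x\<^sup>a\<close> itself; by minimality of \<open>a\<close> there are no \<open>1\<close>-chains in this multidegree.\<close>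
    define c where "c T = (if T = {} then monom a else 0 :: 'k mpoly)" for T :: "nat set"
    have "c \<in> koszul_chains V ?J 0 a"
      unfolding koszul_chains_def using a fin zero by (auto simp: c_def sqfree_def)
    moreover have "koszul_diff V c = (\<lambda>_. 0)"
      by (simp add: koszul_diff_def c_def)
    moreover have "c \<notin> tor_boundaries V ?J 0 a"
    proof
      assume "c \<in> tor_boundaries V ?J 0 a"
      then obtain d where d: "d \<in> koszul_chains V ?J 1 a" "c = koszul_diff V d"
        by (auto simp: tor_boundaries_def)
      have "d T = 0" for T
      proof (rule ccontr)
        assume "d T \<noteq> 0"
        then obtain b where "b \<in> Poly_Mapping.keys (d T)" by (metis all_not_in_conv keys_eq_empty)
        note b = this koszul_chain_keysD[OF d(1) this]
        then obtain j where "T = {j}" by (meson card_1_singletonE)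
        then have "a = b + Poly_Mapping.single j 1" using b(4) by (simp add: sqfree_def)
        then show False using min b by (auto simp: mono_span_def)
      qed
      then have "c {} = 0" unfolding d(2) by (simp add: koszul_diff_def)
      then have "Poly_Mapping.keys (monom a :: 'k mpoly) = {}" by (simp add: c_def)
      then show False by simp
    qed
    ultimately show "Tor_nonzero V 0 ?J a"
      by (auto simp: Tor_nonzero_def tor_cycles_def)
  }
qed

lemma monom_factor:
  fixes p :: "'k::field mpoly"
  assumes "\<And>m. m \<in> Poly_Mapping.keys p \<Longrightarrow> \<exists>b. m = u + b"
  shows "\<exists>q. p = monom u * q"
proof -
  have "Poly_Mapping.single m (Poly_Mapping.lookup p m) = monom u * Poly_Mapping.single (m - u) (Poly_Mapping.lookup p m)" if "m \<in> Poly_Mapping.keys p" for m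
    using assms[OF that] by (auto simp: monom_def mult_single)
  then have "p = (\<Sum>m\<in>Poly_Mapping.keys p. monom u * Poly_Mapping.single (m - u) (Poly_Mapping.lookup p m))"
    by (subst poly_mapping_sum_singles) (rule sum.cong, auto)
  also have "\<dots> = monom u * (\<Sum>m\<in>Poly_Mapping.keys p. Poly_Mapping.single (m - u) (Poly_Mapping.lookup p m))"
    by (simp add: sum_distrib_left)
  finally show ?thesis by blast
qed

lemma monom_nonzero: "(monom u :: 'k::field mpoly) \<noteq> 0"
  by (metis keys_monom keys_zero insert_not_empty)

lemma koszul_diff_mult: "koszul_diff V (\<lambda>T. p * c T) = (\<lambda>T. p * koszul_diff V c T)"
  by (simp add: koszul_diff_def sum_distrib_left mult.left_commute)

text \<open>
  If all monomials of \<open>J\<close> dividing \<open>x\<^sup>a\<close> are multiples of \<open>x\<^sup>u\<close>, then in multidegree \<open>a\<close> the Koszul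
  complex of \<open>J\<close> is the one of \<open>S\<close> in multidegree \<open>a - u\<close>, multiplied by \<open>x\<^sup>u\<close>, and that
  one is exact.
\<close>

lemma Tor_vanishes:
  fixes J :: "'k::field mpoly set"
  assumes V: "finite V" and J: "J = mono_span V X" and X: "upset X" and u: "u \<in> X" and i: "i > 0"
    and only: "\<And>m b. m \<in> X \<Longrightarrow> a = m + b \<Longrightarrow> \<exists>d. m = u + d"
  shows "\<not> Tor_nonzero V i J a"
proof -
  have zero: "0 \<in> J" by (simp add: J mono_span_def)
  have "c \<in> tor_boundaries V J i a" if "c \<in> tor_cycles V J i a" for c
  proof (cases "c = (\<lambda>_. 0)")
    case True
    then show ?thesis using zero_boundary[OF zero] by simp
  next
    case False
    have ch: "c \<in> koszul_chains V J i a" and dc: "koszul_diff V c = (\<lambda>_. 0)"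
      using that by (auto simp: tor_cycles_def)
    have keysX: "b \<in> X" "Poly_Mapping.keys b \<subseteq> V" if "b \<in> Poly_Mapping.keys (c T)" for b T
      using koszul_chain_keysD(4)[OF ch that] that by (auto simp: J mono_span_def)
    have "\<exists>q. c T = monom u * q" for T
    proof (rule monom_factor)
      fix m assume m: "m \<in> Poly_Mapping.keys (c T)"
      show "\<exists>b. m = u + b"
        by (rule only[OF keysX(1)[OF m], of "sqfree T"]) (use koszul_chain_keysD(3)[OF ch m] in simp)
    qed
    then obtain q where q: "\<And>T. c T = monom u * q T" by metis
    then have cq: "c = (\<lambda>T. monom u * q T)" by auto
    have keysq: "b \<in> Poly_Mapping.keys (q T) \<Longrightarrow> u + b \<in> Poly_Mapping.keys (c T)" for b T
      unfolding q keys_monom_mult by blast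
    have q0: "c T = 0 \<longleftrightarrow> q T = 0" for T
      using monom_nonzero[of u, where 'k = 'k] by (simp add: q)
    from False obtain T0 b0 where "b0 \<in> Poly_Mapping.keys (q T0)"
      by (metis all_not_in_conv keys_eq_empty ext q0)
    from keysq[OF this] have a: "a = u + (a - u)"
      using koszul_chain_keysD(3)[OF ch] by (metis add.assoc add_diff_cancel_left')
    have uV: "Poly_Mapping.keys u \<subseteq> V"
      using keysX(2)[OF keysq[OF \<open>b0 \<in> Poly_Mapping.keys (q T0)\<close>]] by (simp add: keys_add_nat)
    have qch: "q \<in> koszul_chains V (carrier (polyring V)) i (a - u)"
      unfolding koszul_chains_def
    proof (intro CollectI allI)
      fix T
      have "Poly_Mapping.keys b \<subseteq> V" "b + sqfree T = a - u" if "b \<in> Poly_Mapping.keys (q T)" for b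
        using keysX(2)[OF keysq[OF that]] koszul_chain_keysD(3)[OF ch keysq[OF that]]
        by (auto simp: keys_add_nat add.assoc)
      moreover have "q T = 0" if "\<not> (T \<subseteq> V \<and> card T = i)"
        using ch that q0[of T] by (auto simp: koszul_chains_def)
      ultimately show "if T \<subseteq> V \<and> card T = i
        then q T \<in> carrier (polyring V) \<and> (\<forall>b\<in>Poly_Mapping.keys (q T). b + sqfree T = a - u)
        else q T = 0" by auto
    qed
    have "(\<lambda>T. monom u * koszul_diff V q T) = (\<lambda>_. 0)"
      using dc unfolding cq koszul_diff_mult .
    then have "koszul_diff V q = (\<lambda>_. 0)"
      using monom_nonzero[of u, where 'k = 'k] by (simp add: fun_eq_iff)
    then have "q \<in> tor_cycles V (carrier (polyring V)) i (a - u)"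
      using qch by (simp add: tor_cycles_def)
    then have "q \<in> tor_boundaries V (carrier (polyring V)) i (a - u)"
      using koszul_resolution(1)[OF V, of i "a - u", where 'k = 'k] i by simp
    then obtain d where d: "d \<in> koszul_chains V (carrier (polyring V)) (Suc i) (a - u)" "q = koszul_diff V d"
      by (auto simp: tor_boundaries_def)
    have "(\<lambda>T. monom u * d T) \<in> koszul_chains V J (Suc i) a"
      unfolding koszul_chains_def
    proof (intro CollectI allI)
      fix T
      have "Poly_Mapping.keys (u + b) \<subseteq> V \<and> u + b \<in> X \<and> (u + b) + sqfree T = a" if b: "b \<in> Poly_Mapping.keys (d T)" for b
      proof -
        have "Poly_Mapping.keys b \<subseteq> V" using koszul_chain_keysD(4)[OF d(1) b] b by simp
        moreover have "u + b + sqfree T = a"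
          using koszul_chain_keysD(3)[OF d(1) b] a by (simp add: add.assoc)
        ultimately show ?thesis using X u uV by (auto simp: keys_add_nat upset_def)
      qed
      moreover have "d T = 0" if "\<not> (T \<subseteq> V \<and> card T = Suc i)"
        using d(1) that by (auto simp: koszul_chains_def)
      ultimately show "if T \<subseteq> V \<and> card T = Suc i
        then monom u * d T \<in> J \<and> (\<forall>b\<in>Poly_Mapping.keys (monom u * d T). b + sqfree T = a)
        else monom u * d T = 0"
        by (auto simp: J mono_span_def keys_monom_mult)
    qed
    moreover have "c = koszul_diff V (\<lambda>T. monom u * d T)"
      unfolding koszul_diff_mult cq d(2) ..
    ultimately show ?thesis by (auto simp: tor_boundaries_def)
  qed
  then show ?thesis by (auto simp: Tor_nonzero_def)
qed

text \<open>
  The two distinct generators \<open>x\<^sup>u\<close> and \<open>x\<^sup>w\<close> divide \<open>x\<^sup>a / x_j\<close> and \<open>x\<^sup>a / x_l\<close>, and by \<open>min\<close> at most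
  one generator divides each \<open>x\<^sup>a / x_i\<close>. So the graph on the variables \<open>x_i\<close> with \<open>x\<^sup>a / x_i \<in> J\<close>, with
  an edge between \<open>x_i\<close> and \<open>x_m\<close> if \<open>x\<^sup>a / (x_i x_m) \<in> J\<close>, is disconnected: \<open>x_j\<close> and \<open>x_l\<close> lie in
  different components. The difference of these two vertices is a cycle that is not a boundary.
\<close>

lemma Tor_1_nonzero:
  fixes J :: "'k::field mpoly set"
  assumes V: "finite V" and J: "J = mono_span V {u + b |u b. u \<in> A}" and a: "Poly_Mapping.keys a \<subseteq> V"
    and u: "u \<in> A" "a = u + Poly_Mapping.single j 1 + r" and w: "w \<in> A" "a = w + Poly_Mapping.single l 1 + s" "u \<noteq> w"
    and min: "\<And>i x y b d. x \<in> A \<Longrightarrow> y \<in> A \<Longrightarrow> a = x + Poly_Mapping.single i 1 + b \<Longrightarrow> a = y + Poly_Mapping.single i 1 + d \<Longrightarrow> x = y"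
  shows "Tor_nonzero V 1 J a"
proof -
  have zero: "0 \<in> J" by (simp add: J mono_span_def)
  have jl: "j \<noteq> l" using min[OF u(1) w(1)] u(2) w(2,3) by metis
  have jV: "j \<in> V" and ru: "Poly_Mapping.keys (u + r) \<subseteq> V"
    using a by (auto simp: u(2) keys_add_nat)
  have lV: "l \<in> V" and sw: "Poly_Mapping.keys (w + s) \<subseteq> V"
    using a by (auto simp: w(2) keys_add_nat)
  have e: "u + r + Poly_Mapping.single j 1 = a" "w + s + Poly_Mapping.single l 1 = a"
    using u(2) w(2) by (simp_all only: ac_simps)
  define c where "c T = (if T = {j} then monom (u + r) else if T = {l} then - monom (w + s) else 0 :: 'k mpoly)" for T
  have in1: "(monom (u + r) :: 'k mpoly) \<in> J" "(- monom (w + s) :: 'k mpoly) \<in> J"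
    using ru sw u(1) w(1) by (auto simp: J mono_span_def)
  have ch: "c \<in> koszul_chains V J 1 a"
    unfolding koszul_chains_def
  proof (intro CollectI allI)
    fix T
    show "if T \<subseteq> V \<and> card T = 1 then c T \<in> J \<and> (\<forall>b\<in>Poly_Mapping.keys (c T). b + sqfree T = a) else c T = 0"
      using jV lV in1 zero jl e by (auto simp: c_def sqfree_def)
  qed
  have Vj: "Var j * monom (u + r) = (monom a :: 'k mpoly)" "Var l * monom (w + s) = (monom a :: 'k mpoly)"
    by (simp_all only: Var_def monom_mult add.commute[of "Poly_Mapping.single _ _"] e)
  have ks: "ksign i {} = (1 :: 'k mpoly)" for i by (simp add: ksign_def)
  have "koszul_diff V c T = 0" for T
  proof (cases "T = {}")
    case True
    have "koszul_diff V c T = (\<Sum>i\<in>{j, l}. ksign i T * Var i * c (insert i T))"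
      unfolding koszul_diff_def
      by (rule sum.mono_neutral_right) (use V jV lV True in \<open>auto simp: c_def\<close>)
    also have "\<dots> = Var j * monom (u + r) - Var l * monom (w + s)"
      using jl True by (simp add: ks c_def)
    finally show ?thesis by (simp add: Vj)
  next
    case False
    then have "c (insert i T) = 0" if "i \<notin> T" for i
      using that by (auto simp: c_def)
    then show ?thesis by (simp add: koszul_diff_def)
  qed
  then have cyc: "c \<in> tor_cycles V J 1 a" using ch by (auto simp: tor_cycles_def)
  have "c \<notin> tor_boundaries V J 1 a"
  proof
    assume "c \<in> tor_boundaries V J 1 a"
    then obtain b where b: "b \<in> koszul_chains V J (Suc 1) a" "c = koszul_diff V b"
      by (auto simp: tor_boundaries_def)
    \<comment> \<open>The set \<open>Z\<close> of all \<open>i\<close> such that \<open>x\<^sup>u\<close> divides \<open>x\<^sup>a / x_i\<close> is a union of components. It contains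
      \<open>j\<close> but not \<open>l\<close>. Restricting a chain with boundary
      \<open>c\<close> to \<open>Z\<close> gives a chain whose boundary is the part of \<open>c\<close> on \<open>Z\<close>. That part is the single vertex \<open>j\<close>,
      which is not a cycle.\<close>
    define Z where "Z = {i \<in> V. \<exists>d. a = u + Poly_Mapping.single i 1 + d}"
    have jZ: "j \<in> Z" using jV u(2) by (auto simp: Z_def)
    have lZ: "l \<notin> Z" using min[OF u(1) w(1) _ w(2)] w(3) by (auto simp: Z_def)
    have bZ: "b {x, i} = 0" if i: "i \<in> Z" and x: "x \<in> V" "x \<notin> Z" for x i
    proof (rule ccontr)
      assume "b {x, i} \<noteq> 0"
      then obtain m where "m \<in> Poly_Mapping.keys (b {x, i})" by (metis all_not_in_conv keys_eq_empty)
      note m = this koszul_chain_keysD[OF b(1) this]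
      then have "m \<in> {u + b |u b. u \<in> A}" by (auto simp: J mono_span_def)
      then obtain y d where y: "y \<in> A" "m = y + d" by blast
      have "x \<noteq> i" using i x by auto
      then have "a = y + Poly_Mapping.single i 1 + (Poly_Mapping.single x 1 + d)" "a = y + Poly_Mapping.single x 1 + (Poly_Mapping.single i 1 + d)"
        using m(4) y(2) by (simp_all add: sqfree_def ac_simps)
      moreover obtain d' where "a = u + Poly_Mapping.single i 1 + d'" using i by (auto simp: Z_def)
      ultimately have "u = y" using min[OF u(1) y(1)] by blast
      then show False using \<open>a = y + Poly_Mapping.single x 1 + (Poly_Mapping.single i 1 + d)\<close> x by (auto simp: Z_def)
    qed
    define b' where "b' T = (if T \<subseteq> Z then b T else 0)" for T
    have "b' \<in> koszul_chains V J (Suc 1) a"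
      using b(1) zero by (auto simp: koszul_chains_def b'_def)
    then have dd: "koszul_diff V (koszul_diff V b') {} = 0"
      using koszul_diff_diff[OF V] by metis
    have dZ: "koszul_diff V b' {i} = (if i \<in> Z then c {i} else 0)" for i
    proof (cases "i \<in> Z")
      case True
      have "ksign x {i} * Var x * b' {x, i} = ksign x {i} * Var x * b {x, i}" if "x \<in> V - {i}" for x
        using bZ[OF True, of x] that True by (auto simp: b'_def)
      then have "koszul_diff V b' {i} = koszul_diff V b {i}"
        unfolding koszul_diff_def by (rule sum.cong[OF refl])
      then show ?thesis using True by (simp add: b(2))
    next
      case False
      then show ?thesis by (simp add: koszul_diff_def b'_def)
    qed
    have "koszul_diff V (koszul_diff V b') {} = (\<Sum>i\<in>V. Var i * (if i \<in> Z then c {i} else 0))"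
      by (simp add: koszul_diff_def[of V "koszul_diff V b'"] dZ ks)
    also have "\<dots> = (\<Sum>i\<in>{j}. Var i * (if i \<in> Z then c {i} else 0))"
      by (rule sum.mono_neutral_right) (use V jV lZ in \<open>auto simp: c_def\<close>)
    also have "\<dots> = monom a" using jZ by (simp add: c_def Vj)
    finally show False using dd monom_nonzero[of a, where 'k = 'k] by simp
  qed
  with cyc show ?thesis by (auto simp: Tor_nonzero_def)
qed

text \<open>
  If at most one generator divides \<open>x\<^sup>a\<close>, then \<open>Tor_1\<close> vanishes in multidegree \<open>a\<close>. If two do and \<open>a\<close> is minimal
  with this property, then no two generators divide the same \<open>x\<^sup>a / x_i\<close>. Since the generators
  are an antichain, each of the two divides some \<open>x\<^sup>a / x_i\<close>, which yields a nonzero class.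
\<close>

lemma HS_1_mono_span:
  assumes V: "finite V"
    and anti: "\<And>x y b. x \<in> A \<Longrightarrow> y \<in> A \<Longrightarrow> x = y + b \<Longrightarrow> x = y"
  shows "HS V 1 (mono_span V {u + b |u b. u \<in> A} :: 'k::field mpoly set)
    = mono_span V {a. \<exists>x\<in>A. \<exists>y\<in>A. \<exists>b d. x \<noteq> y \<and> a = x + b \<and> a = y + d}"
proof (rule HS_eqI)
  let ?X = "{u + b |u b. u \<in> A}" and ?Y = "{a. \<exists>x\<in>A. \<exists>y\<in>A. \<exists>b d. x \<noteq> y \<and> a = x + b \<and> a = y + d}"
  let ?J = "mono_span V ?X :: 'k mpoly set"
  show "upset ?Y" unfolding upset_def by (auto simp: add.assoc) (metis add.assoc)
  have upX: "upset ?X" by (rule upset_generated)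
  show "a \<in> ?Y" if a: "Poly_Mapping.keys a \<subseteq> V" "Tor_nonzero V 1 ?J a" for a
  proof (rule ccontr)
    assume no: "a \<notin> ?Y"
    show False
    proof (cases "\<exists>u\<in>A. \<exists>b. a = u + b")
      case True
      then obtain u b where u: "u \<in> A" "a = u + b" by blast
      have "\<not> Tor_nonzero V 1 ?J a"
      proof (rule Tor_vanishes[OF V refl upX])
        show "u \<in> ?X" using u(1) by (metis (mono_tags, lifting) add.right_neutral mem_Collect_eq)
        show "\<exists>d. m = u + d" if m: "m \<in> ?X" "a = m + b'" for m b'
        proof -
          obtain y d where y: "y \<in> A" "m = y + d" using m(1) by blast
          then have "a = y + (d + b')" using m(2) by (simp add: add.assoc)
          then have "y = u" using no u y(1) by blast
          then show ?thesis using y(2) by blast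
        qed
      qed simp
      with a(2) show False by simp
    next
      case False
      from a(2) obtain c where c: "c \<in> koszul_chains V ?J 1 a" "c \<notin> tor_boundaries V ?J 1 a"
        by (auto simp: Tor_nonzero_def tor_cycles_def)
      have "0 \<in> ?J" by (simp add: mono_span_def)
      from zero_boundary[OF this] have "c \<noteq> (\<lambda>_. 0)" using c(2) by blast
      then obtain T b where "b \<in> Poly_Mapping.keys (c T)" by (metis all_not_in_conv keys_eq_empty ext)
      note b = this koszul_chain_keysD[OF c(1) this]
      then have "b \<in> ?X" by (auto simp: mono_span_def)
      then show False using False b(4) by (auto simp: add.assoc)
    qed
  qed
  show "Tor_nonzero V 1 ?J a"
    if a: "Poly_Mapping.keys a \<subseteq> V" "a \<in> ?Y" and min: "\<And>j b. a = b + Poly_Mapping.single j 1 \<Longrightarrow> b \<notin> ?Y" for a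
  proof -
    obtain u w b d where uw: "u \<in> A" "w \<in> A" "u \<noteq> w" "a = u + b" "a = w + d"
      using a(2) by blast
    have "b \<noteq> 0" using anti[OF uw(1,2), of d] uw(3-5) by auto
    then obtain j r where j: "b = Poly_Mapping.single j 1 + r" using exp_nonzero_peel by blast
    have "d \<noteq> 0" using anti[OF uw(2,1), of b] uw(3-5) by auto
    then obtain l s where l: "d = Poly_Mapping.single l 1 + s" using exp_nonzero_peel by blast
    show ?thesis
    proof (rule Tor_1_nonzero[OF V refl a(1) uw(1) _ uw(2) _ uw(3)])
      show "a = u + Poly_Mapping.single j 1 + r" using uw(4) j by (simp add: add.assoc)
      show "a = w + Poly_Mapping.single l 1 + s" using uw(5) l by (simp add: add.assoc)
      fix i x y b d
      assume xy: "x \<in> A" "y \<in> A" "a = x + Poly_Mapping.single i 1 + b" "a = y + Poly_Mapping.single i 1 + d"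
      have "(x + b) + Poly_Mapping.single i 1 = (y + d) + Poly_Mapping.single i 1" using xy(3,4) by (metis add.assoc add.commute)
      then have "x + b = y + d" by (rule add_right_imp_eq)
      moreover have "a = (x + b) + Poly_Mapping.single i 1" using xy(3) by (simp add: ac_simps)
      ultimately show "x = y" using min xy(1,2) by blast
    qed
  qed
qed

section \<open>Homological shift ideals of powers of edge ideals\<close>

definition edge_products :: "nat set set \<Rightarrow> nat \<Rightarrow> (nat \<Rightarrow>\<^sub>0 nat) set" where
  "edge_products E k = {u. \<exists>M. set_mset M \<subseteq> E \<and> size M = k \<and> Poly_Mapping.lookup u = vdeg M}"

lemma edge_product_exists:
  assumes "\<forall>e\<in>#M. finite e"
  obtains u where "Poly_Mapping.lookup u = vdeg M"
proof -
  have "Poly_Mapping.lookup (\<Sum>e\<in>#M. sqfree e) = vdeg M"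
    using assms
  proof (induction M)
    case (add e M)
    then show ?case by (auto simp: lookup_add lookup_sqfree_of_bool)
  qed auto
  then show thesis using that by blast
qed

lemma packs_iff_edge_product:
  assumes G: "simple_graph n E"
  shows "packs E k {1..n} (Poly_Mapping.lookup a) M \<longleftrightarrow>
    set_mset M \<subseteq> E \<and> size M = k \<and> (\<exists>u b. Poly_Mapping.lookup u = vdeg M \<and> a = u + b)"
proof
  assume M: "packs E k {1..n} (Poly_Mapping.lookup a) M"
  then have sub: "set_mset M \<subseteq> E" by (simp add: packs_def)
  then obtain u where u: "Poly_Mapping.lookup u = vdeg M"
    using edge_product_exists[of M] simple_graph_edge[OF G] by blast
  have "a = u + (a - u)"
  proof (rule poly_mapping_eqI)
    fix v
    have "vdeg M v \<le> Poly_Mapping.lookup a v"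
    proof (cases "v \<in> {1..n}")
      case True
      then show ?thesis using M by (simp add: packs_def)
    next
      case False
      then have "vdeg M v = 0" using sub simple_graph_edge[OF G] unfolding vdeg_eq_0_iff by blast
      then show ?thesis by simp
    qed
    then show "Poly_Mapping.lookup a v = Poly_Mapping.lookup (u + (a - u)) v"
      by (simp add: lookup_add lookup_minus u)
  qed
  then show "set_mset M \<subseteq> E \<and> size M = k \<and> (\<exists>u b. Poly_Mapping.lookup u = vdeg M \<and> a = u + b)"
    using M u unfolding packs_def by blast
next
  assume "set_mset M \<subseteq> E \<and> size M = k \<and> (\<exists>u b. Poly_Mapping.lookup u = vdeg M \<and> a = u + b)"
  then show "packs E k {1..n} (Poly_Mapping.lookup a) M"
    by (auto simp: packs_def lookup_add)
qed

text \<open>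
  All products of \<open>k\<close> edges have degree \<open>2k\<close>, so none properly divides another.
\<close>

lemma edge_products_antichain:
  assumes G: "simple_graph n E" and x: "x \<in> edge_products E k" and y: "y \<in> edge_products E k"
    and xy: "x = y + b"
  shows "x = y"
proof -
  obtain M N where M: "set_mset M \<subseteq> E" "size M = k" "Poly_Mapping.lookup x = vdeg M"
    and N: "set_mset N \<subseteq> E" "size N = k" "Poly_Mapping.lookup y = vdeg N"
    using x y unfolding edge_products_def by blast
  have total: "(\<Sum>v\<in>{1..n}. vdeg Q v) = 2 * size Q" if Q: "set_mset Q \<subseteq> E" for Q
  proof -
    have "(\<Sum>v\<in>{1..n}. vdeg Q v) = (\<Sum>v\<in>{1..n}. 1 * vdeg Q v)" by simp
    also have "\<dots> = (\<Sum>d\<in>#Q. \<Sum>x\<in>d. 1)"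
      by (rule sum_mset_edges[symmetric]) (use Q simple_graph_edge[OF G] in blast)+
    also have "\<dots> = (\<Sum>d\<in>#Q. 2)"
      by (rule arg_cong[of _ _ sum_mset], rule image_mset_cong) (use Q simple_graph_edge[OF G] in fastforce)
    finally show ?thesis by simp
  qed
  have "(\<Sum>v\<in>{1..n}. Poly_Mapping.lookup b v) = 0"
  proof -
    have "(\<Sum>v\<in>{1..n}. Poly_Mapping.lookup x v) = 2 * k" "(\<Sum>v\<in>{1..n}. Poly_Mapping.lookup y v) = 2 * k"
      unfolding M(3) N(3) total[OF M(1)] total[OF N(1)] M(2) N(2) by (rule refl)+
    moreover have "(\<Sum>v\<in>{1..n}. Poly_Mapping.lookup x v) = (\<Sum>v\<in>{1..n}. Poly_Mapping.lookup y v) + (\<Sum>v\<in>{1..n}. Poly_Mapping.lookup b v)"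
      unfolding xy lookup_add sum.distrib ..
    ultimately show ?thesis by linarith
  qed
  then have b0: "Poly_Mapping.lookup b v = 0" if "v \<in> {1..n}" for v
    using that by simp
  have "Poly_Mapping.lookup x v = Poly_Mapping.lookup y v" for v
  proof (cases "v \<in> {1..n}")
    case True
    then show ?thesis using b0 by (simp add: xy lookup_add)
  next
    case False
    then have "vdeg M v = 0" using M(1) simple_graph_edge[OF G] unfolding vdeg_eq_0_iff by blast
    then have "Poly_Mapping.lookup x v = 0" by (simp only: M(3))
    then show ?thesis by (simp add: xy lookup_add)
  qed
  then show ?thesis by (rule poly_mapping_eqI)
qed

lemma HS_power_edge_ideal:
  assumes G: "simple_graph n E" and i: "i = 0 \<or> i = 1"
  shows "HS {1..n} i (ideal_power (polyring {1..n}) (edge_ideal n E :: 'k::field mpoly set) k)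
    = mono_span {1..n} (fitting_exps E i k {1..n})"
  unfolding ideal_power_edge_ideal[OF G]
  using i
proof
  assume "i = 0"
  then show "HS {1..n} i (mono_span {1..n} (fitting_exps E 0 k {1..n}) :: 'k mpoly set)
    = mono_span {1..n} (fitting_exps E i k {1..n})"
    using HS_0_mono_span[OF _ upset_fitting_exps] by blast
next
  assume i: "i = 1"
  let ?V = "{1..n}" and ?A = "edge_products E k"
  have gen: "fitting_exps E 0 k ?V = {u + b |u b. u \<in> ?A}"
    unfolding fitting_exps_def packable_0 packs_iff_edge_product[OF G] edge_products_def by blast
  have two: "fitting_exps E 1 k ?V = {a. \<exists>x\<in>?A. \<exists>y\<in>?A. \<exists>b d. x \<noteq> y \<and> a = x + b \<and> a = y + d}"
  proof (intro Set.set_eqI iffI)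
    fix a assume "a \<in> fitting_exps E 1 k ?V"
    then obtain M N where "packs E k ?V (Poly_Mapping.lookup a) M" "packs E k ?V (Poly_Mapping.lookup a) N" "vdeg M \<noteq> vdeg N"
      unfolding fitting_exps_def packable_1 by blast
    then show "a \<in> {a. \<exists>x\<in>?A. \<exists>y\<in>?A. \<exists>b d. x \<noteq> y \<and> a = x + b \<and> a = y + d}"
      unfolding packs_iff_edge_product[OF G] edge_products_def
      by (clarify, metis (mono_tags, lifting) mem_Collect_eq)
  next
    fix a assume "a \<in> {a. \<exists>x\<in>?A. \<exists>y\<in>?A. \<exists>b d. x \<noteq> y \<and> a = x + b \<and> a = y + d}"
    then obtain x y b d M N where "x \<noteq> y" "a = x + b" "a = y + d"
      "set_mset M \<subseteq> E" "size M = k" "Poly_Mapping.lookup x = vdeg M" "set_mset N \<subseteq> E" "size N = k" "Poly_Mapping.lookup y = vdeg N"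
      unfolding edge_products_def by blast
    then show "a \<in> fitting_exps E 1 k ?V"
      unfolding fitting_exps_def packable_1 packs_iff_edge_product[OF G] mem_Collect_eq
      by (metis lookup_inject)
  qed
  have "HS ?V 1 (mono_span ?V {u + b |u b. u \<in> ?A} :: 'k mpoly set) = mono_span ?V (fitting_exps E 1 k ?V)"
    unfolding two by (rule HS_1_mono_span[OF finite_atLeastAtMost edge_products_antichain[OF G]])
  then show "HS ?V i (mono_span ?V (fitting_exps E 0 k ?V) :: 'k mpoly set) = mono_span ?V (fitting_exps E i k ?V)"
    unfolding i gen .
qed

section \<open>Associated primes of monomial ideals\<close>

text \<open>
  A product of terms that arises in only one way is not cancelled.
\<close>

lemma lookup_mult_unique:
  fixes p q :: "'k::field mpoly"
  assumes b: "b \<in> Poly_Mapping.keys p" and c: "c \<in> Poly_Mapping.keys q"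
    and uniq: "\<And>b' c'. b' \<in> Poly_Mapping.keys p \<Longrightarrow> c' \<in> Poly_Mapping.keys q \<Longrightarrow> b' + c' = b + c \<Longrightarrow> b' = b \<and> c' = c"
  shows "Poly_Mapping.lookup (p * q) (b + c) = Poly_Mapping.lookup p b * Poly_Mapping.lookup q c"
proof -
  have "p * q = (\<Sum>x\<in>Poly_Mapping.keys p. \<Sum>y\<in>Poly_Mapping.keys q. Poly_Mapping.single (x + y) (Poly_Mapping.lookup p x * Poly_Mapping.lookup q y))"
    by (subst (1) poly_mapping_sum_singles[of p], subst (1) poly_mapping_sum_singles[of q])
      (simp add: sum_product mult_single)
  then have "Poly_Mapping.lookup (p * q) (b + c)
    = (\<Sum>x\<in>Poly_Mapping.keys p. \<Sum>y\<in>Poly_Mapping.keys q. if x + y = b + c then Poly_Mapping.lookup p x * Poly_Mapping.lookup q y else 0)"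
    by (simp add: lookup_sum lookup_single when_def)
  also have "\<dots> = (\<Sum>x\<in>Poly_Mapping.keys p. \<Sum>y\<in>Poly_Mapping.keys q. if x = b then if y = c then Poly_Mapping.lookup p x * Poly_Mapping.lookup q y else 0 else 0)"
    by (intro sum.cong refl) (use uniq in auto)
  also have "\<dots> = (\<Sum>x\<in>Poly_Mapping.keys p. if x = b then \<Sum>y\<in>Poly_Mapping.keys q. if y = c then Poly_Mapping.lookup p x * Poly_Mapping.lookup q y else 0 else 0)"
    by (intro sum.cong refl) simp
  also have "\<dots> = Poly_Mapping.lookup p b * Poly_Mapping.lookup q c"
    using b c by (simp add: sum.delta)
  finally show ?thesis .
qed

lemma prime_contains_Var:
  fixes P :: "'k::field mpoly set"
  assumes P: "primeideal P (polyring V)" and "monom b \<in> P" "Poly_Mapping.keys b \<subseteq> V"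
  shows "\<exists>v\<in>Poly_Mapping.keys b. Var v \<in> P"
  using assms(2,3)
proof (induction "exp_total b" arbitrary: b rule: less_induct)
  case less
  interpret primeideal P "polyring V" by (rule P)
  show ?case
  proof (cases "b = 0")
    case True
    then have "\<one>\<^bsub>polyring V\<^esub> \<in> P" using less.prems(1) by (simp add: monom_def)
    then have "P = carrier (polyring V)" by (rule one_imp_carrier)
    then show ?thesis using I_notcarr by simp
  next
    case False
    then obtain j r where b: "b = Poly_Mapping.single j 1 + r" by (rule exp_nonzero_peel)
    then have keys: "Poly_Mapping.keys b = insert j (Poly_Mapping.keys r)" by (simp add: keys_add_nat)
    have "Var j \<otimes>\<^bsub>polyring V\<^esub> monom r \<in> P"
      using less.prems(1) by (simp add: Var_def monom_mult b)
    then have "Var j \<in> P \<or> monom r \<in> P"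
      by (rule I_prime[rotated 2]) (use less.prems(2) keys in \<open>auto simp: Var_def\<close>)
    then show ?thesis
    proof
      assume "monom r \<in> P"
      moreover have "exp_total r < exp_total b"
        using exp_total_add_single[of r j] b by (simp add: add.commute)
      ultimately show ?thesis using less.hyps[of r] less.prems(2) keys by auto
    qed (use keys in auto)
  qed
qed

text \<open>
  Among the polynomials with annihilator \<open>P\<close> modulo the monomial ideal choose \<open>f\<close> with the fewest
  terms. If \<open>x\<^sup>u \<notin> P\<close>, then \<open>x\<^sup>u f\<close> has annihilator \<open>P\<close> as well, because \<open>P\<close> is prime, and its terms
  inside the ideal may be discarded; by minimality there are none. Hence any term \<open>x\<^sup>c\<close> of \<open>f\<close> avoids the
  ideal after multiplication by monomials in the variables outside \<open>P\<close>. A comparison of leading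
  terms shows that \<open>P\<close> is generated by its variables.
\<close>

lemma Ass_mono_span:
  fixes P :: "'k::field mpoly set"
  assumes up: "upset Y" and ass: "P \<in> Ass (polyring V) (mono_span V Y)"
  defines "W \<equiv> vars_in V P"
  obtains c where "Poly_Mapping.keys c \<subseteq> V" "\<And>v. v \<in> W \<Longrightarrow> c + Poly_Mapping.single v 1 \<in> Y"
    "\<And>m. Poly_Mapping.keys m \<subseteq> V - W \<Longrightarrow> c + m \<notin> Y"
    "P = {p \<in> carrier (polyring V). \<forall>b\<in>Poly_Mapping.keys p. Poly_Mapping.keys b \<inter> W \<noteq> {}}"
proof -
  let ?R = "polyring V :: 'k mpoly ring" and ?L = "mono_span V Y :: 'k mpoly set"
  have P: "primeideal P ?R" using ass by (simp add: Ass_def)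
  interpret primeideal P ?R by (rule P)
  have W: "v \<in> W \<longleftrightarrow> v \<in> V \<and> Var v \<in> P" for v by (simp add: W_def vars_in_def)
  define F where "F f \<longleftrightarrow> f \<in> carrier ?R \<and> P = {r \<in> carrier ?R. r * f \<in> ?L}" for f
  obtain f0 where "F f0" using ass by (auto simp: Ass_def F_def)
  then obtain f where f: "F f" and fmin: "\<And>g. F g \<Longrightarrow> card (Poly_Mapping.keys f) \<le> card (Poly_Mapping.keys g)"
    using ex_has_least_nat[of F f0 "\<lambda>f. card (Poly_Mapping.keys f)"] by blast
  have fc: "f \<in> carrier ?R" and Pf: "P = {r \<in> carrier ?R. r * f \<in> ?L}" using f by (auto simp: F_def)
  have Lsub: "p - q \<in> ?L" if "p \<in> ?L" "q \<in> ?L" for p q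
    using that keys_diff[of p q] by (fastforce simp: mono_span_def)
  have Ladd: "p + q \<in> ?L" if "p \<in> ?L" "q \<in> ?L" for p q
    using that Poly_Mapping.keys_add[of p q] by (fastforce simp: mono_span_def)
  have Lmult: "r * p \<in> ?L" if "p \<in> ?L" "r \<in> carrier ?R" for r p
    using ideal.I_l_closed[OF mono_span_ideal[OF up] that] by simp
  have Pmult: "r * p \<in> P" if "p \<in> P" "r \<in> carrier ?R" for r p
    using I_l_closed[OF that] by simp
  have annihilates_no_key: "u + b \<notin> Y" if u: "Poly_Mapping.keys u \<subseteq> V" "monom u \<notin> P" and b: "b \<in> Poly_Mapping.keys f" for u b
  proof
    assume ub: "u + b \<in> Y"
    \<comment> \<open>Discarding the single term \<open>t\<close> of \<open>x\<^sup>u f\<close> already contradicts minimality.\<close>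
    define t where "t = Poly_Mapping.single (u + b) (Poly_Mapping.lookup f b)"
    define g where "g = monom u * f - t"
    have bV: "Poly_Mapping.keys b \<subseteq> V" using fc b by simp
    have tL: "t \<in> ?L" using ub u(1) bV by (auto simp: t_def mono_span_def keys_add_nat)
    have gk: "Poly_Mapping.keys g \<subseteq> (+) u ` Poly_Mapping.keys f - {u + b}"
    proof
      fix c assume c: "c \<in> Poly_Mapping.keys g"
      have "Poly_Mapping.lookup g (u + b) = 0" by (simp add: g_def t_def lookup_minus monom_def lookup_single_mult)
      then have ne: "c \<noteq> u + b" using c by (auto simp: in_keys_iff)
      moreover have "c \<in> Poly_Mapping.keys (monom u * f) \<union> Poly_Mapping.keys t"
        using c keys_diff[of "monom u * f" t] by (auto simp: g_def)
      ultimately show "c \<in> (+) u ` Poly_Mapping.keys f - {u + b}"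
        by (auto simp: keys_monom_mult t_def split: if_splits)
    qed
    have "F g"
      unfolding F_def
    proof
      have "Poly_Mapping.keys a \<subseteq> V" if a: "a \<in> Poly_Mapping.keys g" for a
      proof -
        obtain b' where "a = u + b'" "b' \<in> Poly_Mapping.keys f" using gk a by blast
        then show ?thesis using fc u(1) by (simp add: keys_add_nat)
      qed
      then show "g \<in> carrier ?R" by simp
      have "r * g \<in> ?L \<longleftrightarrow> r \<in> P" if r: "r \<in> carrier ?R" for r
      proof -
        have rt: "r * t \<in> ?L" by (rule Lmult[OF tL r])
        have eq: "r * g = r * monom u * f - r * t" by (simp add: g_def algebra_simps)
        have "r * g \<in> ?L \<longleftrightarrow> r * monom u * f \<in> ?L"
          using Ladd[OF _ rt, of "r * g"] Lsub[OF _ rt, of "r * monom u * f"] by (auto simp: eq)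
        also have "\<dots> \<longleftrightarrow> r * monom u \<in> P"
        proof -
          have "r \<otimes>\<^bsub>?R\<^esub> monom u \<in> carrier ?R" by (rule m_closed) (use r u(1) in auto)
          then show ?thesis by (subst Pf) simp
        qed
        also have "\<dots> \<longleftrightarrow> r \<in> P"
        proof
          assume "r * monom u \<in> P"
          then have "r \<in> P \<or> monom u \<in> P"
            using I_prime[of r "monom u"] r u(1) by simp
          then show "r \<in> P" using u(2) by blast
        next
          assume "r \<in> P"
          then show "r * monom u \<in> P" using Pmult[of r "monom u"] u(1) by (simp add: mult.commute)
        qed
        finally show ?thesis .
      qed
      then show "P = {r \<in> carrier ?R. r * g \<in> ?L}"
        using a_subset by blast
    qed
    then have "card (Poly_Mapping.keys f) \<le> card (Poly_Mapping.keys g)" by (rule fmin)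
    also have "\<dots> \<le> card ((+) u ` Poly_Mapping.keys f - {u + b})" by (rule card_mono[OF _ gk]) simp
    also have "\<dots> = card (Poly_Mapping.keys f) - 1"
      using b by (simp add: card_Diff_singleton card_image)
    also have "\<dots> < card (Poly_Mapping.keys f)" using card_Diff1_less[OF finite_keys b] b by (simp add: card_Diff_singleton)
    finally show False by simp
  qed
  have f0: "f \<noteq> 0"
  proof
    assume "f = 0"
    then have "r * f \<in> ?L" for r by (simp add: mono_span_def)
    then have "P = carrier ?R" using Pf by blast
    then show False using I_notcarr by simp
  qed
  have soc: "c + Poly_Mapping.single v 1 \<in> Y" if "c \<in> Poly_Mapping.keys f" "v \<in> W" for c v
  proof -
    have "monom (Poly_Mapping.single v 1) * f \<in> ?L" using that(2) Pf by (auto simp: W Var_def)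
    then show ?thesis using that(1) by (auto simp: mono_span_def keys_monom_mult add.commute)
  qed
  have meets: "Poly_Mapping.keys b \<inter> W \<noteq> {}" if r: "r \<in> P" and b: "b \<in> Poly_Mapping.keys r" for r b
  proof (rule ccontr)
    assume "\<not> Poly_Mapping.keys b \<inter> W \<noteq> {}"
    define B where "B = {b \<in> Poly_Mapping.keys r. Poly_Mapping.keys b \<inter> W = {}}"
    have B: "finite B" "B \<noteq> {}" using b \<open>\<not> Poly_Mapping.keys b \<inter> W \<noteq> {}\<close> by (auto simp: B_def)
    have C: "finite (Poly_Mapping.keys f)" "Poly_Mapping.keys f \<noteq> {}" using f0 by auto
    \<comment> \<open>\<open>m\<close> is the largest term of \<open>r\<close> free of the variables in \<open>P\<close>. The coefficient of \<open>m + c\<close> in \<open>r f\<close> cannot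
      cancel: a term of \<open>r\<close> with a variable in \<open>P\<close> only contributes exponents in \<open>Y\<close>.\<close>
    define m c where "m = Max B" and "c = Max (Poly_Mapping.keys f)"
    have m: "m \<in> B" and c: "c \<in> Poly_Mapping.keys f" using Max_in[OF B] Max_in[OF C] by (auto simp: m_def c_def)
    have rc: "r \<in> carrier ?R" using r a_subset by blast
    have mV: "Poly_Mapping.keys m \<subseteq> V" using m rc by (auto simp: B_def)
    have "monom m \<notin> P"
    proof
      assume "monom m \<in> P"
      from prime_contains_Var[OF P this mV] obtain v where "v \<in> Poly_Mapping.keys m" "v \<in> W"
        using mV by (auto simp: W)
      then show False using m by (auto simp: B_def)
    qed
    then have no: "m + c \<notin> Y" using annihilates_no_key[OF mV _ c] by blast
    have "Poly_Mapping.lookup (r * f) (m + c) = Poly_Mapping.lookup r m * Poly_Mapping.lookup f c"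
    proof (rule lookup_mult_unique[OF _ c])
      show "m \<in> Poly_Mapping.keys r" using m by (simp add: B_def)
      fix b' c' assume b': "b' \<in> Poly_Mapping.keys r" and c': "c' \<in> Poly_Mapping.keys f" and eq: "b' + c' = m + c"
      have "Poly_Mapping.keys b' \<inter> W = {}"
      proof (rule ccontr)
        assume "Poly_Mapping.keys b' \<inter> W \<noteq> {}"
        then obtain v where v: "v \<in> Poly_Mapping.keys b'" "v \<in> W" by blast
        then have "b' = Poly_Mapping.single v 1 + (b' - Poly_Mapping.single v 1)" by (intro exp_peel) (simp add: in_keys_iff)
        then have "m + c = (c' + Poly_Mapping.single v 1) + (b' - Poly_Mapping.single v 1)" using eq by (metis add.assoc add.commute)
        then show False using no soc[OF c' v(2)] up by (auto simp: upset_def)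
      qed
      then have "b' \<in> B" using b' by (simp add: B_def)
      then have le: "b' \<le> m" "c' \<le> c" using B C c' by (auto simp: m_def c_def)
      show "b' = m \<and> c' = c"
      proof (rule ccontr)
        assume "\<not> ?thesis"
        then have "b' + c' < m + c"
          using le by (metis add_less_le_mono add_le_less_mono order_le_less)
        then show False using eq by simp
      qed
    qed
    moreover have "Poly_Mapping.lookup r m \<noteq> 0" "Poly_Mapping.lookup f c \<noteq> 0" using m c by (auto simp: B_def in_keys_iff)
    ultimately have "m + c \<in> Poly_Mapping.keys (r * f)" by (simp add: in_keys_iff)
    moreover have "r * f \<in> ?L" using r Pf by blast
    ultimately show False using no by (auto simp: mono_span_def)
  qed
  have Peq: "P = {p \<in> carrier ?R. \<forall>b\<in>Poly_Mapping.keys p. Poly_Mapping.keys b \<inter> W \<noteq> {}}"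
  proof (intro equalityI subsetI)
    fix p assume "p \<in> P"
    then show "p \<in> {p \<in> carrier ?R. \<forall>b\<in>Poly_Mapping.keys p. Poly_Mapping.keys b \<inter> W \<noteq> {}}"
      using meets[OF \<open>p \<in> P\<close>] subsetD[OF a_subset \<open>p \<in> P\<close>] by blast
  next
    fix p assume p: "p \<in> {p \<in> carrier ?R. \<forall>b\<in>Poly_Mapping.keys p. Poly_Mapping.keys b \<inter> W \<noteq> {}}"
    show "p \<in> P"
    proof (rule ideal_keysI[OF is_ideal])
      fix b assume b: "b \<in> Poly_Mapping.keys p"
      then obtain v where v: "v \<in> Poly_Mapping.keys b" "v \<in> W" using p by blast
      then have eq: "b = Poly_Mapping.single v 1 + (b - Poly_Mapping.single v 1)" by (intro exp_peel) (simp add: in_keys_iff)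
      have "Poly_Mapping.keys b \<subseteq> V" using p b by simp
      then have "Poly_Mapping.keys (b - Poly_Mapping.single v 1) \<subseteq> V" by (subst (asm) eq) (simp only: keys_add_nat Un_subset_iff)
      then have "monom (b - Poly_Mapping.single v 1) * Var v \<in> P" using v(2) by (intro Pmult) (auto simp: W)
      then show "monom b \<in> P" by (subst eq) (simp add: Var_def monom_mult add.commute)
    qed
  qed
  obtain c where c: "c \<in> Poly_Mapping.keys f" using f0 by (metis all_not_in_conv keys_eq_empty)
  show thesis
  proof (rule that[OF _ _ _ Peq])
    show "Poly_Mapping.keys c \<subseteq> V" using c fc by simp
    show "c + Poly_Mapping.single v 1 \<in> Y" if "v \<in> W" for v by (rule soc[OF c that])
    show "c + m \<notin> Y" if m: "Poly_Mapping.keys m \<subseteq> V - W" for m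
    proof -
      have mV: "Poly_Mapping.keys m \<subseteq> V" using m by blast
      have "monom m \<notin> P"
      proof
        assume "monom m \<in> P"
        from prime_contains_Var[OF P this mV] obtain v where "v \<in> Poly_Mapping.keys m" "v \<in> W"
          using mV by (auto simp: W)
        then show False using m by blast
      qed
      then show ?thesis using annihilates_no_key[OF mV _ c] by (simp add: add.commute)
    qed
  qed
qed

section \<open>Monomial localization\<close>

lemma lookup_restrict_exp: "Poly_Mapping.lookup (restrict_exp W a) v = (if v \<in> W then Poly_Mapping.lookup a v else 0)"
proof -
  have "Poly_Mapping.lookup (restrict_exp W a) v = (\<Sum>i \<in> Poly_Mapping.keys a \<inter> W. if i = v then Poly_Mapping.lookup a i else 0)"
    by (simp add: restrict_exp_def lookup_sum lookup_single when_def)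
  then show ?thesis
    by (simp add: sum.delta in_keys_iff)
qed

lemma restrict_exp_add: "restrict_exp W (a + b) = restrict_exp W a + restrict_exp W b"
  by (rule poly_mapping_eqI) (simp add: lookup_restrict_exp lookup_add)

lemma subst_one_monom: "subst_one W (monom b :: 'k::field mpoly) = monom (restrict_exp W b)"
  by (simp add: subst_one_def) (simp add: monom_def)

lemma keys_subst_one: "Poly_Mapping.keys (subst_one W p :: 'k::field mpoly) \<subseteq> restrict_exp W ` Poly_Mapping.keys p"
  unfolding subst_one_def by (rule order_trans[OF keys_sum]) (auto split: if_splits)

lemma subst_one_monom_mult:
  "subst_one W (monom u * p :: 'k::field mpoly) = monom (restrict_exp W u) * subst_one W p"
proof -
  have inj: "inj_on ((+) u) (Poly_Mapping.keys p)" by (simp add: inj_on_def)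
  have "subst_one W (monom u * p)
    = (\<Sum>a\<in>Poly_Mapping.keys p. Poly_Mapping.single (restrict_exp W (u + a)) (Poly_Mapping.lookup p a))"
    unfolding subst_one_def keys_monom_mult sum.reindex[OF inj]
    by (simp add: monom_def lookup_single_mult)
  also have "\<dots> = (\<Sum>a\<in>Poly_Mapping.keys p. monom (restrict_exp W u) * Poly_Mapping.single (restrict_exp W a) (Poly_Mapping.lookup p a))"
    by (simp add: monom_def mult_single restrict_exp_add)
  also have "\<dots> = monom (restrict_exp W u) * subst_one W p"
    by (simp add: subst_one_def sum_distrib_left)
  finally show ?thesis .
qed

lemma monom_in_localize:
  "(monom a :: 'k::field mpoly) \<in> localize V P (mono_span V X) \<longleftrightarrow>
    (\<exists>b\<in>X. Poly_Mapping.keys b \<subseteq> V \<and> restrict_exp (vars_in V P) b = a)"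
proof
  assume "(monom a :: 'k mpoly) \<in> localize V P (mono_span V X)"
  then obtain p :: "'k mpoly" where p: "p \<in> mono_span V X" "monom a = subst_one (vars_in V P) p"
    by (auto simp: localize_def)
  then have "a \<in> restrict_exp (vars_in V P) ` Poly_Mapping.keys p"
    using keys_subst_one[of "vars_in V P" p] by (metis insert_subset keys_monom)
  with p(1) show "\<exists>b\<in>X. Poly_Mapping.keys b \<subseteq> V \<and> restrict_exp (vars_in V P) b = a"
    unfolding mono_span_def by blast
next
  assume "\<exists>b\<in>X. Poly_Mapping.keys b \<subseteq> V \<and> restrict_exp (vars_in V P) b = a"
  then obtain b where b: "b \<in> X" "Poly_Mapping.keys b \<subseteq> V" "restrict_exp (vars_in V P) b = a" by blast
  then have "(monom b :: 'k mpoly) \<in> mono_span V X" by simp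
  then have "subst_one (vars_in V P) (monom b :: 'k mpoly) \<in> localize V P (mono_span V X)"
    unfolding localize_def by blast
  then show "(monom a :: 'k mpoly) \<in> localize V P (mono_span V X)"
    by (simp add: subst_one_monom b(3))
qed

text \<open>
  In one direction the bounds outside \<open>W\<close> are dropped; in the other, the exponent \<open>k\<close> at the variables outside \<open>W\<close>
  is large enough for every packing of \<open>k\<close> edges.
\<close>

lemma fitting_exps_localize:
  assumes V: "finite V" and W: "W \<subseteq> V"
  shows "(\<exists>b\<in>fitting_exps E i k V. Poly_Mapping.keys b \<subseteq> V \<and> restrict_exp W b = a) \<longleftrightarrow>
    Poly_Mapping.keys a \<subseteq> W \<and> packable E i k W (Poly_Mapping.lookup a)"
proof
  assume "\<exists>b\<in>fitting_exps E i k V. Poly_Mapping.keys b \<subseteq> V \<and> restrict_exp W b = a"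
  then obtain b where b: "packable E i k V (Poly_Mapping.lookup b)" "restrict_exp W b = a"
    by (auto simp: fitting_exps_def)
  have a: "Poly_Mapping.lookup a v = (if v \<in> W then Poly_Mapping.lookup b v else 0)" for v
    by (simp add: lookup_restrict_exp flip: b(2))
  have "Poly_Mapping.keys a \<subseteq> W" by (auto simp: in_keys_iff a split: if_splits)
  moreover have "packable E i k W (Poly_Mapping.lookup a)"
    by (rule packable_mono[OF b(1) W]) (simp add: a)
  ultimately show "Poly_Mapping.keys a \<subseteq> W \<and> packable E i k W (Poly_Mapping.lookup a)" ..
next
  assume a: "Poly_Mapping.keys a \<subseteq> W \<and> packable E i k W (Poly_Mapping.lookup a)"
  define b where "b = a + (\<Sum>v\<in>V - W. Poly_Mapping.single v k)"
  have a0: "Poly_Mapping.lookup a v = 0" if "v \<notin> W" for v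
    using a that by (metis in_keys_iff subsetD)
  have lb: "Poly_Mapping.lookup b v = (if v \<in> W then Poly_Mapping.lookup a v else if v \<in> V then k else 0)" for v
    using V a0[of v] by (simp add: b_def lookup_add lookup_sum lookup_single when_def sum.delta)
  have "packable E i k V (Poly_Mapping.lookup b)"
    by (rule packable_mono[OF packable_extend[of E i k W "Poly_Mapping.lookup a" V]]) (use a lb in auto)
  moreover have "Poly_Mapping.keys b \<subseteq> V" using W by (auto simp: in_keys_iff lb split: if_splits)
  moreover have "restrict_exp W b = a"
    by (rule poly_mapping_eqI) (simp add: lookup_restrict_exp lb a0)
  ultimately show "\<exists>b\<in>fitting_exps E i k V. Poly_Mapping.keys b \<subseteq> V \<and> restrict_exp W b = a"
    by (auto simp: fitting_exps_def)
qed

section \<open>The persistence properties\<close>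

lemma keys_sqfree: "finite e \<Longrightarrow> Poly_Mapping.keys (sqfree e) = e"
  by (auto simp: in_keys_iff lookup_sqfree_of_bool of_bool_def split: if_splits)

lemma sqfree_edge_fits:
  assumes "simple_graph n E" "e \<in> E"
  shows "sqfree e \<in> fitting_exps E 0 1 {1..n}"
  using simple_graph_edge[OF assms] assms(2)
  by (auto simp: fitting_exps_def packable_0 packs_def lookup_sqfree_of_bool intro!: exI[of _ "{#e#}"])

lemma fitting_exps_add_edge:
  assumes "simple_graph n E" "e \<in> E" "a \<in> fitting_exps E i k {1..n}"
  shows "sqfree e + a \<in> fitting_exps E i (Suc k) {1..n}"
proof -
  have "packable E i (Suc k) {1..n} (\<lambda>v. Poly_Mapping.lookup a v + of_bool (v \<in> e))"
    using assms(2,3) packable_add_edge by (simp add: fitting_exps_def)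
  then show ?thesis
    unfolding fitting_exps_def mem_Collect_eq
    by (rule packable_mono) (use simple_graph_edge[OF assms(1,2)] in \<open>auto simp: lookup_add lookup_sqfree_of_bool\<close>)
qed

text \<open>
  If \<open>P\<close> is the annihilator of \<open>x\<^sup>c\<close> modulo the shift ideal of \<open>I^k\<close>, then it is the annihilator of \<open>x\<^sup>c\<close>
  times a suitable edge modulo the shift ideal of \<open>I^(k+1)\<close>. If the graph has no edges, both ideals
  are zero.
\<close>

lemma edge_ideal_persistence:
  assumes G: "simple_graph n E" and i: "i = 0 \<or> i = 1"
  shows "homological_persistence {1..n} i (edge_ideal n E :: 'k::field mpoly set)"
  unfolding homological_persistence_def
proof (intro allI impI subsetI)
  fix k :: nat and P :: "'k mpoly set"
  let ?V = "{1..n}"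
  assume k: "k \<ge> 1"
    and "P \<in> Ass (polyring ?V) (HS ?V i (ideal_power (polyring ?V) (edge_ideal n E) k))"
  then have P: "P \<in> Ass (polyring ?V) (mono_span ?V (fitting_exps E i k ?V))"
    by (simp only: HS_power_edge_ideal[OF G i])
  have "P \<in> Ass (polyring ?V) (mono_span ?V (fitting_exps E i (Suc k) ?V))"
  proof (cases "E = {}")
    case True
    then have "fitting_exps E i k ?V = {}" "fitting_exps E i (Suc k) ?V = {}"
      using packable_no_edges k by (auto simp: fitting_exps_def)
    then show ?thesis using P by (simp only:)
  next
    case False
    define W where "W = vars_in ?V P"
    have WV: "W \<subseteq> ?V" by (auto simp: W_def vars_in_def)
    obtain c where c: "Poly_Mapping.keys c \<subseteq> ?V" "\<And>v. v \<in> W \<Longrightarrow> c + Poly_Mapping.single v 1 \<in> fitting_exps E i k ?V"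
      "\<And>m. Poly_Mapping.keys m \<subseteq> ?V - W \<Longrightarrow> c + m \<notin> fitting_exps E i k ?V"
      and Peq: "P = {p \<in> carrier (polyring ?V). \<forall>b\<in>Poly_Mapping.keys p. Poly_Mapping.keys b \<inter> W \<noteq> {}}"
      using Ass_mono_span[OF upset_fitting_exps P] unfolding W_def by blast
    have edges: "\<forall>e\<in>E. card e = 2" using simple_graph_edge[OF G] by blast
    have none: "\<not> packable E i k W (Poly_Mapping.lookup c)"
    proof
      assume "packable E i k W (Poly_Mapping.lookup c)"
      then have "packable E i k ?V (\<lambda>v. if v \<in> W then Poly_Mapping.lookup c v else k)"
        by (rule packable_extend)
      then have "c + (\<Sum>v\<in>?V - W. Poly_Mapping.single v k) \<in> fitting_exps E i k ?V"
        unfolding fitting_exps_def mem_Collect_eq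
        by (rule packable_mono) (auto simp: lookup_add lookup_sum lookup_single when_def sum.delta)
      moreover have "Poly_Mapping.keys (\<Sum>v\<in>?V - W. Poly_Mapping.single v k) \<subseteq> ?V - W"
        by (rule order_trans[OF keys_sum]) (auto split: if_splits)
      ultimately show False using c(3) by blast
    qed
    have soc: "packable E i k W (\<lambda>x. Poly_Mapping.lookup c x + of_bool (x = v))" if "v \<in> W" for v
      by (rule packable_mono[OF c(2)[OF that, unfolded fitting_exps_def mem_Collect_eq] WV])
        (simp add: lookup_add lookup_single when_def)
    obtain e where e: "e \<in> E" "\<not> packable E i (Suc k) W (\<lambda>x. Poly_Mapping.lookup c x + of_bool (x \<in> e))"
      using edge_keeping_unpackable_degrees[OF edges False _ i none soc] k by auto
    have fe: "finite e" "e \<subseteq> ?V" using simple_graph_edge[OF G e(1)] by auto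
    define c' where "c' = sqfree e + c"
    have soc': "c' + Poly_Mapping.single v 1 \<in> fitting_exps E i (Suc k) ?V" if "v \<in> W" for v
      using fitting_exps_add_edge[OF G e(1) c(2)[OF that]] by (simp add: c'_def add.assoc)
    have out: "c' + m \<notin> fitting_exps E i (Suc k) ?V" if m: "Poly_Mapping.keys m \<inter> W = {}" for m
    proof
      assume "c' + m \<in> fitting_exps E i (Suc k) ?V"
      then have "packable E i (Suc k) ?V (Poly_Mapping.lookup (c' + m))" by (simp add: fitting_exps_def)
      then have "packable E i (Suc k) W (\<lambda>x. Poly_Mapping.lookup c x + of_bool (x \<in> e))"
      proof (rule packable_mono[OF _ WV])
        fix v assume "v \<in> W"
        then have "Poly_Mapping.lookup m v = 0" using m by (metis disjoint_iff in_keys_iff)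
        then show "Poly_Mapping.lookup (c' + m) v \<le> Poly_Mapping.lookup c v + of_bool (v \<in> e)"
          using fe by (simp add: c'_def lookup_add lookup_sqfree_of_bool)
      qed
      with e(2) show False by blast
    qed
    have c'V: "Poly_Mapping.keys c' \<subseteq> ?V" using c(1) fe by (simp add: c'_def keys_add_nat keys_sqfree)
    \<comment> \<open>In terms of ideals, the annihilator of \<open>x\<^sup>c'\<close> consists of the polynomials all of whose terms
      involve a variable in \<open>W\<close>.\<close>
    have iff: "b + c' \<in> fitting_exps E i (Suc k) ?V \<longleftrightarrow> Poly_Mapping.keys b \<inter> W \<noteq> {}" for b
    proof
      assume "Poly_Mapping.keys b \<inter> W \<noteq> {}"
      then obtain v where v: "v \<in> Poly_Mapping.keys b" "v \<in> W" by blast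
      then have "b = Poly_Mapping.single v 1 + (b - Poly_Mapping.single v 1)" by (intro exp_peel) (simp add: in_keys_iff)
      then have "b + c' = (c' + Poly_Mapping.single v 1) + (b - Poly_Mapping.single v 1)" by (metis add.assoc add.commute)
      then show "b + c' \<in> fitting_exps E i (Suc k) ?V"
        using soc'[OF v(2)] upset_fitting_exps by (auto simp: upset_def)
    qed (use out[of b] in \<open>auto simp: add.commute\<close>)
    have "P = {r \<in> carrier (polyring ?V). r \<otimes>\<^bsub>polyring ?V\<^esub> monom c' \<in> mono_span ?V (fitting_exps E i (Suc k) ?V)}"
    proof (subst Peq, intro Collect_cong conj_cong refl)
      fix r :: "'k mpoly" assume r: "r \<in> carrier (polyring ?V)"
      have keys: "Poly_Mapping.keys (r * monom c') = (\<lambda>b. b + c') ` Poly_Mapping.keys r"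
        unfolding mult.commute[of r] keys_monom_mult by (simp add: add.commute)
      have "Poly_Mapping.keys (b + c') \<subseteq> ?V" if "b \<in> Poly_Mapping.keys r" for b
        using r that c'V unfolding keys_add_nat by simp
      then show "(\<forall>b\<in>Poly_Mapping.keys r. Poly_Mapping.keys b \<inter> W \<noteq> {}) \<longleftrightarrow>
        r \<otimes>\<^bsub>polyring ?V\<^esub> monom c' \<in> mono_span ?V (fitting_exps E i (Suc k) ?V)"
        unfolding polyring_simps mono_span_def mem_Collect_eq keys ball_simps iff by blast
    qed
    moreover have "primeideal P (polyring ?V)" using P by (simp add: Ass_def)
    moreover have "(monom c' :: 'k mpoly) \<in> carrier (polyring ?V)" using c'V by simp
    ultimately show ?thesis unfolding Ass_def by blast
  qed
  then show "P \<in> Ass (polyring ?V) (HS ?V i (ideal_power (polyring ?V) (edge_ideal n E) (k + 1)))"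
    by (simp only: HS_power_edge_ideal[OF G i] Suc_eq_plus1)
qed

text \<open>
  The monomial \<open>g\<close> is the localization of an edge. The exponent \<open>a\<close> is the restriction of a term of a
  polynomial in the colon ideal, and for monomial ideals that term lies in the colon ideal, too.
\<close>

lemma edge_ideal_strong_persistence:
  assumes G: "simple_graph n E" and i: "i = 0 \<or> i = 1"
  shows "homological_strong_persistence {1..n} i (edge_ideal n E :: 'k::field mpoly set)"
  unfolding homological_strong_persistence_def HS_power_edge_ideal[OF G i]
proof (intro allI impI, elim conjE)
  fix P :: "'k mpoly set" and k :: nat and a :: "nat \<Rightarrow>\<^sub>0 nat"
  let ?V = "{1..n}" and ?L = "\<lambda>k. mono_span {1..n} (fitting_exps E i k {1..n}) :: 'k mpoly set"
  define W where "W = vars_in ?V P"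
  have WV: "W \<subseteq> ?V" by (auto simp: W_def vars_in_def)
  assume prime: "monomial_prime ?V P" and P0: "P \<noteq> {0}" and k: "k > 0"
    and a: "monom a \<in> localize ?V P (colon_ideal (polyring ?V) (?L k) P) - localize ?V P (?L k)"
  have loc: "(monom d :: 'k mpoly) \<in> localize ?V P (?L m) \<longleftrightarrow> Poly_Mapping.keys d \<subseteq> W \<and> packable E i m W (Poly_Mapping.lookup d)" for d m
    unfolding monom_in_localize W_def[symmetric] by (rule fitting_exps_localize[OF finite_atLeastAtMost WV])
  obtain p :: "'k mpoly" where p: "p \<in> carrier (polyring ?V)" "\<And>q. q \<in> P \<Longrightarrow> p * q \<in> ?L k"
    "monom a = subst_one W p"
    using a by (auto simp: localize_def colon_ideal_def W_def)
  have "a \<in> restrict_exp W ` Poly_Mapping.keys p"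
    using keys_subst_one[of W p] p(3) by (metis insert_subset keys_monom)
  then obtain b where b: "b \<in> Poly_Mapping.keys p" "a = restrict_exp W b" by blast
  have la: "Poly_Mapping.lookup a v = (if v \<in> W then Poly_Mapping.lookup b v else 0)" for v
    by (simp add: b(2) lookup_restrict_exp)
  have aW: "Poly_Mapping.keys a \<subseteq> W" by (auto simp: in_keys_iff la split: if_splits)
  have none: "\<not> packable E i k W (Poly_Mapping.lookup a)"
    using a aW loc by blast
  have soc: "packable E i k W (\<lambda>x. Poly_Mapping.lookup a x + of_bool (x = v))" if v: "v \<in> W" for v
  proof -
    have "p * Var v \<in> ?L k" using v p(2) by (auto simp: W_def vars_in_def)
    then have "monom (Poly_Mapping.single v 1) * p \<in> ?L k" by (simp add: Var_def mult.commute)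
    then have "Poly_Mapping.single v 1 + b \<in> fitting_exps E i k ?V"
      using b(1) by (auto simp: mono_span_def keys_monom_mult)
    then have "packable E i k ?V (Poly_Mapping.lookup (Poly_Mapping.single v 1 + b))" by (simp add: fitting_exps_def)
    then show ?thesis
      by (rule packable_mono[OF _ WV]) (simp add: la lookup_add lookup_single when_def)
  qed
  \<comment> \<open>Without edges the shift ideal is zero, so \<open>soc\<close> leaves no variable in \<open>P\<close>, and \<open>P\<close> would be the zero
    prime.\<close>
  have ne: "E \<noteq> {}"
  proof
    assume "E = {}"
    then have "W = {}" using soc packable_no_edges[OF k] by blast
    obtain U where U: "U \<subseteq> ?V" "P = Idl\<^bsub>polyring ?V\<^esub> (Var ` U)"
      using prime by (auto simp: monomial_prime_def)
    interpret cring "polyring ?V :: 'k mpoly ring" by (rule polyring_cring)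
    have "Var ` U \<subseteq> P"
      unfolding U(2) by (rule genideal_self) (use U(1) in \<open>auto simp: Var_def\<close>)
    then have "U \<subseteq> W" using U(1) by (auto simp: W_def vars_in_def)
    then have "P = Idl\<^bsub>polyring ?V\<^esub> {}" using \<open>W = {}\<close> U(2) by simp
    also have "\<dots> \<subseteq> {0}"
      using genideal_minimal[OF zeroideal, of "{}"] by simp
    finally have "P \<subseteq> {0}" .
    moreover have "P \<noteq> {}"
      using prime unfolding monomial_prime_def
      by (metis additive_subgroup.zero_closed empty_iff ideal.axioms(1) primeideal.axioms(1))
    ultimately show False using P0 by blast
  qed
  have edges: "\<forall>e\<in>E. card e = 2" using simple_graph_edge[OF G] by blast
  obtain e where e: "e \<in> E" "\<not> packable E i (Suc k) W (\<lambda>x. Poly_Mapping.lookup a x + of_bool (x \<in> e))"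
    using edge_keeping_unpackable_degrees[OF edges ne k i none soc] by blast
  have fe: "finite e" "e \<subseteq> ?V" using simple_graph_edge[OF G e(1)] by auto
  define g where "g = restrict_exp W (sqfree e)"
  have "monom g \<in> localize ?V P (edge_ideal n E :: 'k mpoly set)"
    unfolding edge_ideal_eq[OF G] monom_in_localize g_def W_def
    using sqfree_edge_fits[OF G e(1)] fe keys_sqfree by blast
  moreover have "monom g * h \<in> localize ?V P (?L (k + 1))" if h: "h \<in> localize ?V P (?L k)" for h
  proof -
    obtain q where q: "q \<in> ?L k" "h = subst_one W q"
      using h by (auto simp: localize_def W_def)
    have "monom (sqfree e) * q \<in> ?L (k + 1)"
      using q(1) fe fitting_exps_add_edge[OF G e(1)]
      by (auto simp: mono_span_def keys_monom_mult keys_add_nat keys_sqfree)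
    then have "subst_one W (monom (sqfree e) * q) \<in> localize ?V P (?L (k + 1))"
      unfolding localize_def W_def by blast
    then show ?thesis by (simp add: subst_one_monom_mult g_def q(2))
  qed
  moreover have "monom a * monom g \<notin> localize ?V P (?L (k + 1))"
  proof
    assume "monom a * monom g \<in> localize ?V P (?L (k + 1))"
    then have "packable E i (k + 1) W (Poly_Mapping.lookup (a + g))"
      unfolding monom_mult loc by blast
    then have "packable E i (k + 1) W (\<lambda>x. Poly_Mapping.lookup a x + of_bool (x \<in> e))"
      by (rule packable_mono) (use fe in \<open>auto simp: g_def lookup_add lookup_restrict_exp lookup_sqfree_of_bool\<close>)
    then show False using e(2) by simp
  qed
  ultimately show "\<exists>b. monom b \<in> localize ?V P (edge_ideal n E) \<and>
      (\<forall>h\<in>localize ?V P (?L k). monom b * h \<in> localize ?V P (?L (k + 1))) \<and>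
      monom a * monom b \<notin> localize ?V P (?L (k + 1))"
    by blast
qed

theorem theorem3p6:
  fixes n :: nat and E :: "nat set set" and I :: "'k::field mpoly set"
  assumes "simple_graph n E"
    and "I = edge_ideal n E"
  shows "(homological_strong_persistence {1..n} 0 I \<and> homological_strong_persistence {1..n} 1 I) \<and>
         (homological_persistence {1..n} 0 I \<and> homological_persistence {1..n} 1 I)"
  unfolding assms(2)
  by (intro conjI edge_ideal_strong_persistence edge_ideal_persistence assms(1)) simp_all

end
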